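(* Let $\mathbb{X},\mathbb{Y}\in\mathcal{A}$ be free, self-adjoint, non-degenerate (i.e. not scalar multiples of $\mathbb{I}$) and centered ($\tau(\mathbb{X})=\tau(\mathbb{Y})=0$), with $\tau(\mathbb{X}^2+\mathbb{Y}^2)=1$. Let $\alpha,\beta>0$ with $\alpha+\beta=1$, let $a\in\mathbb{R}$ and $b\ge -1$, and assume in addition that $b\ge\max\{-\alpha,-\beta\}$ if $b<0$. Then $\mathbb{X}/\sqrt{\alpha}$ and $\mathbb{Y}/\sqrt{\beta}$ have the free Meixner laws $\mu_{a/\sqrt{\alpha},\,b/\alpha}$ and $\mu_{a/\sqrt{\beta},\,b/\beta}$, respectively, if and only if $$\tau(\mathbb{X}\,|\,\mathbb{X}+\mathbb{Y})=\alpha(\mathbb{X}+\mathbb{Y})$$ and $$\tau\big((\beta\mathbb{X}-\alpha\mathbb{Y})(\mathbb{X}+\mathbb{Y})(\beta\mathbb{X}-\alpha\mathbb{Y})\,\big|\,\mathbb{X}+\mathbb{Y}\big)=\frac{\alpha\beta}{(b+1)^2}\Big(b^2(\mathbb{X}+\mathbb{Y})^3+2ba(\mathbb{X}+\mathbb{Y})^2+(b+a^2)(\mathbb{X}+\mathbb{Y})+a\,\mathbb{I}\Big).$$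
   Context: $\mathcal{A}$ is a von Neumann algebra with unit $\mathbb{I}$ and a normal faithful tracial state $\tau:\mathcal{A}\to\mathbb{C}$. A random variable is a self-adjoint element of $\mathcal{A}$; its law is the compactly supported probability measure on $\mathbb{R}$ with the same moments. Free cumulants: the multilinear functionals $R_k$ ($k\ge1$) on $\mathcal{A}$ determined recursively by $\tau(\mathbb{X}_1\cdots\mathbb{X}_n)=\sum_{\nu\in NC(n)}\prod_{B\in\nu}R_{|B|}(\mathbb{X}_i:i\in B)$, where $NC(n)$ is the set of non-crossing partitions of $\{1,\dots,n\}$. Random variables $\mathbb{X}_1,\dots,\mathbb{X}_n$ are free if $R_k(\mathbb{Y}_1,\dots,\mathbb{Y}_k)=0$ for every $k$ and every non-constant choice $\mathbb{Y}_1,\dots,\mathbb{Y}_k\in\{\mathbb{X}_1,\dots,\mathbb{X}_n\}$ (this is the usual freeness). Free Meixner laws: for $a\in\mathbb{R}$, $b\ge-1$, $\mu_{a,b}$ is the compactly supported probability measure on $\mathbb{R}$ with Cauchy–Stieltjes transform $$\int_{\mathbb{R}}\frac{1}{z-y}\,\mu_{a,b}(dy)=\frac{(1+2b)z+a-\sqrt{(z-a)^2-4(1+b)}}{2(bz^2+az+1)},\qquad \Im z>0,$$ the branch of the square root being such that the transform maps the upper half plane to the closed lower half plane. It has mean $0$ and variance $1$. Equivalently, its $\mathcal{R}$-transform $\sum_{i\ge0}R_{i+1}z^i$ ($R_i$ being its free cumulants) is $\dfrac{2z}{1-za+\sqrt{(1-za)^2-4z^2b}}$ for small $|z|$, with the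 root chosen so that it tends to $0$ as $z\to0$. Conditional expectation: for self-adjoint $\mathbb{V}\in\mathcal{A}$, $\tau(\cdot|\mathbb{V})$ is the unique $\tau$-preserving conditional expectation of $\mathcal{A}$ onto the von Neumann subalgebra $\mathcal{B}$ generated by $\mathbb{V}$ and $\mathbb{I}$, characterized by $\tau(\mathbb{U}\mathbb{W})=\tau(\tau(\mathbb{U}|\mathbb{V})\mathbb{W})$ for all $\mathbb{W}\in\mathcal{B}$. *)

theory Defs
  imports "HOL-Probability.Probability"
begin

class complex_vector = real_vector +
  fixes scaleC :: "complex \<Rightarrow> 'a \<Rightarrow> 'a"  (infixr "*\<^sub>C" 75)
  assumes scaleC_add_right: "c *\<^sub>C (x + y) = c *\<^sub>C x + c *\<^sub>C y"
    and scaleC_add_left: "(c + d) *\<^sub>C x = c *\<^sub>C x + d *\<^sub>C x"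
    and scaleC_scaleC: "c *\<^sub>C d *\<^sub>C x = (c * d) *\<^sub>C x"
    and scaleC_of_real: "complex_of_real r *\<^sub>C x = r *\<^sub>R x"

text \<open>
  The inner product is linear in its second argument. Positivity and definiteness are part of
  \<open>cinner_self\<close>, and completeness is part of the class \<^class>\<open>banach\<close>.
\<close>

class complex_hilbert = complex_vector + banach +
  fixes cinner :: "'a \<Rightarrow> 'a \<Rightarrow> complex"
  assumes cinner_add_right: "cinner x (y + z) = cinner x y + cinner x z"
    and cinner_scaleC_right: "cinner x (c *\<^sub>C y) = c * cinner x y"
    and cinner_commute: "cinner y x = cnj (cinner x y)"
    and cinner_self: "cinner x x = complex_of_real ((norm x)\<^sup>2)"

typedef (overloaded) 'h bounded_op =
  "{T :: 'h::complex_hilbert \<Rightarrow> 'h. bounded_linear T \<and> (\<forall>c x. T (c *\<^sub>C x) = c *\<^sub>C T x)}"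
  morphisms app_op Abs_op
  by (rule exI[of _ "\<lambda>x. x"]) (simp add: bounded_linear_ident)

setup_lifting type_definition_bounded_op

lemma scaleC_zero_right [simp]: "c *\<^sub>C (0 :: 'a::complex_vector) = 0"
  using scaleC_add_right[of c 0 "0 :: 'a"] by simp

lemma scaleC_minus_right: "c *\<^sub>C (- x) = - (c *\<^sub>C (x :: 'a::complex_vector))"
  using scaleC_add_right[of c x "- x"] by (simp add: add_eq_0_iff)

lemma scaleC_diff_right: "c *\<^sub>C (x - y) = c *\<^sub>C x - c *\<^sub>C (y :: 'a::complex_vector)"
  using scaleC_add_right[of c x "- y"] by (simp add: scaleC_minus_right)

lemma scaleR_scaleC_commute: "r *\<^sub>R c *\<^sub>C x = c *\<^sub>C r *\<^sub>R (x :: 'a::complex_vector)"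
  by (simp flip: scaleC_of_real add: scaleC_scaleC mult.commute)

lemma norm_scaleC: "norm (c *\<^sub>C x) = cmod c * norm (x :: 'h::complex_hilbert)"
proof -
  have "cinner (c *\<^sub>C x) (c *\<^sub>C x) = c * cnj c * cinner x x"
    by (simp only: cinner_scaleC_right cinner_commute[of "c *\<^sub>C x" x])
       (simp add: cinner_self)
  then have "complex_of_real ((norm (c *\<^sub>C x))\<^sup>2) = complex_of_real ((cmod c * norm x)\<^sup>2)"
    by (simp add: cinner_self complex_norm_square[symmetric] power_mult_distrib flip: of_real_power)
  then have "(norm (c *\<^sub>C x))\<^sup>2 = (cmod c * norm x)\<^sup>2"
    using of_real_eq_iff by blast
  then show ?thesis
    by (simp add: power2_eq_iff_nonneg)
qed

lemma bounded_linear_scaleC: "bounded_linear (\<lambda>x :: 'h::complex_hilbert. c *\<^sub>C x)"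
  by (rule bounded_linear_intro[where K = "cmod c"])
     (simp_all add: scaleC_add_right scaleR_scaleC_commute norm_scaleC mult.commute)

instantiation bounded_op :: (complex_hilbert) "{ring, monoid_mult, complex_vector}"
begin

lift_definition zero_bounded_op :: "'a bounded_op" is "\<lambda>x. 0"
  by simp

lift_definition one_bounded_op :: "'a bounded_op" is "\<lambda>x. x"
  by (simp add: bounded_linear_ident)

lift_definition plus_bounded_op :: "'a bounded_op \<Rightarrow> 'a bounded_op \<Rightarrow> 'a bounded_op"
  is "\<lambda>S T x. S x + T x"
  by (auto simp: scaleC_add_right intro: bounded_linear_add)

lift_definition minus_bounded_op :: "'a bounded_op \<Rightarrow> 'a bounded_op \<Rightarrow> 'a bounded_op"
  is "\<lambda>S T x. S x - T x"
  by (auto simp: scaleC_diff_right intro: bounded_linear_sub)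

lift_definition uminus_bounded_op :: "'a bounded_op \<Rightarrow> 'a bounded_op"
  is "\<lambda>T x. - T x"
  by (auto simp: scaleC_minus_right intro: bounded_linear_minus)

lift_definition times_bounded_op :: "'a bounded_op \<Rightarrow> 'a bounded_op \<Rightarrow> 'a bounded_op"
  is "\<lambda>S T x. S (T x)"
  by (auto intro: bounded_linear_compose)

lift_definition scaleR_bounded_op :: "real \<Rightarrow> 'a bounded_op \<Rightarrow> 'a bounded_op"
  is "\<lambda>r T x. r *\<^sub>R T x"
  by (auto simp: scaleR_scaleC_commute intro: bounded_linear_const_scaleR)

lift_definition scaleC_bounded_op :: "complex \<Rightarrow> 'a bounded_op \<Rightarrow> 'a bounded_op"
  is "\<lambda>c T x. c *\<^sub>C T x"
  by (auto simp: scaleC_scaleC mult.commute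
      intro: bounded_linear_compose[OF bounded_linear_scaleC])

instance
proof
  fix S T U :: "'a bounded_op" and c d :: complex and r q :: real
  show "S + T + U = S + (T + U)" "S + T = T + S" "0 + S = S" "- S + S = 0" "S - T = S + - T"
    "S * T * U = S * (T * U)" "(S + T) * U = S * U + T * U" "1 * S = S" "S * 1 = S"
    by (transfer; simp add: fun_eq_iff)+
  show "S * (T + U) = S * T + S * U"
    by transfer (simp add: fun_eq_iff linear_add[OF bounded_linear.linear])
  show "r *\<^sub>R (S + T) = r *\<^sub>R S + r *\<^sub>R T" "(r + q) *\<^sub>R S = r *\<^sub>R S + q *\<^sub>R S"
    "r *\<^sub>R q *\<^sub>R S = (r * q) *\<^sub>R S" "1 *\<^sub>R S = S"
    by (transfer; simp add: fun_eq_iff scaleR_add_right scaleR_add_left)+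
  show "c *\<^sub>C (S + T) = c *\<^sub>C S + c *\<^sub>C T" "(c + d) *\<^sub>C S = c *\<^sub>C S + d *\<^sub>C S"
    "c *\<^sub>C d *\<^sub>C S = (c * d) *\<^sub>C S" "complex_of_real r *\<^sub>C S = r *\<^sub>R S"
    by (transfer; simp add: fun_eq_iff scaleC_add_right scaleC_add_left scaleC_scaleC scaleC_of_real)+
qed

end

text \<open>The operator described here exists and is unique by the Riesz representation theorem.\<close>

definition adj :: "'h::complex_hilbert bounded_op \<Rightarrow> 'h bounded_op" where
  "adj T = (THE S. \<forall>x y. cinner (app_op T x) y = cinner x (app_op S y))"

definition self_adjoint :: "'h::complex_hilbert bounded_op \<Rightarrow> bool" where
  "self_adjoint T \<longleftrightarrow> (\<forall>x y. cinner (app_op T x) y = cinner x (app_op T y))"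

definition commutant :: "'h::complex_hilbert bounded_op set \<Rightarrow> 'h bounded_op set" where
  "commutant M = {T. \<forall>S\<in>M. S * T = T * S}"

text \<open>
  A commutant is automatically a unital subalgebra, so these two conditions say that \<open>M\<close> is a
  unital \<open>*\<close>-algebra of operators which equals its bicommutant.
\<close>

definition von_neumann_algebra :: "'h::complex_hilbert bounded_op set \<Rightarrow> bool" where
  "von_neumann_algebra M \<longleftrightarrow> (\<forall>T\<in>M. adj T \<in> M) \<and> commutant (commutant M) = M"

text \<open>
  The ultraweak (or \<open>\<sigma>\<close>-weak) topology is the coarsest topology for which all functionals
  \<open>T \<mapsto> (\<Sum>n. \<langle>\<eta>\<^sub>n, T \<xi>\<^sub>n\<rangle>)\<close> with square-summable \<open>\<xi>\<close> and \<open>\<eta>\<close> are continuous.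
\<close>

definition ultraweak_topology :: "'h::complex_hilbert bounded_op topology" where
  "ultraweak_topology = topology_generated_by
     {{T. (\<Sum>n. cinner (\<eta> n) (app_op T (\<xi> n))) \<in> G} | \<xi> \<eta> G.
        summable (\<lambda>n::nat. (norm (\<xi> n))\<^sup>2) \<and> summable (\<lambda>n. (norm (\<eta> n))\<^sup>2) \<and> open G}"

text \<open>The state \<open>\<tau>\<close> is a function on all operators, but only its values on \<open>A\<close> matter.\<close>

locale tracial_von_neumann_algebra =
  fixes A :: "'h::complex_hilbert bounded_op set"
    and \<tau> :: "'h bounded_op \<Rightarrow> complex"
  assumes vna: "von_neumann_algebra A"
    and trace_add: "\<lbrakk>S \<in> A; T \<in> A\<rbrakk> \<Longrightarrow> \<tau> (S + T) = \<tau> S + \<tau> T"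
    and trace_scaleC: "T \<in> A \<Longrightarrow> \<tau> (c *\<^sub>C T) = c * \<tau> T"
    and trace_one: "\<tau> 1 = 1"
    and trace_positive: "T \<in> A \<Longrightarrow> \<tau> (adj T * T) \<in> \<real>\<^sub>\<ge>\<^sub>0"
    and trace_faithful: "\<lbrakk>T \<in> A; \<tau> (adj T * T) = 0\<rbrakk> \<Longrightarrow> T = 0"
    and trace_commute: "\<lbrakk>S \<in> A; T \<in> A\<rbrakk> \<Longrightarrow> \<tau> (S * T) = \<tau> (T * S)"
    and trace_normal: "continuous_map (subtopology ultraweak_topology A) euclidean \<tau>"

text \<open>
  \<open>has_cond_exp \<tau> V U E\<close> states that \<open>\<tau>(U|V) = E\<close>, by the property which characterizes the
  \<open>\<tau>\<close>-preserving conditional expectation onto the von Neumann algebra generated by \<open>V\<close> and the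
  unit. Such an \<open>E\<close> exists and is unique in a von Neumann algebra with a normal faithful
  tracial state.
\<close>

definition has_cond_exp ::
  "('h::complex_hilbert bounded_op \<Rightarrow> complex) \<Rightarrow> 'h bounded_op \<Rightarrow> 'h bounded_op \<Rightarrow> 'h bounded_op \<Rightarrow> bool"
  where
  "has_cond_exp \<tau> V U E \<longleftrightarrow>
     E \<in> von_neumann_algebra hull {V, 1} \<and>
     (\<forall>W \<in> von_neumann_algebra hull {V, 1}. \<tau> (U * W) = \<tau> (E * W))"

text \<open>Positions are counted from 0, as in lists.\<close>

definition noncrossing :: "nat set set \<Rightarrow> bool" where
  "noncrossing P \<longleftrightarrow>
     \<not> (\<exists>B\<in>P. \<exists>C\<in>P. B \<noteq> C \<and> (\<exists>i j k l. i < j \<and> j < k \<and> k < l \<and> i \<in> B \<and> k \<in> B \<and> j \<in> C \<and> l \<in> C))"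

definition NC :: "nat \<Rightarrow> nat set set set" where
  "NC n = {P. partition_on {..<n} P \<and> noncrossing P}"

lemma length_nths_block:
  assumes "P \<in> NC (length xs) - {{{..<length xs}}}" and "B \<in> P"
  shows "length (nths xs B) < length xs"
proof -
  have part: "partition_on {..<length xs} P" and ne: "P \<noteq> {{..<length xs}}"
    using assms(1) by (auto simp: NC_def)
  have sub: "B \<subseteq> {..<length xs}"
    using part assms(2) by (auto simp: partition_on_def)
  have "B \<noteq> {..<length xs}"
  proof
    assume B: "B = {..<length xs}"
    have "C = B" if "C \<in> P" for C
    proof (rule ccontr)
      assume "C \<noteq> B"
      then have "C \<inter> B = {}"
        using part that assms(2) by (auto simp: partition_on_def disjoint_def)
      moreover have "C \<subseteq> B" "C \<noteq> {}"
        using part that B by (auto simp: partition_on_def)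
      ultimately show False by blast
    qed
    then show False
      using ne assms(2) B by blast
  qed
  then have "card B < card {..<length xs}"
    using sub by (intro psubset_card_mono) auto
  moreover have "{i. i < length xs \<and> i \<in> B} = B"
    using sub by auto
  ultimately show ?thesis
    by (simp add: length_nths)
qed

text \<open>
  The moment-cumulant formula, solved for the term of the one-block partition: \<open>R\<^sub>n(x\<^sub>1, \<dots>, x\<^sub>n)\<close>
  is \<open>free_cumulant \<tau> [x\<^sub>1, \<dots>, x\<^sub>n]\<close>, for \<open>n \<ge> 1\<close>.
\<close>

function free_cumulant :: "('a::monoid_mult \<Rightarrow> complex) \<Rightarrow> 'a list \<Rightarrow> complex" where
  "free_cumulant \<tau> xs = \<tau> (prod_list xs)
     - (\<Sum>P \<in> NC (length xs) - {{{..<length xs}}}. \<Prod>B\<in>P. free_cumulant \<tau> (nths xs B))"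
  by auto
termination
  by (relation "inv_image less_than (length \<circ> snd)") (use length_nths_block in auto)

declare free_cumulant.simps [simp del]

lemma moment_cumulant_formula:
  assumes "xs \<noteq> []"
  shows "\<tau> (prod_list xs) = (\<Sum>P \<in> NC (length xs). \<Prod>B\<in>P. free_cumulant \<tau> (nths xs B))"
proof -
  have "finite (NC (length xs))"
    by (rule finite_subset[OF _ finitely_many_partition_on[of "{..<length xs}"]])
       (auto simp: NC_def)
  moreover have "{{..<length xs}} \<in> NC (length xs)"
    using assms by (auto simp: NC_def noncrossing_def partition_on_def)
  ultimately show ?thesis
    by (subst sum.remove) (auto simp: free_cumulant.simps[of \<tau> xs] nths_all)
qed

text \<open>
  Free independence of the family of the entries of \<open>xs\<close>. A choice of entries is a list of indices,
  and it is the choice of indices that has to be non-constant, also if \<open>xs\<close> has equal entries.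
\<close>

definition free_rvs :: "('a::monoid_mult \<Rightarrow> complex) \<Rightarrow> 'a list \<Rightarrow> bool" where
  "free_rvs \<tau> xs \<longleftrightarrow>
     (\<forall>is. set is \<subseteq> {..<length xs} \<and> (\<exists>i\<in>set is. \<exists>j\<in>set is. i \<noteq> j)
        \<longrightarrow> free_cumulant \<tau> (map ((!) xs) is) = 0)"

definition compactly_supported :: "real measure \<Rightarrow> bool" where
  "compactly_supported \<mu> \<longleftrightarrow> (\<exists>K. compact K \<and> (AE y in \<mu>. y \<in> K))"

definition has_law :: "('a::monoid_mult \<Rightarrow> complex) \<Rightarrow> 'a \<Rightarrow> real measure \<Rightarrow> bool" where
  "has_law \<tau> X \<mu> \<longleftrightarrow> real_distribution \<mu> \<and> compactly_supported \<mu> \<and>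
     (\<forall>n. \<tau> (X ^ n) = complex_of_real (\<integral>y. y ^ n \<partial>\<mu>))"

definition cauchy_transform :: "real measure \<Rightarrow> complex \<Rightarrow> complex" where
  "cauchy_transform \<mu> z = (\<integral>y. 1 / (z - complex_of_real y) \<partial>\<mu>)"

text \<open>
  \<open>free_meixner a b \<mu>\<close> states that \<open>\<mu>\<close> is the free Meixner law \<open>\<mu>\<^bsub>a,b\<^esub>\<close> (for \<open>b \<ge> -1\<close>). The
  function \<open>s\<close> is the branch of the square root. If \<open>b > 0\<close> and \<open>a\<^sup>2 < 4 * b\<close>, then the denominator
  has a zero in the upper half plane. There the fraction has a removable singularity, but division
  by zero would give the value 0, so this point is left out.
\<close>

definition free_meixner :: "real \<Rightarrow> real \<Rightarrow> real measure \<Rightarrow> bool" where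
  "free_meixner a b \<mu> \<longleftrightarrow> real_distribution \<mu> \<and> compactly_supported \<mu> \<and>
     (\<exists>s. continuous_on {z. Im z > 0} s \<and>
       (\<forall>z. Im z > 0 \<longrightarrow> (s z)\<^sup>2 = (z - of_real a)\<^sup>2 - 4 * (1 + of_real b)) \<and>
       (\<forall>z. Im z > 0 \<and> of_real b * z\<^sup>2 + of_real a * z + 1 \<noteq> 0 \<longrightarrow>
         (let G = ((1 + 2 * of_real b) * z + of_real a - s z)
                  / (2 * (of_real b * z\<^sup>2 + of_real a * z + 1))
          in Im G \<le> 0 \<and> cauchy_transform \<mu> z = G)))"

definition has_free_meixner_law :: "('a::monoid_mult \<Rightarrow> complex) \<Rightarrow> 'a \<Rightarrow> real \<Rightarrow> real \<Rightarrow> bool" where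
  "has_free_meixner_law \<tau> X a b \<longleftrightarrow> (\<exists>\<mu>. free_meixner a b \<mu> \<and> has_law \<tau> X \<mu>)"

end

theory Submission
  imports Defs "HOL-Complex_Analysis.Complex_Analysis" "HOL-Real_Asymp.Real_Asymp"
begin

text \<open>
  Let \<open>S = X + Y\<close>, let \<open>M\<close> be the moment series of \<open>S\<close>, and let \<open>K\<^sub>X\<close>, \<open>K\<^sub>Y\<close> and \<open>K = K\<^sub>X + K\<^sub>Y\<close> be the
  cumulant series of \<open>X\<close>, \<open>Y\<close> and \<open>S\<close>, so that \<open>M = 1 + K(z M)\<close>. Sorting non-crossing partitions by one
  block shows that the moments \<open>\<tau>(X S\<^sup>n)\<close> and \<open>\<tau>((\<beta> X - \<alpha> Y) S (\<beta> X - \<alpha> Y) S\<^sup>n)\<close> are, up to the factor \<open>M\<close>,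
  the coefficients of shifted cumulant series composed with \<open>z M\<close>. The first regression condition thus
  says \<open>K\<^sub>X = \<alpha> K\<close>. Given this, the second one is a cubic equation for \<open>M - 1\<close>, which is a non-zero factor
  times a quadratic equation that amounts to \<open>K = w\<^sup>2 + a w K + b K\<^sup>2\<close>; in the scaling of \<open>X\<close> and \<open>Y\<close>, this is
  the equation for the cumulants of the two free Meixner laws.

  A conditional expectation can be tested on the powers of \<open>S\<close>, because the polynomials in \<open>S\<close> are
  ultraweakly dense in the generated von Neumann algebra. A self-adjoint element has a law by the
  Hausdorff moment problem. This law is a free Meixner law as soon as its Cauchy transform satisfies
  the right quadratic equation near infinity, by analytic continuation.
\<close>

unbundle no vec_syntax
unbundle fps_syntax

subsection \<open>Sums over non-crossing partitions\<close>

text \<open>When a block runs through a word in S, the gap in front of each further block element is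
  again a word in S and contributes M, while the element itself contributes z. This is the source of
  the substitution z M. As z M is invertible under composition, a condition on all powers of S
  becomes an identity between cumulant series. The letter D = \<beta> X - \<alpha> Y is the
  combination whose cumulants with copies of S vanish once K_X = \<alpha> K and K_Y = \<beta> K, so
  that only blocks through both letters D survive. If both laws are free Meixner, then K_X /
  \<alpha> and K_Y / \<beta> solve one quadratic equation, which has only one solution without
  constant term; so both equal K. Two obstacles shape the analytic side. A law asks for a measure,
  which has to be built from the moments of an operator. And ultraweak functionals are infinite sums
  of matrix coefficients; on square-summable sequences of vectors each becomes a single matrix
  coefficient of the amplified operator, so that the classical bicommutant argument with one vector
  applies.\<close>

definition NC_on :: "nat set \<Rightarrow> nat set set set" where
  "NC_on S = {P. partition_on S P \<and> noncrossing P}"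

definition nc_sum :: "(nat set \<Rightarrow> 'a::comm_semiring_1) \<Rightarrow> nat set \<Rightarrow> 'a" where
  "nc_sum f S = (\<Sum>P\<in>NC_on S. \<Prod>B\<in>P. f B)"

text \<open>\<open>U\<close> is the part of one block that has been found so far when the positions
  are read from left to right, hence \<open>U \<subseteq> B\<close> and not \<open>U = B\<close>.
  The set \<open>S\<close> holds the positions still to be read.\<close>

definition nc_block_sum :: "(nat set \<Rightarrow> 'a::comm_semiring_1) \<Rightarrow> nat set \<Rightarrow> nat set \<Rightarrow> 'a" where
  "nc_block_sum f U S = (\<Sum>P | P \<in> NC_on (U \<union> S) \<and> (\<exists>B\<in>P. U \<subseteq> B). \<Prod>B\<in>P. f B)"

lemma noncrossingD:
  "noncrossing P \<Longrightarrow> B \<in> P \<Longrightarrow> C \<in> P \<Longrightarrow> i < j \<Longrightarrow> j < k \<Longrightarrow> k < l \<Longrightarrow>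
    i \<in> B \<Longrightarrow> k \<in> B \<Longrightarrow> j \<in> C \<Longrightarrow> l \<in> C \<Longrightarrow> B = C"
  unfolding noncrossing_def by blast

lemma NC_eq_NC_on: "NC n = NC_on {..<n}"
  by (simp add: NC_def NC_on_def)

lemma finite_NC_on [simp]: "finite S \<Longrightarrow> finite (NC_on S)"
  by (rule finite_subset[OF _ finitely_many_partition_on[of S]]) (auto simp: NC_on_def)

lemma finite_member_NC_on: "finite S \<Longrightarrow> P \<in> NC_on S \<Longrightarrow> finite P"
  by (auto simp: NC_on_def intro: finite_elements)

lemma NC_on_block_subset: "P \<in> NC_on S \<Longrightarrow> B \<in> P \<Longrightarrow> B \<subseteq> S"
  by (auto simp: NC_on_def partition_on_def)

lemma NC_on_block_nonempty: "P \<in> NC_on S \<Longrightarrow> B \<in> P \<Longrightarrow> B \<noteq> {}"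
  by (auto simp: NC_on_def partition_on_def)

lemma NC_on_block_eq: "P \<in> NC_on S \<Longrightarrow> B \<in> P \<Longrightarrow> C \<in> P \<Longrightarrow> x \<in> B \<Longrightarrow> x \<in> C \<Longrightarrow> B = C"
  by (auto simp: NC_on_def partition_on_def disjoint_def)

lemma nc_sum_empty [simp]: "nc_sum f {} = 1"
proof -
  have "NC_on {} = {{}}"
    by (auto simp: NC_on_def partition_on_empty noncrossing_def)
  then show ?thesis by (simp add: nc_sum_def)
qed

text \<open>A crossing between a block of \<open>P\<close> and a block of \<open>Q\<close> needs an
  element of \<open>H\<close> strictly between two elements of \<open>G\<close>, whichever block
  comes first, and \<open>gap\<close> excludes this.\<close>

lemma NC_on_Un:
  assumes P: "P \<in> NC_on G" and Q: "Q \<in> NC_on H"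
    and gap: "\<And>h. h \<in> H \<Longrightarrow> (\<forall>g\<in>G. h < g) \<or> (\<forall>g\<in>G. g < h)"
  shows "P \<union> Q \<in> NC_on (G \<union> H)"
proof -
  have GH: "G \<inter> H = {}" using gap by fastforce
  have sub: "B \<subseteq> G" if "B \<in> P" for B using NC_on_block_subset[OF P that] .
  have sub': "B \<subseteq> H" if "B \<in> Q" for B using NC_on_block_subset[OF Q that] .
  have "partition_on (G \<union> H) (P \<union> Q)"
  proof (rule partition_onI)
    show "\<Union> (P \<union> Q) = G \<union> H"
      using P Q by (auto simp: NC_on_def partition_on_def)
    show "{} \<notin> P \<union> Q"
      using P Q by (auto simp: NC_on_def partition_on_def)
    fix B C assume BC: "B \<in> P \<union> Q" "C \<in> P \<union> Q" "B \<noteq> C"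
    show "disjnt B C"
      unfolding disjnt_iff
    proof (intro allI notI)
      fix x assume x: "x \<in> B \<and> x \<in> C"
      then consider "B \<in> P" "C \<in> P" | "B \<in> Q" "C \<in> Q"
        using BC GH sub sub' by blast
      then show False
        using x BC(3) NC_on_block_eq[OF P, of B C x] NC_on_block_eq[OF Q, of B C x]
        by cases auto
    qed
  qed
  moreover have "noncrossing (P \<union> Q)"
    unfolding noncrossing_def
  proof (intro notI, elim bexE conjE exE)
    fix B C i j k l
    assume *: "B \<in> P \<union> Q" "C \<in> P \<union> Q" "B \<noteq> C" "i < j" "j < k" "k < l"
      "i \<in> B" "k \<in> B" "j \<in> C" "l \<in> (C :: nat set)"
    consider "B \<in> P" "C \<in> P" | "B \<in> Q" "C \<in> Q" | "B \<in> P" "C \<in> Q" | "B \<in> Q" "C \<in> P"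
      using * by blast
    then show False
    proof cases
      case 1
      then show False using P * unfolding NC_on_def noncrossing_def by blast
    next
      case 2
      then show False using Q * unfolding NC_on_def noncrossing_def by blast
    next
      case 3
      then have "i \<in> G" "k \<in> G" "j \<in> H" using * sub sub' by auto
      then show False using gap[of j] * by fastforce
    next
      case 4
      then have "j \<in> G" "l \<in> G" "k \<in> H" using * sub sub' by auto
      then show False using gap[of k] * by fastforce
    qed
  qed
  ultimately show ?thesis by (simp add: NC_on_def)
qed

lemma NC_on_split:
  assumes P: "P \<in> NC_on (G \<union> H)" and GH: "G \<inter> H = {}"
    and blocks: "\<And>B. B \<in> P \<Longrightarrow> B \<subseteq> G \<or> B \<inter> G = {}"
  shows "{B \<in> P. B \<subseteq> G} \<in> NC_on G" "{B \<in> P. \<not> B \<subseteq> G} \<in> NC_on H"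
proof -
  have part: "\<Union>P = G \<union> H" "disjoint P" "{} \<notin> P" and nc: "noncrossing P"
    using P by (auto simp: NC_on_def partition_on_def)
  have nc': "noncrossing {B \<in> P. \<phi> B}" for \<phi>
    using nc unfolding noncrossing_def by blast
  have dis: "disjoint {B \<in> P. \<phi> B}" for \<phi>
    using part(2) by (auto simp: disjoint_def)
  have U1: "\<Union>{B \<in> P. B \<subseteq> G} = G"
  proof (intro equalityI subsetI)
    fix x assume "x \<in> G"
    then obtain B where "B \<in> P" "x \<in> B" using part(1) by blast
    then show "x \<in> \<Union>{B \<in> P. B \<subseteq> G}" using blocks \<open>x \<in> G\<close> by blast
  qed auto
  have U2: "\<Union>{B \<in> P. \<not> B \<subseteq> G} = H"
  proof (intro equalityI subsetI)
    fix x assume "x \<in> H"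
    then obtain B where "B \<in> P" "x \<in> B" using part(1) by blast
    then show "x \<in> \<Union>{B \<in> P. \<not> B \<subseteq> G}" using GH \<open>x \<in> H\<close> by blast
  next
    fix x assume "x \<in> \<Union>{B \<in> P. \<not> B \<subseteq> G}"
    then obtain B where "B \<in> P" "\<not> B \<subseteq> G" "x \<in> B" by blast
    then show "x \<in> H" using blocks[of B] part(1) by blast
  qed
  show "{B \<in> P. B \<subseteq> G} \<in> NC_on G" "{B \<in> P. \<not> B \<subseteq> G} \<in> NC_on H"
    using U1 U2 nc' dis part(3) by (auto simp: NC_on_def partition_on_def)
qed

lemma singleton_in_NC_on: "U \<noteq> {} \<Longrightarrow> {U} \<in> NC_on U"
  by (auto simp: NC_on_def noncrossing_def partition_on_def)

text \<open>
  Either \<open>U\<close> is a block, or the block containing \<open>U\<close> has a smallest element \<open>j\<close> outside \<open>U\<close>;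
  in a non-crossing partition no block leaves the gap between \<open>U\<close> and \<open>j\<close>.
\<close>

lemma nc_block_sum_rec:
  assumes fin: "finite U" "finite S" and ne: "U \<noteq> {}" and less: "\<And>u s. u \<in> U \<Longrightarrow> s \<in> S \<Longrightarrow> u < s"
  shows "nc_block_sum f U S =
    f U * nc_sum f S + (\<Sum>j\<in>S. nc_sum f {s\<in>S. s < j} * nc_block_sum f (insert j U) {s\<in>S. j < s})"
proof -
  define T where "T = {P. P \<in> NC_on (U \<union> S) \<and> (\<exists>B\<in>P. U \<subseteq> B)}"
  define T0 where "T0 = {P. P \<in> NC_on (U \<union> S) \<and> U \<in> P}"
  define T1 where "T1 j = {P. P \<in> NC_on (U \<union> S) \<and> (\<exists>B\<in>P. insert j U \<subseteq> B \<and> B \<inter> {s\<in>S. s < j} = {})}" for j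
  have US: "U \<inter> S = {}" using less by fastforce
  have T_eq: "T = T0 \<union> (\<Union>j\<in>S. T1 j)"
  proof (intro equalityI subsetI)
    fix P assume "P \<in> T"
    then obtain B where P: "P \<in> NC_on (U \<union> S)" and B: "B \<in> P" "U \<subseteq> B" by (auto simp: T_def)
    have BS: "B \<subseteq> U \<union> S" using NC_on_block_subset[OF P B(1)] .
    show "P \<in> T0 \<union> (\<Union>j\<in>S. T1 j)"
    proof (cases "B = U")
      case True
      then show ?thesis using P B by (auto simp: T0_def)
    next
      case False
      define j where "j = (LEAST s. s \<in> B - U)"
      have "\<exists>s. s \<in> B - U" using False B by blast
      then have j: "j \<in> B - U" unfolding j_def by (rule LeastI_ex)
      have min: "s \<notin> B - U" if "s < j" for s using that not_less_Least unfolding j_def by blast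
      have "insert j U \<subseteq> B \<and> B \<inter> {s\<in>S. s < j} = {}"
        using j B min US by blast
      then show ?thesis using P B j BS by (auto simp: T1_def)
    qed
  qed (use US in \<open>auto simp: T_def T0_def T1_def\<close>)
  have fin': "finite (NC_on (U \<union> S))" using fin by simp
  have finT: "finite T0" "finite (T1 j)" for j
    unfolding T0_def T1_def by (rule finite_subset[OF _ fin'], blast)+
  have disj0: "T0 \<inter> (\<Union>j\<in>S. T1 j) = {}"
  proof (rule ccontr)
    assume "T0 \<inter> (\<Union>j\<in>S. T1 j) \<noteq> {}"
    then obtain P j B where *: "P \<in> NC_on (U \<union> S)" "U \<in> P" "j \<in> S" "B \<in> P" "insert j U \<subseteq> B"
      by (auto simp: T0_def T1_def)
    then have "B = U" using NC_on_block_eq[of P "U \<union> S" B U] ne by blast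
    then show False using * US by blast
  qed
  have disj1: "T1 i \<inter> T1 j = {}" if "i \<in> S" "j \<in> S" "i \<noteq> j" for i j
  proof (rule ccontr)
    assume "T1 i \<inter> T1 j \<noteq> {}"
    then obtain P B C where *: "P \<in> NC_on (U \<union> S)" "B \<in> P" "insert i U \<subseteq> B" "B \<inter> {s\<in>S. s < i} = {}"
      "C \<in> P" "insert j U \<subseteq> C" "C \<inter> {s\<in>S. s < j} = {}"
      by (auto simp: T1_def)
    then have "B = C" using NC_on_block_eq[of P "U \<union> S" B C] ne by blast
    then have "i \<in> B" "j \<in> B" using * by auto
    then have "\<not> i < j" "\<not> j < i" using that * \<open>B = C\<close> by blast+
    then show False using that by simp
  qed
  have T1_sum: "(\<Sum>P\<in>T1 j. \<Prod>B\<in>P. f B) = nc_sum f {s\<in>S. s < j} * nc_block_sum f (insert j U) {s\<in>S. j < s}"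
    if j: "j \<in> S" for j
  proof -
    define G where "G = {s\<in>S. s < j}"
    define H where "H = insert j U \<union> {s\<in>S. j < s}"
    define T2 where "T2 = {P. P \<in> NC_on H \<and> (\<exists>B\<in>P. insert j U \<subseteq> B)}"
    have GH: "G \<inter> H = {}" using US by (auto simp: G_def H_def)
    have GHU: "G \<union> H = U \<union> S" using j by (auto simp: G_def H_def)
    have finGH: "finite G" "finite H" using fin by (auto simp: G_def H_def)
    have gap: "(\<forall>g\<in>G. h < g) \<or> (\<forall>g\<in>G. g < h)" if "h \<in> H" for h
      using that less by (auto simp: G_def H_def)
    have "(\<Sum>(P, Q)\<in>NC_on G \<times> T2. (\<Prod>B\<in>P. f B) * (\<Prod>B\<in>Q. f B)) = (\<Sum>P\<in>T1 j. \<Prod>B\<in>P. f B)"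
    proof (rule sum.reindex_bij_witness[where j = "\<lambda>(P, Q). P \<union> Q"
          and i = "\<lambda>P. ({B\<in>P. B \<subseteq> G}, {B\<in>P. \<not> B \<subseteq> G})"])
      fix R assume "R \<in> NC_on G \<times> T2"
      then obtain P Q B where R: "R = (P, Q)" and P: "P \<in> NC_on G" and Q: "Q \<in> NC_on H"
        and B: "B \<in> Q" "insert j U \<subseteq> B"
        by (auto simp: T2_def)
      have QG: "\<not> C \<subseteq> G" if "C \<in> Q" for C
        using NC_on_block_subset[OF Q that] NC_on_block_nonempty[OF Q that] GH by blast
      have PG: "C \<subseteq> G" if "C \<in> P" for C
        using NC_on_block_subset[OF P that] .
      show "({B \<in> case R of (P, Q) \<Rightarrow> P \<union> Q. B \<subseteq> G}, {B \<in> case R of (P, Q) \<Rightarrow> P \<union> Q. \<not> B \<subseteq> G}) = R"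
        unfolding R using QG PG by auto
      have PQ: "P \<union> Q \<in> NC_on (U \<union> S)"
        using NC_on_Un[OF P Q gap] GHU by simp
      have "B \<inter> G = {}" using NC_on_block_subset[OF Q B(1)] GH by blast
      then have "\<exists>B\<in>P \<union> Q. insert j U \<subseteq> B \<and> B \<inter> {s\<in>S. s < j} = {}"
        using B unfolding G_def by (intro bexI[of _ B]) simp_all
      with PQ show "(case R of (P, Q) \<Rightarrow> P \<union> Q) \<in> T1 j"
        unfolding R T1_def by simp
      have "P \<inter> Q = {}" using PG QG by blast
      then show "(\<Prod>B\<in>(case R of (P, Q) \<Rightarrow> P \<union> Q). f B) = (case R of (P, Q) \<Rightarrow> (\<Prod>B\<in>P. f B) * (\<Prod>B\<in>Q. f B))"
        unfolding R using finite_member_NC_on[OF finGH(1) P] finite_member_NC_on[OF finGH(2) Q]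
        by (simp add: prod.union_disjoint)
    next
      fix P assume "P \<in> T1 j"
      then obtain B where P: "P \<in> NC_on (U \<union> S)" and B: "B \<in> P" "insert j U \<subseteq> B" "B \<inter> G = {}"
        unfolding T1_def G_def by blast
      \<comment> \<open>A block that meets the gap \<open>G\<close> and also leaves it would
        alternate with \<open>B\<close> along \<open>u < c < j < d\<close>.\<close>
      have blocks: "C \<subseteq> G \<or> C \<inter> G = {}" if C: "C \<in> P" for C
      proof (rule ccontr)
        assume "\<not> (C \<subseteq> G \<or> C \<inter> G = {})"
        then obtain c d where cd: "c \<in> C" "c \<in> G" "d \<in> C" "d \<notin> G" by blast
        have CB: "C \<noteq> B" using cd B by blast
        then have "C \<inter> B = {}" using NC_on_block_eq[OF P C B(1)] by blast
        then have "d \<notin> insert j U" using cd B by blast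
        moreover have "d \<in> U \<union> S" using NC_on_block_subset[OF P C] cd by blast
        ultimately have d: "j < d" using cd by (auto simp: G_def)
        obtain u where u: "u \<in> U" using ne by blast
        have "noncrossing P" using P by (simp add: NC_on_def)
        moreover have "u < c" "c < j" using u cd less by (auto simp: G_def)
        moreover have "u \<in> B" "j \<in> B" using B u by auto
        ultimately have "B = C" using noncrossingD[of P B C u c j d] B(1) C d cd by blast
        then show False using CB by simp
      qed
      have P': "P \<in> NC_on (G \<union> H)" using P GHU by simp
      show "(case ({B \<in> P. B \<subseteq> G}, {B \<in> P. \<not> B \<subseteq> G}) of (P, Q) \<Rightarrow> P \<union> Q) = P"
        by auto
      have "\<not> B \<subseteq> G" using B ne by blast
      then have "{B \<in> P. \<not> B \<subseteq> G} \<in> T2"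
        using NC_on_split(2)[OF P' GH blocks] B by (auto simp: T2_def)
      then show "({B \<in> P. B \<subseteq> G}, {B \<in> P. \<not> B \<subseteq> G}) \<in> NC_on G \<times> T2"
        using NC_on_split(1)[OF P' GH blocks] by simp
    qed
    moreover have "nc_block_sum f (insert j U) {s\<in>S. j < s} = (\<Sum>P\<in>T2. \<Prod>B\<in>P. f B)"
      by (simp add: nc_block_sum_def T2_def H_def)
    ultimately show ?thesis
      by (simp add: nc_sum_def G_def sum_product sum.cartesian_product)
  qed
  have "nc_block_sum f U S = (\<Sum>P\<in>T. \<Prod>B\<in>P. f B)"
    by (simp add: nc_block_sum_def T_def)
  also have "\<dots> = (\<Sum>P\<in>T0. \<Prod>B\<in>P. f B) + (\<Sum>P\<in>(\<Union>j\<in>S. T1 j). \<Prod>B\<in>P. f B)"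
    unfolding T_eq using fin finT disj0 by (intro sum.union_disjoint) auto
  also have "(\<Sum>P\<in>(\<Union>j\<in>S. T1 j). \<Prod>B\<in>P. f B) = (\<Sum>j\<in>S. \<Sum>P\<in>T1 j. \<Prod>B\<in>P. f B)"
    using fin finT disj1 by (intro sum.UNION_disjoint) auto
  also have "(\<Sum>P\<in>T0. \<Prod>B\<in>P. f B) = f U * nc_sum f S"
  proof -
    have "(\<Sum>P\<in>NC_on S. f U * (\<Prod>B\<in>P. f B)) = (\<Sum>P\<in>T0. \<Prod>B\<in>P. f B)"
    proof (rule sum.reindex_bij_witness[where j = "\<lambda>P. insert U P" and i = "\<lambda>P. {B\<in>P. B \<subseteq> S}"])
      fix P assume P: "P \<in> NC_on S"
      have notin: "U \<notin> P" using NC_on_block_subset[OF P, of U] US ne by blast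
      show "{B \<in> insert U P. B \<subseteq> S} = P"
        using NC_on_block_subset[OF P] US ne by blast
      have "P \<union> {U} \<in> NC_on (S \<union> U)"
        using P singleton_in_NC_on[OF ne] by (rule NC_on_Un) (use less in blast)
      then show "insert U P \<in> T0" by (simp add: T0_def Un_commute)
      show "(\<Prod>B\<in>insert U P. f B) = f U * (\<Prod>B\<in>P. f B)"
        using notin finite_member_NC_on[OF fin(2) P] by simp
    next
      fix P assume "P \<in> T0"
      then have P: "P \<in> NC_on (S \<union> U)" "U \<in> P" by (simp_all add: T0_def Un_commute)
      have eq: "B = U" if "B \<in> P" "B \<inter> U \<noteq> {}" for B
        using that NC_on_block_eq[OF P(1) that(1) P(2)] by blast
      have sub: "B = U \<or> B \<subseteq> S" if "B \<in> P" for B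
        using eq[OF that] NC_on_block_subset[OF P(1) that] by blast
      show "{B \<in> P. B \<subseteq> S} \<in> NC_on S"
        by (rule NC_on_split(1)[OF P(1)]) (use US sub in auto)
      show "insert U {B \<in> P. B \<subseteq> S} = P"
        using sub P(2) by blast
    qed
    then show ?thesis by (simp add: nc_sum_def sum_distrib_left)
  qed
  finally show ?thesis by (simp add: T1_sum)
qed

lemma nc_sum_eq_nc_block_sum:
  assumes "a \<notin> S"
  shows "nc_sum f (insert a S) = nc_block_sum f {a} S"
proof -
  have "\<exists>B\<in>P. a \<in> B" if "P \<in> NC_on (insert a S)" for P
    using that by (auto simp: NC_on_def partition_on_def)
  then have "{P \<in> NC_on ({a} \<union> S). \<exists>B\<in>P. {a} \<subseteq> B} = NC_on (insert a S)" by auto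
  then show ?thesis by (simp add: nc_sum_def nc_block_sum_def)
qed

section \<open>Relabelling positions by increasing maps\<close>

lemma NC_on_image:
  assumes P: "P \<in> NC_on A" and e: "strict_mono_on A e"
  shows "(`) e ` P \<in> NC_on (e ` A)"
proof -
  have inj: "inj_on e A" using e by (rule strict_mono_on_imp_inj_on)
  have sub: "B \<subseteq> A" if "B \<in> P" for B using NC_on_block_subset[OF P that] .
  have part: "partition_on A P" and nc: "noncrossing P" using P by (auto simp: NC_on_def)
  have "{} \<notin> (`) e ` P" using part by (auto simp: partition_on_def)
  then have "(`) e ` P - {{}} = (`) e ` P" by blast
  then have "partition_on (e ` A) ((`) e ` P)"
    using partition_on_inj_image[OF part inj] by simp
  moreover have "noncrossing ((`) e ` P)"
    unfolding noncrossing_def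
  proof (intro notI, elim bexE conjE exE imageE)
    fix B' C' i' j' k' l' B C
    assume *: "B' \<noteq> C'" "i' < j'" "j' < k'" "k' < l'" "i' \<in> B'" "k' \<in> B'" "j' \<in> C'" "l' \<in> C'"
      "B' = e ` B" "B \<in> P" "C' = e ` C" "C \<in> P"
    then obtain i j k l where ijkl: "i \<in> B" "k \<in> B" "j \<in> C" "l \<in> C"
      "i' = e i" "j' = e j" "k' = e k" "l' = e l" by blast
    moreover have "i \<in> A" "j \<in> A" "k \<in> A" "l \<in> A" using ijkl * sub by blast+
    ultimately have "i < j" "j < k" "k < l"
      using * strict_mono_on_less[OF e] by auto
    then show False using nc * ijkl unfolding noncrossing_def by blast
  qed
  ultimately show ?thesis by (simp add: NC_on_def)
qed

lemma nc_sum_image: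
  assumes A: "finite A" and e: "strict_mono_on A e"
  shows "nc_sum f (e ` A) = nc_sum (\<lambda>B. f (e ` B)) A"
proof -
  have inj: "inj_on e A" using e by (rule strict_mono_on_imp_inj_on)
  let ?g = "inv_into A e"
  have g: "strict_mono_on (e ` A) ?g"
  proof (rule strict_mono_onI)
    fix x y assume "x \<in> e ` A" "y \<in> e ` A" "x < y"
    then show "?g x < ?g y"
      using strict_mono_on_less[OF e] inj by auto
  qed
  have gA: "?g ` e ` A = A" using inj by simp
  have ge: "?g ` e ` B = B" if "B \<subseteq> A" for B
    using that inj by simp
  have eg: "e ` ?g ` B = B" if "B \<subseteq> e ` A" for B
    using that image_inv_into_cancel[of e A "e ` A" B] by simp
  have "(\<Sum>P\<in>NC_on A. \<Prod>B\<in>P. f (e ` B)) = (\<Sum>P\<in>NC_on (e ` A). \<Prod>B\<in>P. f B)"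
  proof (rule sum.reindex_bij_witness[where j = "(`) ((`) e)" and i = "(`) ((`) ?g)"])
    fix P assume P: "P \<in> NC_on A"
    note sub = NC_on_block_subset[OF P]
    show "(`) ?g ` (`) e ` P = P"
      unfolding image_image[of "(`) ?g"] using ge[OF sub] by simp
    show "(`) e ` P \<in> NC_on (e ` A)" using NC_on_image[OF P e] .
    have "inj_on ((`) e) P"
      using sub inj by (metis inj_on_image_Pow inj_on_subset PowI subsetI)
    then show "(\<Prod>B\<in>(`) e ` P. f B) = (\<Prod>B\<in>P. f (e ` B))"
      by (simp add: prod.reindex)
  next
    fix P assume P: "P \<in> NC_on (e ` A)"
    note sub = NC_on_block_subset[OF P]
    show "(`) e ` (`) ?g ` P = P"
      unfolding image_image[of "(`) e"] using eg[OF sub] by simp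
    show "(`) ?g ` P \<in> NC_on A" using NC_on_image[OF P g] gA by simp
  qed
  then show ?thesis by (simp add: nc_sum_def)
qed

text \<open>The moment-cumulant formula counts positions within the list at hand. Here a subword
  keeps the positions of the whole word, so that the words in the gaps and the blocks around them
  share one numbering.\<close>

lemma trace_nths_eq_nc_sum:
  assumes one: "\<tau> 1 = 1" and A: "A \<subseteq> {..<length xs}"
  shows "\<tau> (prod_list (nths xs A)) = nc_sum (\<lambda>B. free_cumulant \<tau> (nths xs B)) A"
proof (cases "A = {}")
  case True
  then show ?thesis using one by simp
next
  case False
  have fin: "finite A" using A finite_subset by blast
  \<comment> \<open>\<open>r i\<close> is the place that position \<open>i\<close> of
    \<open>xs\<close> takes in \<open>nths xs A\<close>.\<close>
  define r where "r i = card {i'\<in>A. i' < i}" for i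
  have r: "strict_mono_on A r"
  proof (rule strict_mono_onI)
    fix i j assume "i \<in> A" "j \<in> A" "i < j"
    then show "r i < r j"
      unfolding r_def by (intro psubset_card_mono) (use fin in auto)
  qed
  have inj: "inj_on r A" using r by (rule strict_mono_on_imp_inj_on)
  have "r i < card A" if "i \<in> A" for i
    unfolding r_def using that fin by (intro psubset_card_mono) auto
  then have rA: "r ` A = {..<card A}"
    using inj by (intro card_subset_eq) (auto simp: card_image)
  have "{i. i < length xs \<and> i \<in> A} = A" using A by auto
  then have len: "length (nths xs A) = card A" by (simp add: length_nths)
  then have ne: "nths xs A \<noteq> []" using False fin by auto
  have "\<tau> (prod_list (nths xs A)) = nc_sum (\<lambda>B. free_cumulant \<tau> (nths (nths xs A) B)) (r ` A)"
    by (simp add: moment_cumulant_formula[OF ne] len NC_eq_NC_on rA nc_sum_def)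
  also have "\<dots> = nc_sum (\<lambda>B. free_cumulant \<tau> (nths (nths xs A) (r ` B))) A"
    by (rule nc_sum_image[OF fin r])
  also have "\<dots> = nc_sum (\<lambda>B. free_cumulant \<tau> (nths xs B)) A"
    unfolding nc_sum_def
  proof (intro sum.cong prod.cong refl)
    fix P B assume "P \<in> NC_on A" "B \<in> P"
    then have B: "B \<subseteq> A" using NC_on_block_subset by blast
    have "nths (nths xs A) (r ` B) = nths xs {i \<in> A. r i \<in> r ` B}"
      by (simp add: nths_nths r_def)
    also have "{i \<in> A. r i \<in> r ` B} = B"
      using B inj by (auto dest: inj_onD)
    finally show "free_cumulant \<tau> (nths (nths xs A) (r ` B)) = free_cumulant \<tau> (nths xs B)"
      by simp
  qed
  finally show ?thesis .
qed

text \<open>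
  \<open>block_sum \<tau> us vs\<close> is the part of the moment-cumulant formula for \<open>us @ vs\<close> in which all
  positions of \<open>us\<close> lie in one block. It is organized by the next element of that block.
\<close>

function block_sum :: "('a::monoid_mult \<Rightarrow> complex) \<Rightarrow> 'a list \<Rightarrow> 'a list \<Rightarrow> complex" where
  "block_sum \<tau> us vs = free_cumulant \<tau> us * \<tau> (prod_list vs)
     + (\<Sum>j<length vs. \<tau> (prod_list (take j vs)) * block_sum \<tau> (us @ [vs ! j]) (drop (Suc j) vs))"
  by auto
termination
  by (relation "inv_image less_than (\<lambda>(\<tau>, us, vs). length vs)") auto

declare block_sum.simps [simp del]

lemma nths_insert_greater:
  assumes "\<And>u. u \<in> U \<Longrightarrow> u < j" "j < length xs"
  shows "nths xs (insert j U) = nths xs U @ [xs ! j]"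
proof -
  have "xs = take j xs @ xs ! j # drop (Suc j) xs"
    using assms(2) by (simp add: id_take_nth_drop)
  moreover have "nths (take j xs @ xs ! j # drop (Suc j) xs) (insert j U) =
      nths (take j xs @ xs ! j # drop (Suc j) xs) U @ [xs ! j]"
  proof -
    have 1: "{i. i + j \<in> insert j U} = {0}" "{i. i + j \<in> U} = {}"
      using assms(1) by (fastforce, fastforce)
    have 2: "nths (take j xs) (insert j U) = nths (take j xs) U"
      unfolding nths_def by (intro arg_cong[where f = "map fst"] filter_cong refl)
        (auto dest!: set_zip_rightD)
    show ?thesis
      using assms(2) 1 2 by (simp add: nths_append nths_Cons min_absorb2)
  qed
  ultimately show ?thesis by simp
qed

text \<open>Positions below \<open>k\<close> outside \<open>U\<close> lie in gaps whose moments have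
  already been factored out, so they do not occur here. The induction is on the number of positions
  still to be read.\<close>

lemma nc_block_sum_eq_block_sum:
  assumes one: "\<tau> 1 = 1"
  shows "finite U \<Longrightarrow> U \<noteq> {} \<Longrightarrow> U \<subseteq> {..<k} \<Longrightarrow> k \<le> length xs \<Longrightarrow>
    nc_block_sum (\<lambda>B. free_cumulant \<tau> (nths xs B)) U {k..<length xs}
      = block_sum \<tau> (nths xs U) (drop k xs)"
proof (induction "length xs - k" arbitrary: U k rule: less_induct)
  case less
  let ?f = "\<lambda>B. free_cumulant \<tau> (nths xs B)" and ?n = "length xs"
  have eq_take: "nths xs {k..<j} = take (j - k) (drop k xs)" if "k \<le> j" for j
  proof -
    have "take (j - k) (drop k xs) = drop k (take j xs)" by (simp add: drop_take)
    also have "\<dots> = nths (nths xs {..<j}) {i. k \<le> i}" by (simp add: drop_eq_nths)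
    also have "\<dots> = nths xs {i \<in> {..<j}. k \<le> i}"
    proof -
      have "{i'. i' < j \<and> i' < i} = {..<i}" if "i < j" for i using that by auto
      then show ?thesis unfolding nths_nths by (intro arg_cong2[where f = nths] refl) auto
    qed
    also have "{i \<in> {..<j}. k \<le> i} = {k..<j}" by auto
    finally show ?thesis by simp
  qed
  have W: "nc_sum ?f {k..<j} = \<tau> (prod_list (take (j - k) (drop k xs)))" if "k \<le> j" "j \<le> ?n" for j
    using that by (subst trace_nths_eq_nc_sum[where \<tau> = \<tau> and A = "{k..<j}", OF one, symmetric]) (auto simp: eq_take)
  have "nc_block_sum ?f U {k..<?n} = ?f U * nc_sum ?f {k..<?n} +
     (\<Sum>j\<in>{k..<?n}. nc_sum ?f {s\<in>{k..<?n}. s < j} * nc_block_sum ?f (insert j U) {s\<in>{k..<?n}. j < s})"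
    using less.prems by (intro nc_block_sum_rec) auto
  also have "(\<Sum>j\<in>{k..<?n}. nc_sum ?f {s\<in>{k..<?n}. s < j} * nc_block_sum ?f (insert j U) {s\<in>{k..<?n}. j < s})
     = (\<Sum>j\<in>{k..<?n}. \<tau> (prod_list (take (j - k) (drop k xs))) *
          block_sum \<tau> (nths xs U @ [xs ! j]) (drop (Suc j) xs))"
  proof (rule sum.cong[OF refl])
    fix j assume j: "j \<in> {k..<?n}"
    have s: "{s\<in>{k..<?n}. s < j} = {k..<j}" "{s\<in>{k..<?n}. j < s} = {Suc j..<?n}" using j by auto
    have "nc_block_sum ?f (insert j U) {Suc j..<?n} = block_sum \<tau> (nths xs (insert j U)) (drop (Suc j) xs)"
      using j less.prems by (intro less.hyps) auto
    then show "nc_sum ?f {s\<in>{k..<?n}. s < j} * nc_block_sum ?f (insert j U) {s\<in>{k..<?n}. j < s} =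
        \<tau> (prod_list (take (j - k) (drop k xs))) * block_sum \<tau> (nths xs U @ [xs ! j]) (drop (Suc j) xs)"
      unfolding s using j less.prems W[of j] by (subst (asm) nths_insert_greater) auto
  qed
  also have "\<dots> = (\<Sum>j<length (drop k xs). \<tau> (prod_list (take j (drop k xs))) *
          block_sum \<tau> (nths xs U @ [drop k xs ! j]) (drop (Suc j) (drop k xs)))"
    using less.prems
    by (intro sum.reindex_bij_witness[where i = "\<lambda>j. j + k" and j = "\<lambda>j. j - k"])
       (auto simp: add.commute)
  finally show ?case
    using W[of ?n] less.prems by (simp add: block_sum.simps[of \<tau> "nths xs U"])
qed

text \<open>Position 0 lies in some block of every partition, so starting with this position alone
  loses nothing.\<close>

theorem trace_eq_block_sum:
  assumes one: "\<tau> 1 = 1"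
  shows "\<tau> (prod_list (x # xs)) = block_sum \<tau> [x] xs"
proof -
  let ?ys = "x # xs"
  have ins: "{..<length ?ys} = insert 0 {1..<length ?ys}" by auto
  have "\<tau> (prod_list ?ys) = \<tau> (prod_list (nths ?ys {..<length ?ys}))"
    by (simp add: nths_upt_eq_take del: length_Cons)
  also have "\<dots> = nc_sum (\<lambda>B. free_cumulant \<tau> (nths ?ys B)) {..<length ?ys}"
    by (rule trace_nths_eq_nc_sum[where \<tau> = \<tau>, OF one]) simp
  also have "\<dots> = nc_block_sum (\<lambda>B. free_cumulant \<tau> (nths ?ys B)) {0} {1..<length ?ys}"
    unfolding ins by (rule nc_sum_eq_nc_block_sum) simp
  also have "\<dots> = block_sum \<tau> (nths ?ys {0}) (drop 1 ?ys)"
    by (rule nc_block_sum_eq_block_sum[where \<tau> = \<tau>, OF one]) auto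
  finally show ?thesis by (simp add: nths_Cons)
qed

subsection \<open>Multilinearity of free cumulants\<close>

lemma nths_list_update_notin: "i \<notin> B \<Longrightarrow> nths (xs[i := v]) B = nths xs B"
  by (induction xs arbitrary: i B) (auto simp: nths_Cons split: nat.split)

text \<open>The place \<open>k\<close> must not depend on \<open>v\<close>, since linearity compares
  three lists that differ in this entry.\<close>

lemma nths_list_update_in:
  assumes "i \<in> B" "i < length xs"
  obtains k where "k < length (nths xs B)" "\<And>v. nths (xs[i := v]) B = (nths xs B)[k := v]"
proof
  let ?k = "length (nths (take i xs) B)"
  have *: "nths (xs[i := v]) B = nths (take i xs) B @ v # nths (drop (Suc i) xs) {j. Suc j + i \<in> B}" for v
    using assms by (simp add: upd_conv_take_nth_drop nths_append nths_Cons min_absorb2)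
  from *[of "xs ! i"] have **: "nths xs B = nths (take i xs) B @ xs ! i # nths (drop (Suc i) xs) {j. Suc j + i \<in> B}"
    by simp
  show "?k < length (nths xs B)" unfolding ** by simp
  show "nths (xs[i := v]) B = (nths xs B)[?k := v]" for v
    unfolding * unfolding ** by simp
qed

text \<open>The only partition of the empty set is the empty one. It is not the one-block partition
  that the definition leaves out, so the definition gives \<open>\<tau> 1 - 1\<close>.\<close>

lemma free_cumulant_Nil [simp]: "\<tau> 1 = 1 \<Longrightarrow> free_cumulant \<tau> [] = 0"
proof -
  assume "\<tau> 1 = 1"
  moreover have "NC 0 = {{}}"
    by (auto simp: NC_def partition_on_empty noncrossing_def)
  ultimately show ?thesis by (subst free_cumulant.simps) simp
qed

text \<open>This isolates the algebra behind multilinearity of cumulants from operators.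
  \<open>trace_linear\<close> is linearity in one letter of a word, with real scalars as in the
  combinations of \<open>X\<close> and \<open>Y\<close>.\<close>

locale tracial_linear =
  fixes A :: "'a::{monoid_mult, real_vector} set" and \<tau> :: "'a \<Rightarrow> complex"
  assumes one_mem: "1 \<in> A"
    and mult_mem: "S \<in> A \<Longrightarrow> T \<in> A \<Longrightarrow> S * T \<in> A"
    and trace_one: "\<tau> 1 = 1"
    and trace_linear: "\<lbrakk>P \<in> A; Q \<in> A; S \<in> A; T \<in> A\<rbrakk> \<Longrightarrow>
      \<tau> (P * (c *\<^sub>R S + d *\<^sub>R T) * Q) = complex_of_real c * \<tau> (P * S * Q) + complex_of_real d * \<tau> (P * T * Q)"
begin

lemma prod_list_mem: "set xs \<subseteq> A \<Longrightarrow> prod_list xs \<in> A"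
  by (induction xs) (auto intro: one_mem mult_mem)

text \<open>Position \<open>i\<close> lies in exactly one block of a partition, so a single factor
  of each product depends on the new entry. This factor is linear by induction, because the block is
  shorter than the word.\<close>

lemma free_cumulant_update_linear:
  assumes "set xs \<subseteq> A" "i < length xs" "S \<in> A" "T \<in> A"
  shows "free_cumulant \<tau> (xs[i := c *\<^sub>R S + d *\<^sub>R T]) =
    complex_of_real c * free_cumulant \<tau> (xs[i := S]) + complex_of_real d * free_cumulant \<tau> (xs[i := T])"
  using assms
proof (induction "length xs" arbitrary: xs i rule: less_induct)
  case less
  let ?n = "length xs"
  have trace_eq: "\<tau> (prod_list (xs[i := c *\<^sub>R S + d *\<^sub>R T])) =
    complex_of_real c * \<tau> (prod_list (xs[i := S])) + complex_of_real d * \<tau> (prod_list (xs[i := T]))"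
  proof -
    have "prod_list (xs[i := v]) = prod_list (take i xs) * v * prod_list (drop (Suc i) xs)" for v
      using less.prems by (simp add: upd_conv_take_nth_drop mult.assoc)
    moreover have "prod_list (take i xs) \<in> A" "prod_list (drop (Suc i) xs) \<in> A"
      using less.prems by (meson prod_list_mem set_take_subset set_drop_subset subset_trans)+
    ultimately show ?thesis using less.prems trace_linear by simp
  qed
  have prod_eq: "(\<Prod>B\<in>P. free_cumulant \<tau> (nths (xs[i := c *\<^sub>R S + d *\<^sub>R T]) B)) =
      complex_of_real c * (\<Prod>B\<in>P. free_cumulant \<tau> (nths (xs[i := S]) B))
    + complex_of_real d * (\<Prod>B\<in>P. free_cumulant \<tau> (nths (xs[i := T]) B))"
    if P: "P \<in> NC ?n - {{{..<?n}}}" for P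
  proof -
    have part: "partition_on {..<?n} P" using P by (simp add: NC_def)
    then obtain B0 where B0: "B0 \<in> P" "i \<in> B0"
      using less.prems unfolding partition_on_def by blast
    have notin: "i \<notin> B" if "B \<in> P - {B0}" for B
      using that B0 part by (auto simp: partition_on_def disjoint_def)
    have fin: "finite P" using part by (auto intro: finite_elements)
    have rest: "(\<Prod>B\<in>P. free_cumulant \<tau> (nths (xs[i := v]) B)) = free_cumulant \<tau> (nths (xs[i := v]) B0)
      * (\<Prod>B\<in>P - {B0}. free_cumulant \<tau> (nths xs B))" for v
      using notin by (simp add: prod.remove[OF fin B0(1)] nths_list_update_notin)
    obtain k where k: "k < length (nths xs B0)" "\<And>v. nths (xs[i := v]) B0 = (nths xs B0)[k := v]"
      using nths_list_update_in[OF B0(2) less.prems(2)] by blast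
    have "length (nths xs B0) < ?n" using length_nths_block[OF P B0(1)] .
    moreover have "set (nths xs B0) \<subseteq> A" using set_nths_subset[of xs B0] less.prems(1) by blast
    ultimately show ?thesis
      unfolding rest using less.hyps[of "nths xs B0" k] k less.prems by (simp add: algebra_simps)
  qed
  have E: "free_cumulant \<tau> (xs[i := v]) = \<tau> (prod_list (xs[i := v]))
      - (\<Sum>P \<in> NC ?n - {{{..<?n}}}. \<Prod>B\<in>P. free_cumulant \<tau> (nths (xs[i := v]) B))" for v
    using free_cumulant.simps[of \<tau> "xs[i := v]"] by (simp only: length_list_update)
  define W where "W v = (\<Sum>P \<in> NC ?n - {{{..<?n}}}. \<Prod>B\<in>P. free_cumulant \<tau> (nths (xs[i := v]) B))" for v
  have "W (c *\<^sub>R S + d *\<^sub>R T) = complex_of_real c * W S + complex_of_real d * W T"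
    unfolding W_def sum_distrib_left sum.distrib[symmetric] by (rule sum.cong[OF refl prod_eq])
  with trace_eq show ?case
    unfolding E[folded W_def] by (simp add: algebra_simps)
qed

text \<open>Multilinearity expands the cumulant into words in \<open>X\<close> and \<open>Y\<close>,
  and freeness leaves only the two constant words. All mixed cumulants of X, S and D are
  instances.\<close>

lemma free_cumulant_combination:
  fixes X Y :: 'a and ps :: "(real \<times> real) list"
  defines "comb \<equiv> \<lambda>(p, q). p *\<^sub>R X + q *\<^sub>R Y"
  assumes free: "free_rvs \<tau> [X, Y]" and mem: "\<And>p. comb p \<in> A"
  shows "free_cumulant \<tau> (map comb ps) =
    complex_of_real (prod_list (map fst ps)) * free_cumulant \<tau> (replicate (length ps) X)
    + complex_of_real (prod_list (map snd ps)) * free_cumulant \<tau> (replicate (length ps) Y)"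
proof -
  have XY: "comb (1, 0) = X" "comb (0, 1) = Y" by (simp_all add: comb_def)
  \<comment> \<open>The letters in \<open>zs\<close> are already expanded into \<open>X\<close> or
    \<open>Y\<close>; each step of the induction expands the last letter of \<open>ps\<close> and
    moves it to \<open>zs\<close>.\<close>
  have "set zs \<subseteq> {(1, 0), (0, 1)} \<Longrightarrow> free_cumulant \<tau> (map comb (ps @ zs)) =
      complex_of_real (prod_list (map fst (ps @ zs))) * free_cumulant \<tau> (replicate (length (ps @ zs)) X)
      + complex_of_real (prod_list (map snd (ps @ zs))) * free_cumulant \<tau> (replicate (length (ps @ zs)) Y)" for zs
  proof (induction ps arbitrary: zs rule: rev_induct)
    case Nil
    have rep: "zs = replicate (length zs) c" if "\<forall>z\<in>set zs. z = c" for c :: "real \<times> real"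
      using that by (metis replicate_length_same)
    have "zs = [] \<or> (zs \<noteq> [] \<and> (\<forall>z\<in>set zs. z = (1, 0))) \<or> (zs \<noteq> [] \<and> (\<forall>z\<in>set zs. z = (0, 1)))
        \<or> ((1, 0) \<in> set zs \<and> (0, 1) \<in> set zs)"
      using Nil by blast
    \<comment> \<open>For the empty word both products are 1, and the formula holds because the
      cumulant of the empty list is 0.\<close>
    then consider "zs = []" | n where "zs = replicate (Suc n) (1, 0)" | n where "zs = replicate (Suc n) (0, 1)"
      | "(1, 0) \<in> set zs" "(0, 1) \<in> set zs"
      using rep by (metis length_0_conv not0_implies_Suc)
    then show ?case
    proof cases
      case 4
      \<comment> \<open>If both letters occur, the word of indices is not constant, so freeness
        applies; and each of the two products contains a factor 0.\<close>
      define ids where "ids = map (\<lambda>z. if z = (1, 0) then 0 else 1 :: nat) zs"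
      have "map ((!) [X, Y]) ids = map comb zs"
        using Nil XY by (auto simp: ids_def)
      moreover have "free_cumulant \<tau> (map ((!) [X, Y]) ids) = 0"
      proof (intro free[unfolded free_rvs_def, rule_format] conjI)
        have "0 \<in> set ids" "1 \<in> set ids"
          using 4[THEN imageI, of "\<lambda>z. if z = (1, 0) then 0 else 1 :: nat"] by (simp_all add: ids_def)
        then show "\<exists>i\<in>set ids. \<exists>j\<in>set ids. i \<noteq> j" by (metis zero_neq_one)
      qed (auto simp: ids_def)
      moreover have "prod_list (map fst zs) = 0" "prod_list (map snd zs) = 0"
        using imageI[OF 4(2), of fst] imageI[OF 4(1), of snd] by (simp_all add: prod_list_zero_iff)
      ultimately show ?thesis by simp
    qed (simp_all add: trace_one XY map_replicate_const del: replicate_Suc)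
  next
    case (snoc pq ps)
    obtain p q where pq: "pq = (p, q)" by (cases pq)
    let ?l = "\<lambda>z. map comb (ps @ z # zs)"
    have upd: "(?l (1, 0))[length ps := v] = map comb ps @ v # map comb zs" for v
      by (simp add: list_update_append)
    have "set (?l (1, 0)) \<subseteq> A" using mem by auto
    from free_cumulant_update_linear[OF this, of "length ps" X Y p q]
    have "free_cumulant \<tau> (?l (p, q)) =
        complex_of_real p * free_cumulant \<tau> (?l (1, 0)) + complex_of_real q * free_cumulant \<tau> (?l (0, 1))"
      unfolding upd using mem[of "(1, 0)"] mem[of "(0, 1)"] XY by (simp add: comb_def)
    then show ?case
      using snoc.IH[of "(1, 0) # zs"] snoc.IH[of "(0, 1) # zs"] snoc.prems by (simp add: pq mult_ac)
  qed
  from this[of "[]"] show ?thesis by simp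
qed

end

subsection \<open>Moment and cumulant series\<close>

definition moment_fps :: "('a::monoid_mult \<Rightarrow> complex) \<Rightarrow> 'a \<Rightarrow> complex fps" where
  "moment_fps \<tau> S = Abs_fps (\<lambda>n. \<tau> (S ^ n))"

text \<open>
  For \<open>us = []\<close> the constant coefficient is the cumulant of the empty list. This is a junk value,
  which is 0 if \<open>\<tau> 1 = 1\<close>.
\<close>

definition cumulant_fps :: "('a::monoid_mult \<Rightarrow> complex) \<Rightarrow> 'a list \<Rightarrow> 'a \<Rightarrow> complex fps" where
  "cumulant_fps \<tau> us S = Abs_fps (\<lambda>j. free_cumulant \<tau> (us @ replicate j S))"

text \<open>Each use of the recursion lowers the degree while \<open>k\<close> grows, so the
  induction is on the degree, for all \<open>k\<close> at once. The lemma serves as a uniqueness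
  principle for such recursions.\<close>

lemma fps_eq_0_recI:
  fixes d g :: "nat \<Rightarrow> 'a::idom fps"
  assumes "\<And>k. d k = fps_X * g k * d (Suc k)"
  shows "d k = 0"
proof -
  have "d k $ n = 0" for n k
  proof (induction n arbitrary: k rule: less_induct)
    case (less n)
    have "d k = fps_X * (g k * d (Suc k))" using assms[of k] by (simp add: mult.assoc)
    then have "d k $ n = (fps_X * (g k * d (Suc k))) $ n" by (rule arg_cong)
    also have "\<dots> = (if n = 0 then 0 else (g k * d (Suc k)) $ (n - 1))"
      by simp
    also have "\<dots> = 0"
      unfolding fps_mult_nth using less by simp
    finally show ?case .
  qed
  then show ?thesis by (simp add: fps_eq_iff)
qed

text \<open>Both sides satisfy F(us) = R(us) M + z M F(us @ [S]), where R(us) is the cumulant of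
  \<open>us\<close>: either the block ends with \<open>us\<close>, or a gap contributes M and the
  next block element contributes z. Such a recursion has only one solution.\<close>

lemma block_sum_replicate:
  "Abs_fps (\<lambda>n. block_sum \<tau> us (replicate n S)) =
    moment_fps \<tau> S * (cumulant_fps \<tau> us S oo (fps_X * moment_fps \<tau> S))"
proof -
  let ?M = "moment_fps \<tau> S"
  define c where "c us = Abs_fps (\<lambda>n. block_sum \<tau> us (replicate n S))" for us
  have c: "c us = fps_const (free_cumulant \<tau> us) * ?M + fps_X * ?M * c (us @ [S])" for us
  proof (rule fps_ext)
    fix n
    have "c us $ n = free_cumulant \<tau> us * \<tau> (S ^ n)
        + (\<Sum>j<n. \<tau> (S ^ j) * block_sum \<tau> (us @ [S]) (replicate (n - Suc j) S))"
      by (simp add: c_def block_sum.simps[of \<tau> us] min_absorb1)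
    also have "(\<Sum>j<n. \<tau> (S ^ j) * block_sum \<tau> (us @ [S]) (replicate (n - Suc j) S))
        = (fps_X * (?M * c (us @ [S]))) $ n"
    proof (cases n)
      case (Suc k)
      then have "{..<n} = {0..k}" by auto
      moreover have "(fps_X * (?M * c (us @ [S]))) $ n = (?M * c (us @ [S])) $ k"
        using Suc by simp
      ultimately show ?thesis using Suc by (simp only: fps_mult_nth) (simp add: c_def moment_fps_def)
    qed simp
    finally show "c us $ n = (fps_const (free_cumulant \<tau> us) * ?M + fps_X * ?M * c (us @ [S])) $ n"
      by (simp add: moment_fps_def mult.assoc)
  qed
  define w where "w = fps_X * ?M"
  have w: "w $ 0 = 0" by (simp add: w_def)
  have r: "cumulant_fps \<tau> us S = fps_const (free_cumulant \<tau> us) + fps_X * cumulant_fps \<tau> (us @ [S]) S" for us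
  proof (rule fps_ext)
    fix n
    show "cumulant_fps \<tau> us S $ n = (fps_const (free_cumulant \<tau> us) + fps_X * cumulant_fps \<tau> (us @ [S]) S) $ n"
      by (cases n) (simp_all add: cumulant_fps_def)
  qed
  have r': "cumulant_fps \<tau> us S oo w = fps_const (free_cumulant \<tau> us) + w * (cumulant_fps \<tau> (us @ [S]) S oo w)" for us
    by (subst r) (simp add: fps_compose_add_distrib fps_compose_mult_distrib[OF w] fps_X_fps_compose_startby0[OF w])
  \<comment> \<open>The recursion for one list involves the list with one more \<open>S\<close>, so
    the two sides are compared along this whole sequence of lists.\<close>
  define d where "d k = c (us @ replicate k S) - ?M * (cumulant_fps \<tau> (us @ replicate k S) S oo w)" for k
  have "d k = fps_X * ?M * d (Suc k)" for k
  proof -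
    have rep: "us @ replicate (Suc k) S = (us @ replicate k S) @ [S]"
      by (simp add: replicate_append_same)
    show ?thesis
      unfolding d_def rep c[of "us @ replicate k S"] r'[of "us @ replicate k S"]
      by (simp add: w_def algebra_simps)
  qed
  then have "d 0 = 0" by (rule fps_eq_0_recI)
  then show ?thesis by (simp add: d_def c_def w_def)
qed

lemma prod_list_replicate_eq_power: "prod_list (replicate n x) = (x :: 'a::monoid_mult) ^ n"
  by (induction n) simp_all

lemma trace_mult_power_eq:
  assumes "\<tau> 1 = 1"
  shows "Abs_fps (\<lambda>n. \<tau> (T * S ^ n)) =
    moment_fps \<tau> S * (cumulant_fps \<tau> [T] S oo (fps_X * moment_fps \<tau> S))"
  unfolding block_sum_replicate[symmetric]
  using trace_eq_block_sum[where \<tau> = \<tau> and x = T, OF assms, of "replicate n S" for n]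
  by (simp add: prod_list_replicate_eq_power)

lemma moment_fps_eq:
  assumes one: "\<tau> 1 = 1"
  shows "moment_fps \<tau> S = 1 + (cumulant_fps \<tau> [] S oo (fps_X * moment_fps \<tau> S))"
proof -
  let ?M = "moment_fps \<tau> S" and ?w = "fps_X * moment_fps \<tau> S"
  have w: "?w $ 0 = 0" by simp
  have K: "cumulant_fps \<tau> [] S = fps_X * cumulant_fps \<tau> [S] S"
  proof (rule fps_ext)
    fix n
    show "cumulant_fps \<tau> [] S $ n = (fps_X * cumulant_fps \<tau> [S] S) $ n"
      using one by (cases n) (simp_all add: cumulant_fps_def)
  qed
  have "?M = 1 + fps_X * Abs_fps (\<lambda>n. \<tau> (S * S ^ n))"
  proof (rule fps_ext)
    fix n
    show "?M $ n = (1 + fps_X * Abs_fps (\<lambda>n. \<tau> (S * S ^ n))) $ n"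
      using one by (cases n) (simp_all add: moment_fps_def)
  qed
  also have "fps_X * Abs_fps (\<lambda>n. \<tau> (S * S ^ n)) = cumulant_fps \<tau> [] S oo ?w"
    unfolding trace_mult_power_eq[where \<tau> = \<tau>, OF one] K
    by (simp add: fps_compose_mult_distrib[OF w] fps_X_fps_compose_startby0[OF w] mult.assoc)
  finally show ?thesis .
qed

text \<open>\<open>fps_X * M\<close> has no constant term and a non-zero linear term, so it is
  invertible under composition.\<close>

lemma fps_X_mult_compose_inj:
  fixes M :: "complex fps"
  assumes "M $ 0 \<noteq> 0"
  shows "F oo (fps_X * M) = G oo (fps_X * M) \<longleftrightarrow> F = G"
  by (rule fps_compose_inj_right) (use assms in simp_all)

section \<open>Quadratic equations for moment and cumulant series\<close>

definition moment_quadratic :: "complex \<Rightarrow> complex \<Rightarrow> complex \<Rightarrow> complex fps \<Rightarrow> bool" where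
  "moment_quadratic v a b M \<longleftrightarrow>
    M - 1 = fps_const v * (fps_X * M)\<^sup>2 + fps_const a * fps_X * (M - 1) * M + fps_const b * (M - 1)\<^sup>2"

text \<open>For \<open>v = 1\<close>, the root without constant term is z times the R-transform 2 z
  / (1 - z a + sqrt ((1 - z a)^2 - 4 z^2 b)) of the free Meixner law. Substituting z M for z and M -
  1 for K gives \<open>moment_quadratic\<close>. The parameter \<open>v\<close> is the
  variance.\<close>

definition cumulant_quadratic :: "complex \<Rightarrow> complex \<Rightarrow> complex \<Rightarrow> complex fps \<Rightarrow> bool" where
  "cumulant_quadratic v a b K \<longleftrightarrow>
    K = fps_const v * fps_X\<^sup>2 + fps_const a * fps_X * K + fps_const b * K\<^sup>2"

lemma moment_quadratic_iff_cumulant_quadratic: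
  fixes M K :: "complex fps" and v a b :: complex
  assumes M: "M = 1 + (K oo (fps_X * M))" and K0: "K $ 0 = 0"
  shows "moment_quadratic v a b M \<longleftrightarrow> cumulant_quadratic v a b K"
proof -
  define w where "w = fps_X * M"
  have w: "w $ 0 = 0" by (simp add: w_def)
  have "M $ 0 = 1" by (subst M) (simp add: K0)
  then have M0: "M $ 0 \<noteq> 0" by simp
  have KM: "K oo w = M - 1" using M by (metis add_diff_cancel_left' w_def)
  have X: "fps_X oo w = w" using w by (rule fps_X_fps_compose_startby0)
  have "(fps_const v * fps_X\<^sup>2 + fps_const a * fps_X * K + fps_const b * K\<^sup>2) oo w
     = fps_const v * w\<^sup>2 + fps_const a * w * (M - 1) + fps_const b * (M - 1)\<^sup>2"
    by (simp add: fps_compose_add_distrib fps_compose_mult_distrib[OF w] power2_eq_square KM X)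
  also have "\<dots> = fps_const v * (fps_X * M)\<^sup>2 + fps_const a * fps_X * (M - 1) * M + fps_const b * (M - 1)\<^sup>2"
    by (simp add: w_def algebra_simps)
  finally show ?thesis
    unfolding moment_quadratic_def cumulant_quadratic_def
    using fps_X_mult_compose_inj[OF M0, of K] KM by (metis w_def)
qed

text \<open>
  The cubic relation for \<open>h = M - 1\<close> is the quadratic one times \<open>(b + a X) h + 1 + 2 b + a X\<close>;
  this factor never vanishes, not even for \<open>b = - 1 / 2\<close> and \<open>a = 0\<close>, where it equals \<open>- h / 2\<close>.
\<close>

lemma cubic_iff_quadratic:
  fixes M :: "complex fps" and a b :: complex
  assumes M: "M $ 0 = 1" "M $ 1 = 0" "M $ 2 = 1"
  shows "fps_const ((b + 1)\<^sup>2) * (M - 1 - (fps_X * M)\<^sup>2) =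
      M\<^sup>2 * (fps_const (b\<^sup>2) * (M - 1 - fps_X\<^sup>2) + fps_const (2 * b * a) * fps_X * (M - 1)
        + fps_const (b + a\<^sup>2) * fps_X\<^sup>2 * (M - 1) + fps_const a * fps_X ^ 3 * M)
    \<longleftrightarrow> moment_quadratic 1 a b M" (is "?L = ?R \<longleftrightarrow> _")
proof -
  let ?l = "M - 1" and ?r = "(fps_X * M)\<^sup>2 + fps_const a * fps_X * (M - 1) * M + fps_const b * (M - 1)\<^sup>2"
  define A where "A = fps_const a"
  define B where "B = fps_const b"
  define H where "H = M - 1"
  define F where "F = (B + A * fps_X) * H + 1 + 2 * B + A * fps_X"
  have MH: "M = 1 + H" by (simp add: H_def)
  have const_eqs: "fps_const ((b + 1)\<^sup>2) = (B + 1)\<^sup>2" "fps_const (b\<^sup>2) = B\<^sup>2"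
    "fps_const (2 * b * a) = 2 * B * A" "fps_const (b + a\<^sup>2) = B + A\<^sup>2"
    by (simp_all add: A_def B_def power2_eq_square numeral_fps_const flip: fps_const_add fps_const_mult fps_const_1_eq_1)
  have "?L - ?R = F * (?l - ?r)"
    unfolding const_eqs A_def[symmetric] B_def[symmetric] MH F_def by algebra
  \<comment> \<open>The first three coefficients of \<open>F\<close> are 1 + 2 b, a and b; the first
    and the last are never both 0.\<close>
  moreover have "F \<noteq> 0"
  proof
    assume F: "F = 0"
    have H: "H $ 0 = 0" "H $ 1 = 0" "H $ 2 = 1" using M by (simp_all add: H_def)
    have "F $ 0 = 1 + 2 * b"
      by (simp add: F_def A_def B_def H)
    then have b: "1 + 2 * b = 0" using F by simp
    have "F $ 1 = a"
      using H by (simp add: F_def A_def B_def distrib_right mult.assoc numeral_fps_const)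
    then have a: "a = 0" using F by simp
    have "F $ 2 = b"
      using H a by (simp add: F_def A_def B_def distrib_right mult.assoc numeral_fps_const)
    then have "b = 0" using F by simp
    then show False using b by simp
  qed
  ultimately have "?L = ?R \<longleftrightarrow> ?l = ?r"
    by (metis mult_eq_0_iff right_minus_eq)
  then show ?thesis by (simp add: moment_quadratic_def)
qed

text \<open>The difference of the two equations splits off the factor \<open>K - L\<close>, and the
  cofactor has constant coefficient 1. Thus the vanishing constant term selects one of the two
  roots.\<close>

lemma cumulant_quadratic_unique:
  fixes K L :: "complex fps"
  assumes "cumulant_quadratic v a b K" "K $ 0 = 0" and "cumulant_quadratic v a b L" "L $ 0 = 0"
  shows "K = L"
proof -
  have "(K - L) * (1 - fps_const a * fps_X - fps_const b * (K + L)) =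
      (K - (fps_const v * fps_X\<^sup>2 + fps_const a * fps_X * K + fps_const b * K\<^sup>2))
    - (L - (fps_const v * fps_X\<^sup>2 + fps_const a * fps_X * L + fps_const b * L\<^sup>2))"
    by (simp add: algebra_simps power2_eq_square)
  also have "\<dots> = 0" using assms(1,3) unfolding cumulant_quadratic_def by simp
  finally have "K - L = 0 \<or> 1 - fps_const a * fps_X - fps_const b * (K + L) = 0"
    by simp
  moreover have "(1 - fps_const a * fps_X - fps_const b * (K + L)) $ 0 \<noteq> 0"
    using assms(2,4) by simp
  then have "1 - fps_const a * fps_X - fps_const b * (K + L) \<noteq> 0" by (metis fps_zero_nth)
  ultimately show ?thesis by simp
qed

text \<open>This is the origin of b / \<alpha> and b / \<beta>: if K is multiplied by v, the term b
  K^2 is multiplied by v exactly when b is divided by v.\<close>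

lemma cumulant_quadratic_scale:
  fixes K :: "complex fps"
  assumes "v \<noteq> 0"
  shows "cumulant_quadratic v a (b / v) (fps_const v * K) \<longleftrightarrow> cumulant_quadratic 1 a b K"
proof -
  have "fps_const (b / v) * (fps_const v * K)\<^sup>2 = fps_const v * (fps_const b * K\<^sup>2)"
    using assms by (simp add: power2_eq_square mult_ac flip: fps_const_mult)
  then have "fps_const v * fps_X\<^sup>2 + fps_const a * fps_X * (fps_const v * K) + fps_const (b / v) * (fps_const v * K)\<^sup>2
    = fps_const v * (fps_X\<^sup>2 + fps_const a * fps_X * K + fps_const b * K\<^sup>2)"
    by (simp add: algebra_simps)
  then show ?thesis using assms by (simp add: cumulant_quadratic_def)
qed

text \<open>Multiplying a variable by c replaces z by c z in its moment series. With c = 1 / sqrt v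
  this normalizes the variance v to 1 and turns a into a / sqrt v, while b stays the same.\<close>

lemma moment_quadratic_rescale:
  fixes M :: "complex fps"
  assumes c: "c \<noteq> 0" and N: "\<And>n. N $ n = c ^ n * M $ n"
  shows "moment_quadratic 1 (a * c) b N \<longleftrightarrow> moment_quadratic (1 / c\<^sup>2) a b M"
proof -
  define w where "w = fps_const c * fps_X"
  have w: "w $ 0 = 0" by (simp add: w_def)
  have NM: "N = M oo w"
    by (rule fps_ext) (simp add: N w_def fps_compose_linear)
  have X: "fps_X oo w = w" using w by (rule fps_X_fps_compose_startby0)
  have "(fps_const (1 / c\<^sup>2) * (fps_X * M)\<^sup>2 + fps_const a * fps_X * (M - 1) * M + fps_const b * (M - 1)\<^sup>2) oo w
     = fps_const (1 / c\<^sup>2) * (w * N)\<^sup>2 + fps_const a * w * (N - 1) * N + fps_const b * (N - 1)\<^sup>2"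
    by (simp add: fps_compose_add_distrib fps_compose_sub_distrib fps_compose_mult_distrib[OF w] power2_eq_square NM X)
  also have "fps_const (1 / c\<^sup>2) * (w * N)\<^sup>2 = (fps_const (1 / c\<^sup>2) * fps_const c * fps_const c) * (fps_X * N)\<^sup>2"
    by (simp only: w_def power2_eq_square mult_ac)
  also have "fps_const (1 / c\<^sup>2) * fps_const c * fps_const c = 1"
    using c by (simp add: fps_const_mult power2_eq_square)
  also have "fps_const a * w = fps_const (a * c) * fps_X"
    by (simp add: w_def mult.assoc[symmetric])
  finally have "(fps_const (1 / c\<^sup>2) * (fps_X * M)\<^sup>2 + fps_const a * fps_X * (M - 1) * M + fps_const b * (M - 1)\<^sup>2) oo w
    = (fps_X * N)\<^sup>2 + fps_const (a * c) * fps_X * (N - 1) * N + fps_const b * (N - 1)\<^sup>2" by simp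
  moreover have "(M - 1) oo w = N - 1" by (simp add: fps_compose_sub_distrib NM)
  moreover have "w $ 1 \<noteq> 0" using c by (simp add: w_def)
  ultimately show ?thesis
    unfolding moment_quadratic_def using fps_compose_inj_right[OF w] by (metis fps_const_1_eq_1 mult_1)
qed

text \<open>Up to a constant factor, the left side is the series of the moments of D S D S^n; the
  block through D, S and D has three prescribed letters, hence the shift by 3. \<open>E\<close> is
  the series of the moments of the cubic polynomial in S times S^n.\<close>

lemma conditional_variance_iff_cumulant_quadratic:
  fixes M K E :: "complex fps" and a b :: complex
  assumes M: "M = 1 + (K oo (fps_X * M))" "M $ 1 = 0" "M $ 2 = 1"
    and K: "K $ 0 = 0" "K $ 1 = 0" "K $ 2 = 1" and b: "b + 1 \<noteq> 0"
    and E: "\<And>n. E $ n = b\<^sup>2 * M $ (n + 3) + 2 * b * a * M $ (n + 2) + (b + a\<^sup>2) * M $ (n + 1) + a * M $ n"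
  shows "fps_const ((b + 1)\<^sup>2) * (M * (fps_shift 3 K oo (fps_X * M))) = E \<longleftrightarrow> cumulant_quadratic 1 a b K"
proof -
  define w where "w = fps_X * M"
  have w: "w $ 0 = 0" by (simp add: w_def)
  have M0: "M $ 0 = 1" by (subst M(1)) (simp add: K)
  have X: "fps_X oo w = w" using w by (rule fps_X_fps_compose_startby0)
  have KM: "K oo w = M - 1" using M(1) by (metis add_diff_cancel_left' w_def)
  have coeffs: "K $ Suc 0 = 0" "M $ Suc 0 = 0" using K M(2) by simp_all
  note M23 = M(2,3)
  have "fps_X ^ 3 * fps_shift 3 K = K - fps_X\<^sup>2"
  proof (rule fps_ext)
    fix n :: nat
    consider "n = 0" | "n = 1" | "n = 2" | "n \<ge> 3" by linarith
    then show "(fps_X ^ 3 * fps_shift 3 K) $ n = (K - fps_X\<^sup>2) $ n"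
      by cases (simp_all add: fps_X_power_mult_nth K coeffs)
  qed
  then have "(fps_X ^ 3 * fps_shift 3 K) oo w = (K - fps_X\<^sup>2) oo w" by simp
  then have shift: "w ^ 3 * (fps_shift 3 K oo w) = M - 1 - w\<^sup>2"
    by (simp add: fps_compose_mult_distrib[OF w] fps_compose_sub_distrib KM
        fps_compose_power[OF w, symmetric] X)
  \<comment> \<open>The subtracted terms are the low coefficients 1, 0, 1 of
    \<open>M\<close>.\<close>
  have XE: "fps_X ^ 3 * E = fps_const (b\<^sup>2) * (M - 1 - fps_X\<^sup>2) + fps_const (2 * b * a) * fps_X * (M - 1)
        + fps_const (b + a\<^sup>2) * fps_X\<^sup>2 * (M - 1) + fps_const a * fps_X ^ 3 * M"
  proof (rule fps_ext)
    fix n :: nat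
    consider "n = 0" | "n = 1" | "n = 2" | m where "n = m + 3"
    proof -
      have "n = 0 \<or> n = 1 \<or> n = 2 \<or> n = (n - 3) + 3" by linarith
      then show thesis using that by blast
    qed
    then show "(fps_X ^ 3 * E) $ n = (fps_const (b\<^sup>2) * (M - 1 - fps_X\<^sup>2) + fps_const (2 * b * a) * fps_X * (M - 1)
        + fps_const (b + a\<^sup>2) * fps_X\<^sup>2 * (M - 1) + fps_const a * fps_X ^ 3 * M) $ n"
      by cases (simp_all add: mult.assoc fps_X_power_mult_nth E M0 M23 coeffs)
  qed
  have ne: "fps_X ^ 3 * M\<^sup>2 \<noteq> 0" using M0 by auto
  \<comment> \<open>The factor z^3 M^2 produces w^3 on the left, which undoes the shift: w^3 times
    the composed series is K - z^2 composed with w, that is, M - 1 - w^2.\<close>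
  have "fps_const ((b + 1)\<^sup>2) * (M * (fps_shift 3 K oo w)) = E \<longleftrightarrow>
      (fps_X ^ 3 * M\<^sup>2) * (fps_const ((b + 1)\<^sup>2) * (M * (fps_shift 3 K oo w))) = (fps_X ^ 3 * M\<^sup>2) * E"
    using ne by (metis mult_left_cancel)
  also have "(fps_X ^ 3 * M\<^sup>2) * (fps_const ((b + 1)\<^sup>2) * (M * (fps_shift 3 K oo w)))
      = fps_const ((b + 1)\<^sup>2) * (w ^ 3 * (fps_shift 3 K oo w))"
    by (simp add: w_def power_mult_distrib power2_eq_square power3_eq_cube mult_ac)
  also have "(fps_X ^ 3 * M\<^sup>2) * E = M\<^sup>2 * (fps_X ^ 3 * E)" by (simp only: mult_ac)
  finally show ?thesis
    unfolding shift XE unfolding w_def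
      cubic_iff_quadratic[OF M0 M(2,3)]
    by (simp only: moment_quadratic_iff_cumulant_quadratic[OF M(1) K(1)])
qed

section \<open>Cumulants of one and two letters, and the words D S D S^n\<close>

lemma block_sum_Nil: "block_sum \<tau> us [] = free_cumulant \<tau> us * \<tau> 1"
  by (subst block_sum.simps) simp

lemma free_cumulant_single: "\<tau> 1 = 1 \<Longrightarrow> free_cumulant \<tau> [x] = \<tau> x"
  using trace_eq_block_sum[of \<tau> x "[]"] by (simp add: block_sum_Nil)

lemma free_cumulant_pair:
  assumes one: "\<tau> 1 = 1"
  shows "free_cumulant \<tau> [x, y] = \<tau> (x * y) - \<tau> x * \<tau> y"
proof -
  have "block_sum \<tau> [x] [y] = \<tau> x * \<tau> y + free_cumulant \<tau> [x, y]"
    by (subst block_sum.simps) (simp add: block_sum_Nil free_cumulant_single one)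
  then show ?thesis
    using trace_eq_block_sum[where \<tau> = \<tau> and x = x, OF one, of "[y]"] by simp
qed

text \<open>
  In a non-zero contribution the two letters \<open>D\<close> lie in one block, and so does the letter \<open>S\<close>
  between them, because \<open>S\<close> has mean 0.
\<close>

lemma trace_sandwich_eq:
  assumes one: "\<tau> 1 = 1" and S: "\<tau> S = 0" and D: "\<And>j. free_cumulant \<tau> (D # replicate j S) = 0"
  shows "Abs_fps (\<lambda>n. \<tau> (D * S * D * S ^ n)) =
    moment_fps \<tau> S * (cumulant_fps \<tau> [D, S, D] S oo (fps_X * moment_fps \<tau> S))"
proof -
  have zero: "block_sum \<tau> (D # replicate i S) (replicate n S) = 0" for i n
  proof -
    have "free_cumulant \<tau> (D # replicate i S @ replicate j S) = 0" for j
      using D[of "i + j"] by (simp add: replicate_add)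
    then have "cumulant_fps \<tau> (D # replicate i S) S = 0"
      by (simp add: cumulant_fps_def fps_eq_iff)
    then have "Abs_fps (\<lambda>n. block_sum \<tau> (D # replicate i S) (replicate n S)) = 0"
      by (simp add: block_sum_replicate)
    then show ?thesis by (metis fps_nth_Abs_fps fps_zero_nth)
  qed
  have zero1: "block_sum \<tau> [D, S] (replicate n S) = 0" for n
    using zero[of 1 n] by simp
  have zero2: "block_sum \<tau> [D, S, S] (replicate n S) = 0" for n
    using zero[of 2 n] by (simp add: numeral_2_eq_2)
  have "\<tau> (D * S * D * S ^ n) = block_sum \<tau> [D, S, D] (replicate n S)" for n
  proof -
    have "\<tau> (D * S * D * S ^ n) = block_sum \<tau> [D] (S # D # replicate n S)"
      using trace_eq_block_sum[where \<tau> = \<tau> and x = D, OF one, of "S # D # replicate n S"]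
      by (simp add: prod_list_replicate_eq_power mult.assoc)
    \<comment> \<open>The other terms vanish: D alone has cumulant 0; taking the second D next
      leaves the gap S of mean 0; taking a later S next gives a block with only one D.\<close>
    also have "\<dots> = block_sum \<tau> [D, S] (D # replicate n S)"
      using D[of 0] by (subst block_sum.simps) (simp add: sum.lessThan_Suc_shift one S zero1 del: sum.lessThan_Suc)
    also have "\<dots> = block_sum \<tau> [D, S, D] (replicate n S)"
      using D[of 1] by (subst block_sum.simps) (simp add: sum.lessThan_Suc_shift one zero2 del: sum.lessThan_Suc)
    finally show ?thesis .
  qed
  then show ?thesis by (simp add: block_sum_replicate)
qed

subsection \<open>The Hausdorff moment problem\<close>

locale poly_functional =
  fixes L :: "real poly \<Rightarrow> real"
  assumes add: "L (p + q) = L p + L q" and smult: "L (smult c p) = c * L p" and one: "L 1 = 1"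
begin

lemma zero: "L 0 = 0"
  using smult[of 0 0] by simp

lemma uminus: "L (- p) = - L p"
  using smult[of "- 1" p] by simp

lemma diff: "L (p - q) = L p - L q"
  using add[of p "- q"] uminus[of q] by simp

lemma sum: "L (\<Sum>i\<in>I. f i) = (\<Sum>i\<in>I. L (f i))"
  by (induction I rule: infinite_finite_induct) (simp_all add: zero add)

end

text \<open>Both quantities are products of \<open>j\<close> factors of modulus at most 1, so they
  differ by at most the sum of the differences of the factors.\<close>

lemma binomial_ratio_approx:
  fixes n k j :: nat
  assumes k: "k \<le> n" and n: "2 * j < n"
  shows "\<bar>real (k choose j) / real (n choose j) - (real k / real n) ^ j\<bar> \<le> real j * (real j / (real n - real j))"
proof -
  define z where "z i = (real k - real i) / (real n - real i)" for i
  have choose: "real (m choose j) = (\<Prod>i\<in>{0..<j}. real m - real i) / fact j" for m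
    using gbinomial_mult_fact[of j "real m"] by (simp add: binomial_gbinomial field_simps)
  have ratio: "real (k choose j) / real (n choose j) = (\<Prod>i\<in>{0..<j}. z i)"
    unfolding choose z_def by (simp add: prod_dividef)
  have power: "(real k / real n) ^ j = (\<Prod>i\<in>{0..<j}. real k / real n)" by simp
  have "\<bar>(\<Prod>i\<in>{0..<j}. z i) - (\<Prod>i\<in>{0..<j}. real k / real n)\<bar> \<le> (\<Sum>i\<in>{0..<j}. \<bar>z i - real k / real n\<bar>)"
  proof (rule norm_prod_diff[of "{0..<j}" z "\<lambda>_. real k / real n", unfolded real_norm_def])
    fix i assume i: "i \<in> {0..<j}"
    \<comment> \<open>If \<open>k < i\<close>, this rests on \<open>i \<le> n - i\<close>, which
      comes from \<open>2 * j < n\<close>.\<close>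
    have "\<bar>real k - real i\<bar> \<le> real n - real i" using i k n by auto
    moreover have "real n - real i > 0" using i n by simp
    ultimately show "\<bar>z i\<bar> \<le> 1" by (simp add: z_def abs_divide divide_le_eq)
    show "\<bar>real k / real n\<bar> \<le> 1" using k by (simp add: divide_le_eq)
  qed
  also have "\<dots> \<le> (\<Sum>i\<in>{0..<j}. real j / (real n - real j))"
  proof (rule sum_mono)
    fix i assume i: "i \<in> {0..<j}"
    have pos: "real n - real i > 0" "real n > 0" "real n - real j > 0" using i n by simp_all
    have "z i - real k / real n = - (real i * (real n - real k) / (real n * (real n - real i)))"
      using pos unfolding z_def by (simp add: field_simps)
    then have "\<bar>z i - real k / real n\<bar> = (real i / (real n - real i)) * ((real n - real k) / real n)"
      using pos k by (simp add: abs_mult)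
    also have "\<dots> \<le> (real i / (real n - real i)) * 1"
      using pos k by (intro mult_left_mono) auto
    also have "\<dots> \<le> real j / (real n - real j)"
      using i pos by (auto intro!: frac_le)
    finally show "\<bar>z i - real k / real n\<bar> \<le> real j / (real n - real j)" .
  qed
  finally show ?thesis unfolding ratio power by simp
qed

text \<open>
  The discrete measures with mass \<open>L (B\<^sub>n\<^sub>,\<^sub>k)\<close> at \<open>k / n\<close>, for the Bernstein polynomials \<open>B\<^sub>n\<^sub>,\<^sub>k\<close>, form
  a tight sequence, and each of its weak limits represents \<open>L\<close>.
\<close>

theorem hausdorff_moment_problem:
  fixes L :: "real poly \<Rightarrow> real"
  assumes "poly_functional L"
    and pos: "\<And>k n. k \<le> n \<Longrightarrow> 0 \<le> L ([:0, 1:] ^ k * [:1, -1:] ^ (n - k))"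
  shows "\<exists>\<nu>. real_distribution \<nu> \<and> (AE y in \<nu>. y \<in> {0..1}) \<and> (\<forall>p. (\<integral>y. poly p y \<partial>\<nu>) = L p)"
proof -
  interpret L: poly_functional L by fact
  define B where "B n k = smult (real (n choose k)) ([:0, 1:] ^ k * [:1, -1:] ^ (n - k))" for n k
  define w where "w n k = (if k \<le> n then L (B n k) else 0)" for n k
  have w_nonneg: "0 \<le> w n k" for n k
    using pos[of k n] by (simp add: w_def B_def L.smult)
  have "(\<Sum>k\<le>n. B n k) = ([:0, 1:] + [:1, -1:]) ^ n" for n
    unfolding binomial_ring B_def by (intro sum.cong refl) (simp add: of_nat_poly)
  moreover have "[:0, 1:] + [:1, -1:] = (1 :: real poly)" by (simp add: one_pCons)
  ultimately have B_sum: "(\<Sum>k\<le>n. B n k) = 1" for n by (simp only: power_one)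
  then have w_sum: "(\<Sum>k\<le>n. w n k) = 1" for n
    using L.sum[of "B n" "{..n}"] by (simp add: w_def L.one)
  \<comment> \<open>The binomial moments of the weights are exact for every \<open>n\<close>. The
    power moments only converge, by comparison of binomial ratios with powers.\<close>
  have w_choose: "(\<Sum>k\<le>n. real (k choose j) * w n k) = real (n choose j) * L ([:0, 1:] ^ j)" if j: "j \<le> n" for n j
  proof -
    have "(\<Sum>k\<le>n. smult (real (k choose j)) (B n k)) = smult (real (n choose j)) ([:0, 1:] ^ j)"
    proof -
      have "(\<Sum>k\<le>n. smult (real (k choose j)) (B n k)) = (\<Sum>k\<in>{j..n}. smult (real (k choose j)) (B n k))"
        by (rule sum.mono_neutral_right) (auto simp: not_le)
      also have "\<dots> = (\<Sum>k\<le>n - j. smult (real (n choose j)) ([:0, 1:] ^ j) * B (n - j) k)"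
      proof (rule sum.reindex_bij_witness[where i = "\<lambda>k. k + j" and j = "\<lambda>k. k - j"])
        fix k assume k: "k \<in> {j..n}"
        have "real (n choose k) * real (k choose j) = real (n choose j) * real ((n - j) choose (k - j))"
          using choose_mult[of j k n] k by (metis atLeastAtMost_iff of_nat_mult)
        moreover have "[:0, 1:] ^ k = [:0, 1:] ^ j * [:0, 1::real:] ^ (k - j)"
          using k by (simp flip: power_add)
        moreover have "n - j - (k - j) = n - k" using k by simp
        ultimately show "smult (real (n choose j)) ([:0, 1:] ^ j) * B (n - j) (k - j) = smult (real (k choose j)) (B n k)"
          by (simp add: B_def mult_ac)
      qed (use j in auto)
      also have "\<dots> = smult (real (n choose j)) ([:0, 1:] ^ j)"
        unfolding sum_distrib_left[symmetric] B_sum by simp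
      finally show ?thesis .
    qed
    then have "L (\<Sum>k\<le>n. smult (real (k choose j)) (B n k)) = L (smult (real (n choose j)) ([:0, 1:] ^ j))"
      by simp
    then show ?thesis by (simp add: L.sum L.smult w_def)
  qed
  have w_prob: "(\<integral>\<^sup>+k. ennreal (w n k) \<partial>count_space UNIV) = 1" for n
  proof -
    have "(\<integral>\<^sup>+k. ennreal (w n k) \<partial>count_space UNIV) = (\<Sum>k\<le>n. ennreal (w n k))"
      by (rule nn_integral_count_space') (auto simp: w_def)
    also have "\<dots> = ennreal (\<Sum>k\<le>n. w n k)" using w_nonneg by (simp add: sum_ennreal)
    finally show ?thesis by (simp add: w_sum)
  qed
  define P where "P n = embed_pmf (w n)" for n
  have P: "pmf (P n) k = w n k" for n k
    unfolding P_def by (rule pmf_embed_pmf) (use w_nonneg w_prob in auto)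
  have P_set: "k \<le> n" if "k \<in> set_pmf (P n)" for n k
    using that by (auto simp: set_pmf_eq P w_def split: if_splits)
  define M where "M n = distr (measure_pmf (P n)) borel (\<lambda>k. real k / real n)" for n
  have M: "real_distribution (M n)" for n
    unfolding M_def by (rule prob_space.real_distribution_distr) (auto intro: prob_space_measure_pmf)
  have M_support: "AE y in M n. y \<in> {0..1}" for n
  proof -
    have "{x \<in> space borel. x \<in> {0..1::real}} \<in> sets borel" by simp
    then show ?thesis
      unfolding M_def by (subst AE_distr_iff) (auto simp: AE_measure_pmf_iff divide_le_eq dest: P_set)
  qed
  have M_int: "(\<integral>y. f y \<partial>M n) = (\<Sum>k\<le>n. f (real k / real n) * w n k)" if [measurable]: "f \<in> borel_measurable borel" for f :: "real \<Rightarrow> real" and n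
  proof -
    have "(\<integral>y. f y \<partial>M n) = (\<integral>k. f (real k / real n) \<partial>measure_pmf (P n))"
      unfolding M_def by (rule integral_distr) auto
    also have "\<dots> = (\<Sum>k\<le>n. f (real k / real n) * w n k)"
      by (subst integral_measure_pmf_real[where A = "{..n}"]) (auto simp: P dest: P_set)
    finally show ?thesis .
  qed
  have "tight M"
    unfolding tight_def
  proof (intro conjI allI impI)
    fix \<epsilon> :: real assume "\<epsilon> > 0"
    have "measure (M n) {-1<..1} > 1 - \<epsilon>" for n
    proof -
      interpret real_distribution "M n" by (rule M)
      have "AE y in M n. y \<in> {-1<..1}" using M_support[of n] by eventually_elim auto
      then have "prob {-1<..1} = 1" by (subst prob_eq_1) auto
      then show ?thesis using \<open>\<epsilon> > 0\<close> by simp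
    qed
    then show "\<exists>a b. a < b \<and> (\<forall>n. measure (M n) {a<..b} > 1 - \<epsilon>)"
      by (intro exI[of _ "-1"] exI[of _ 1]) auto
  qed (rule M)
  then obtain r \<nu> where r: "strict_mono (r :: nat \<Rightarrow> nat)" and \<nu>: "real_distribution \<nu>"
    and conv: "weak_conv_m (M \<circ> id \<circ> r) \<nu>"
    using tight_imp_convergent_subsubsequence[of M id] strict_mono_id by blast
  interpret \<nu>: real_distribution \<nu> by (rule \<nu>)
  \<comment> \<open>Weak convergence is tested on bounded continuous functions, and powers are
    unbounded on the line. Clamping changes nothing on \<open>{0..1}\<close>, where all measures
    involved live.\<close>
  define clamp where "clamp y = max 0 (min 1 y)" for y :: real
  have lim: "(\<lambda>n. \<integral>y. f y \<partial>M (r n)) \<longlonglongrightarrow> (\<integral>y. f y \<partial>\<nu>)"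
    if "\<And>x. isCont f x" "\<And>x. norm (f x) \<le> C" for f :: "real \<Rightarrow> real" and C
    using weak_conv_imp_integral_bdd_continuous_conv[of "M \<circ> id \<circ> r" \<nu> f C] M \<nu> conv that by simp
  have support: "AE y in \<nu>. y \<in> {0..1}"
  proof -
    \<comment> \<open>A bounded continuous function that is 0 exactly on
      \<open>{0..1}\<close>.\<close>
    define f where "f y = min 1 \<bar>y - clamp y\<bar>" for y
    have cont: "isCont f x" for x unfolding f_def clamp_def by (intro continuous_intros)
    then have [measurable]: "f \<in> borel_measurable borel"
      by (intro borel_measurable_continuous_onI continuous_at_imp_continuous_on) auto
    have bdd: "norm (f x) \<le> 1" for x by (simp add: f_def)
    have "(\<integral>y. f y \<partial>M (r n)) = 0" for n
    proof -
      have "AE y in M (r n). f y = 0"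
        using M_support[of "r n"] by eventually_elim (simp add: f_def clamp_def)
      then show ?thesis by (rule integral_eq_zero_AE)
    qed
    then have "(\<integral>y. f y \<partial>\<nu>) = 0" using lim[of f, OF cont bdd] by (simp add: LIMSEQ_const_iff)
    moreover have "integrable \<nu> f"
      by (rule \<nu>.integrable_const_bound[where B = 1]) (use bdd in auto)
    moreover have "AE y in \<nu>. 0 \<le> f y" by (simp add: f_def)
    ultimately have "AE y in \<nu>. f y = 0" using integral_nonneg_eq_0_iff_AE by blast
    then show ?thesis by eventually_elim (auto simp: f_def clamp_def min_def max_def split: if_splits)
  qed
  have power: "(\<integral>y. y ^ j \<partial>\<nu>) = L ([:0, 1:] ^ j)" for j
  proof -
    have approx: "\<bar>(\<integral>y. y ^ j \<partial>M n) - L ([:0, 1:] ^ j)\<bar> \<le> real j * (real j / (real n - real j))" if n: "2 * j < n" for n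
    proof -
      have ne: "real (n choose j) > 0" using n by (simp add: zero_less_binomial_iff)
      have "L ([:0, 1:] ^ j) = (\<Sum>k\<le>n. real (k choose j) / real (n choose j) * w n k)"
        using w_choose[of j n] n ne by (simp add: sum_divide_distrib[symmetric] field_simps)
      then have "(\<integral>y. y ^ j \<partial>M n) - L ([:0, 1:] ^ j) =
          (\<Sum>k\<le>n. ((real k / real n) ^ j - real (k choose j) / real (n choose j)) * w n k)"
        by (simp add: M_int sum_subtractf left_diff_distrib)
      also have "\<bar>\<dots>\<bar> \<le> (\<Sum>k\<le>n. \<bar>((real k / real n) ^ j - real (k choose j) / real (n choose j)) * w n k\<bar>)"
        by (rule sum_abs)
      also have "\<dots> \<le> (\<Sum>k\<le>n. real j * (real j / (real n - real j)) * w n k)"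
      proof (rule sum_mono)
        fix k assume "k \<in> {..n}"
        then have "\<bar>(real k / real n) ^ j - real (k choose j) / real (n choose j)\<bar> \<le> real j * (real j / (real n - real j))"
          using binomial_ratio_approx[of k n j] n by (simp only: abs_minus_commute atMost_iff)
        then show "\<bar>((real k / real n) ^ j - real (k choose j) / real (n choose j)) * w n k\<bar>
            \<le> real j * (real j / (real n - real j)) * w n k"
          unfolding abs_mult abs_of_nonneg[OF w_nonneg] by (rule mult_right_mono[OF _ w_nonneg])
      qed
      also have "\<dots> = real j * (real j / (real n - real j))"
        unfolding sum_distrib_left[symmetric] w_sum by simp
      finally show ?thesis .
    qed
    have "(\<lambda>n. real j * (real j / (real n - real j))) \<longlonglongrightarrow> 0" by real_asymp
    then have "(\<lambda>n. (\<integral>y. y ^ j \<partial>M n) - L ([:0, 1:] ^ j)) \<longlonglongrightarrow> 0"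
      by (rule Lim_null_comparison[rotated])
        (use approx in \<open>auto intro!: eventually_mono[OF eventually_gt_at_top[of "2 * j"]]\<close>)
    then have "(\<lambda>n. \<integral>y. y ^ j \<partial>M n) \<longlonglongrightarrow> L ([:0, 1:] ^ j)" by (simp add: LIM_zero_iff)
    then have 1: "(\<lambda>n. \<integral>y. y ^ j \<partial>M (r n)) \<longlonglongrightarrow> L ([:0, 1:] ^ j)"
      using LIMSEQ_subseq_LIMSEQ[OF _ r] by (force simp: o_def)
    have clamp: "clamp y = y" if "y \<in> {0..1}" for y using that by (simp add: clamp_def)
    have cont: "isCont (\<lambda>y. clamp y ^ j) x" for x unfolding clamp_def by (intro continuous_intros)
    then have [measurable]: "(\<lambda>y. clamp y ^ j) \<in> borel_measurable borel"
      by (intro borel_measurable_continuous_onI continuous_at_imp_continuous_on) auto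
    have "norm (clamp y ^ j) \<le> 1" for y by (auto simp: clamp_def intro!: power_le_one)
    from lim[of "\<lambda>y. clamp y ^ j", OF cont this]
    have "(\<lambda>n. \<integral>y. clamp y ^ j \<partial>M (r n)) \<longlonglongrightarrow> (\<integral>y. clamp y ^ j \<partial>\<nu>)" .
    moreover have "(\<integral>y. clamp y ^ j \<partial>M (r n)) = (\<integral>y. y ^ j \<partial>M (r n))" for n
    proof -
      interpret real_distribution "M (r n)" by (rule M)
      show ?thesis
        by (rule integral_cong_AE) (auto intro!: eventually_mono[OF M_support[of "r n"]] simp: clamp)
    qed
    moreover have "(\<integral>y. clamp y ^ j \<partial>\<nu>) = (\<integral>y. y ^ j \<partial>\<nu>)"
      by (rule integral_cong_AE) (auto intro!: eventually_mono[OF support] simp: clamp)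
    ultimately show ?thesis using 1 LIMSEQ_unique by simp
  qed
  have int: "integrable \<nu> (\<lambda>y. y ^ j)" for j
    by (rule \<nu>.integrable_const_bound[where B = 1])
      (auto intro!: eventually_mono[OF support] power_le_one)
  have "(\<integral>y. poly p y \<partial>\<nu>) = L p" for p
  proof -
    have "L p = L (\<Sum>i\<le>degree p. monom (coeff p i) i)" by (simp add: poly_as_sum_of_monoms)
    also have "\<dots> = (\<Sum>i\<le>degree p. coeff p i * L ([:0, 1:] ^ i))"
      by (simp add: L.sum monom_altdef L.smult)
    also have "\<dots> = (\<integral>y. (\<Sum>i\<le>degree p. coeff p i * y ^ i) \<partial>\<nu>)"
      using int by (subst Bochner_Integration.integral_sum) (auto simp: power)
    finally show ?thesis by (simp add: poly_altdef)
  qed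
  then show ?thesis using \<nu> support by blast
qed

lemma pcompose_power: "pcompose (p ^ n) q = pcompose p q ^ n" for p :: "'a::comm_semiring_1 poly"
  by (induction n) (simp_all add: pcompose_1 pcompose_mult)

text \<open>
  By iterated Cauchy-Schwarz, the growth bound implies \<open>\<bar>L (q\<^sup>2 X\<^sup>n)\<bar> \<le> r\<^sup>n L (q\<^sup>2)\<close>, which gives the
  positivity that the Hausdorff moment problem on \<open>[- r, r]\<close> requires.
\<close>

theorem bounded_moment_problem:
  fixes L :: "real poly \<Rightarrow> real"
  assumes L: "poly_functional L"
    and square: "\<And>p. 0 \<le> L (p * p)"
    and r: "r > 0" and bound: "\<And>n. \<bar>L ([:0, 1:] ^ n)\<bar> \<le> C * r ^ n"
  shows "\<exists>\<mu>. real_distribution \<mu> \<and> (AE y in \<mu>. y \<in> {-r..r}) \<and> (\<forall>n. (\<integral>y. y ^ n \<partial>\<mu>) = L ([:0, 1:] ^ n))"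
proof -
  interpret L: poly_functional L by fact
  let ?X = "[:0, 1::real:]"
  have cauchy_schwarz: "(L (p * q))\<^sup>2 \<le> L (p * p) * L (q * q)" for p q
  proof -
    have quad: "0 \<le> L (p * p) + 2 * t * L (p * q) + t\<^sup>2 * L (q * q)" for t
    proof -
      have eq: "(p + smult t q) * (p + smult t q) = p * p + (smult t (p * q) + smult t (p * q)) + smult (t * t) (q * q)"
        by (simp add: distrib_left distrib_right mult.commute)
      have "L ((p + smult t q) * (p + smult t q)) = L (p * p) + (t * L (p * q) + t * L (p * q)) + t * t * L (q * q)"
        unfolding eq by (simp only: L.add L.smult)
      then show ?thesis using square[of "p + smult t q"] by (simp add: power2_eq_square)
    qed
    show ?thesis
    proof (cases "L (q * q) = 0")
      case True
      have "L (p * q) = 0"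
      proof (rule ccontr)
        assume ne: "L (p * q) \<noteq> 0"
        \<comment> \<open>At this argument the quadratic expression takes the value -1.\<close>
        then show False using quad[of "- (L (p * p) + 1) / (2 * L (p * q))"] True
            by (simp add: diff_divide_distrib left_diff_distrib)
      qed
      then show ?thesis using True by simp
    next
      case False
      then have pos: "L (q * q) > 0" using square[of q] by simp
      have "0 \<le> L (p * p) - (L (p * q))\<^sup>2 / L (q * q)"
        using quad[of "- L (p * q) / L (q * q)"] pos by (simp add: power2_eq_square)
      then show ?thesis using pos by (simp add: field_simps)
    qed
  qed
  have growth: "\<bar>L (q * q * ?X ^ n)\<bar> \<le> L (q * q) * r ^ n" for q n
  proof (rule ccontr)
    assume "\<not> ?thesis"
    then have gt: "\<bar>L (q * q * ?X ^ n)\<bar> > L (q * q) * r ^ n" by simp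
    define s where "s m = L (q * q * ?X ^ m)" for m
    \<comment> \<open>If the estimate fails by a factor \<open>t > 1\<close> at exponent
      \<open>n\<close>, every doubling of the exponent squares this factor, which finally
      contradicts the bound \<open>sD\<close> for all exponents.\<close>
    define t where "t = \<bar>s n\<bar> / (L (q * q) * r ^ n)"
    have cs: "(s m)\<^sup>2 \<le> L (q * q) * s (2 * m)" for m
    proof -
      have e: "q * (q * ?X ^ m) = q * q * ?X ^ m" "(q * ?X ^ m) * (q * ?X ^ m) = q * q * ?X ^ (2 * m)"
        unfolding mult_2 power_add by (simp_all only: mult_ac)
      show ?thesis using cauchy_schwarz[of q "q * ?X ^ m"] unfolding s_def e .
    qed
    have s0: "L (q * q) > 0"
    proof (rule ccontr)
      assume "\<not> L (q * q) > 0"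
      then have "L (q * q) = 0" using square[of q] by simp
      then have "s n = 0" using cs[of n] by simp
      then show False using gt \<open>L (q * q) = 0\<close> by (simp add: s_def)
    qed
    have t: "t > 1" using gt s0 r by (simp add: t_def s_def)
    define D where "D = (\<Sum>i\<le>degree (q * q). \<bar>coeff (q * q) i\<bar> * (C * r ^ i))"
    have sD: "\<bar>s m\<bar> \<le> D * r ^ m" for m
    proof -
      have "q * q * ?X ^ m = (\<Sum>i\<le>degree (q * q). monom (coeff (q * q) i) i) * ?X ^ m"
        by (simp add: poly_as_sum_of_monoms)
      also have "\<dots> = (\<Sum>i\<le>degree (q * q). smult (coeff (q * q) i) (?X ^ (i + m)))"
        by (simp add: sum_distrib_right monom_altdef power_add)
      finally have "s m = (\<Sum>i\<le>degree (q * q). coeff (q * q) i * L (?X ^ (i + m)))"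
        by (simp add: s_def L.sum L.smult)
      also have "\<bar>\<dots>\<bar> \<le> (\<Sum>i\<le>degree (q * q). \<bar>coeff (q * q) i\<bar> * (C * r ^ (i + m)))"
        by (rule order_trans[OF sum_abs]) (auto simp: abs_mult intro!: sum_mono mult_left_mono bound)
      also have "\<dots> = D * r ^ m" unfolding D_def sum_distrib_right power_add by (simp only: mult_ac)
      finally show ?thesis .
    qed
    have iter: "L (q * q) * (t * r ^ n) ^ (2 ^ k) \<le> \<bar>s (2 ^ k * n)\<bar>" for k
    proof (induction k)
      case 0
      have "L (q * q) * (t * r ^ n) = \<bar>s n\<bar>" using s0 r by (simp add: t_def)
      then show ?case by simp
    next
      case (Suc k)
      have nonneg: "0 \<le> L (q * q) * (t * r ^ n) ^ (2 ^ k)" using s0 t r by simp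
      have "L (q * q) * (L (q * q) * (t * r ^ n) ^ (2 ^ Suc k)) = (L (q * q) * (t * r ^ n) ^ (2 ^ k))\<^sup>2"
        by (simp add: power2_eq_square power_mult[symmetric] power_add[symmetric] mult_2 mult_ac)
      also have "\<dots> \<le> \<bar>s (2 ^ k * n)\<bar>\<^sup>2"
        using Suc nonneg by (rule power_mono)
      also have "\<dots> \<le> L (q * q) * s (2 ^ Suc k * n)"
        using cs[of "2 ^ k * n"] by (simp add: mult.assoc)
      also have "\<dots> \<le> L (q * q) * \<bar>s (2 ^ Suc k * n)\<bar>" using s0 by simp
      finally show ?case using s0 by (metis mult_le_cancel_left_pos)
    qed
    have bounded: "t ^ k \<le> D / L (q * q)" for k
    proof -
      have "t ^ k \<le> t ^ (2 ^ k)" using t by (intro power_increasing) (auto intro: less_imp_le less_exp)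
      moreover have "L (q * q) * (t * r ^ n) ^ (2 ^ k) \<le> D * r ^ (2 ^ k * n)"
        using iter[of k] sD[of "2 ^ k * n"] by linarith
      then have "(L (q * q) * t ^ (2 ^ k)) * r ^ (2 ^ k * n) \<le> D * r ^ (2 ^ k * n)"
        by (simp add: power_mult_distrib power_mult[symmetric] mult_ac)
      then have "L (q * q) * t ^ (2 ^ k) \<le> D" using r by (simp add: mult_le_cancel_right)
      then have "t ^ (2 ^ k) \<le> D / L (q * q)" using s0 by (simp add: field_simps)
      ultimately show ?thesis by linarith
    qed
    obtain k where "D / L (q * q) < t ^ k" using real_arch_pow[OF t] by blast
    then show False using bounded[of k] by simp
  qed
  \<comment> \<open>\<open>u\<close> maps \<open>{-r..r}\<close> affinely onto
    \<open>{0..1}\<close>, and \<open>v\<close> is 1 - u. They transport the problem to the unit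
    interval.\<close>
  define u where "u = [:1 / 2, 1 / (2 * r):]"
  define v where "v = [:1 / 2, - 1 / (2 * r):]"
  define L' where "L' p = L (pcompose p u)" for p
  have L': "poly_functional L'"
    by standard (simp_all add: L'_def pcompose_add pcompose_smult pcompose_1 L.add L.smult L.one)
  have u: "L (q * q * u) = L (q * q) / 2 + L (q * q * ?X) / (2 * r)"
    and v: "L (q * q * v) = L (q * q) / 2 - L (q * q * ?X) / (2 * r)" for q
  proof -
    have "u = smult (1/2) 1 + smult (1 / (2 * r)) ?X" "v = smult (1/2) 1 - smult (1 / (2 * r)) ?X"
      by (simp_all add: u_def v_def one_pCons)
    then show "L (q * q * u) = L (q * q) / 2 + L (q * q * ?X) / (2 * r)"
      "L (q * q * v) = L (q * q) / 2 - L (q * q * ?X) / (2 * r)"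
      by (simp_all only: distrib_left right_diff_distrib mult_smult_right L.add L.diff L.smult) simp_all
  qed
  have uv: "L (q * q * (u * v)) = L (q * q) / 4 - L (q * q * ?X ^ 2) / (4 * r\<^sup>2)" for q
  proof -
    have "u * v = smult (1/4) 1 - smult (1 / (4 * r\<^sup>2)) (?X ^ 2)"
      by (simp add: u_def v_def one_pCons power2_eq_square)
    then show ?thesis
      by (simp only: distrib_left right_diff_distrib mult_smult_right L.add L.diff L.smult) simp
  qed
  have "0 \<le> L' (?X ^ k * [:1, -1:] ^ (n - k))" if "k \<le> n" for k n
  proof -
    \<comment> \<open>After the square of \<open>q\<close> is split off, the remaining factor is 1,
      u, v or u v. For these, positivity follows from the growth estimate at the exponents 1 and
      2.\<close>
    define q where "q = u ^ (k div 2) * v ^ ((n - k) div 2)"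
    have "pcompose [:1, -1:] u = v" by (simp add: u_def v_def pcompose_pCons)
    moreover have "pcompose ?X u = u" by (simp add: pcompose_pCons)
    ultimately have "L' (?X ^ k * [:1, -1:] ^ (n - k)) = L (u ^ k * v ^ (n - k))"
      by (simp add: L'_def pcompose_mult pcompose_power)
    also have "u ^ k * v ^ (n - k) = q * q * (u ^ (k mod 2) * v ^ ((n - k) mod 2))"
    proof -
      have "x ^ m = x ^ (m div 2) * x ^ (m div 2) * x ^ (m mod 2)" for x :: "real poly" and m
        by (simp flip: power_add mult_2)
      then have "u ^ k * v ^ (n - k) = (u ^ (k div 2) * u ^ (k div 2) * u ^ (k mod 2))
          * (v ^ ((n - k) div 2) * v ^ ((n - k) div 2) * v ^ ((n - k) mod 2))" by metis
      then show ?thesis by (simp only: q_def mult_ac)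
    qed
    finally have eq: "L' (?X ^ k * [:1, -1:] ^ (n - k)) = L (q * q * (u ^ (k mod 2) * v ^ ((n - k) mod 2)))" .
    have g1: "\<bar>L (q * q * ?X)\<bar> / (2 * r) \<le> L (q * q) / 2"
      using growth[of q 1] r by (simp add: field_simps)
    have g2: "\<bar>L (q * q * ?X ^ 2)\<bar> / (4 * r\<^sup>2) \<le> L (q * q) / 4"
      using growth[of q 2] r by (simp add: field_simps)
    have "\<bar>L (q * q * ?X) / (2 * r)\<bar> \<le> L (q * q) / 2" "\<bar>L (q * q * ?X ^ 2) / (4 * r\<^sup>2)\<bar> \<le> L (q * q) / 4"
      using g1 g2 r by (simp_all add: abs_divide)
    then have "0 \<le> L (q * q * u)" "0 \<le> L (q * q * v)" "0 \<le> L (q * q * (u * v))"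
      unfolding u v uv by linarith+
    then show ?thesis
      unfolding eq using square[of q]
      by (cases "even k"; cases "even (n - k)") (simp_all add: even_iff_mod_2_eq_zero odd_iff_mod_2_eq_one)
  qed
  from hausdorff_moment_problem[OF L' this] obtain \<nu> where \<nu>: "real_distribution \<nu>"
    "AE y in \<nu>. y \<in> {0..1}" "\<And>p. (\<integral>y. poly p y \<partial>\<nu>) = L' p" by blast
  interpret \<nu>: real_distribution \<nu> by (rule \<nu>)
  define \<mu> where "\<mu> = distr \<nu> borel (\<lambda>y. 2 * r * y - r)"
  have "real_distribution \<mu>"
    unfolding \<mu>_def by (rule \<nu>.real_distribution_distr) measurable
  moreover have "AE y in \<mu>. y \<in> {-r..r}"
  proof -
    have "AE y in \<nu>. 2 * r * y - r \<in> {-r..r}"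
      using \<nu>(2) by eventually_elim (use r in \<open>auto simp: mult_le_cancel_left1\<close>)
    then show ?thesis unfolding \<mu>_def by (subst AE_distr_iff) auto
  qed
  moreover have "(\<integral>y. y ^ n \<partial>\<mu>) = L (?X ^ n)" for n
  proof -
    have "(\<integral>y. y ^ n \<partial>\<mu>) = (\<integral>y. (2 * r * y - r) ^ n \<partial>\<nu>)"
      unfolding \<mu>_def by (rule integral_distr) auto
    also have "\<dots> = (\<integral>y. poly ([:- r, 2 * r:] ^ n) y \<partial>\<nu>)"
      by (simp add: algebra_simps)
    also have "\<dots> = L' ([:- r, 2 * r:] ^ n)" by (rule \<nu>(3))
    also have "\<dots> = L (pcompose [:- r, 2 * r:] u ^ n)" by (simp only: L'_def pcompose_power)
    also have "pcompose [:- r, 2 * r:] u = ?X" using r by (simp add: u_def pcompose_pCons)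
    finally show ?thesis .
  qed
  ultimately show ?thesis by blast
qed

subsection \<open>Cauchy transforms of free Meixner laws\<close>

text \<open>Convergence at the point and the value are bundled, so that a polynomial expression in
  series can be evaluated by introduction rules alone.\<close>

definition fps_value :: "complex fps \<Rightarrow> complex \<Rightarrow> complex \<Rightarrow> bool" where
  "fps_value F w v \<longleftrightarrow> ereal (cmod w) < fps_conv_radius F \<and> eval_fps F w = v"

lemma fps_value_add: "fps_value F w u \<Longrightarrow> fps_value G w v \<Longrightarrow> fps_value (F + G) w (u + v)"
  using order_less_le_trans[OF _ fps_conv_radius_add, of "ereal (cmod w)" F G]
  by (simp add: fps_value_def eval_fps_add)

lemma fps_value_diff: "fps_value F w u \<Longrightarrow> fps_value G w v \<Longrightarrow> fps_value (F - G) w (u - v)"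
  using order_less_le_trans[OF _ fps_conv_radius_diff, of "ereal (cmod w)" F G]
  by (simp add: fps_value_def eval_fps_diff)

lemma fps_value_mult: "fps_value F w u \<Longrightarrow> fps_value G w v \<Longrightarrow> fps_value (F * G) w (u * v)"
  using order_less_le_trans[OF _ fps_conv_radius_mult, of "ereal (cmod w)" F G]
  by (simp add: fps_value_def eval_fps_mult)

lemma fps_value_const: "fps_value (fps_const c) w c"
  and fps_value_X: "fps_value fps_X w w"
  by (simp_all add: fps_value_def)

lemmas fps_value_intros = fps_value_add fps_value_diff fps_value_mult fps_value_const fps_value_X

locale compact_real_distribution = real_distribution \<mu> for \<mu> :: "real measure" +
  fixes \<rho> :: real
  assumes \<rho>: "\<rho> > 0" and support: "AE y in \<mu>. \<bar>y\<bar> \<le> \<rho>"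
begin

definition moments :: "complex fps" where
  "moments = Abs_fps (\<lambda>n. complex_of_real (\<integral>y. y ^ n \<partial>\<mu>))"

lemma cauchy_transform_sums:
  assumes z: "cmod z > \<rho>"
  shows "(\<lambda>n. moments $ n * (1 / z) ^ Suc n) sums cauchy_transform \<mu> z"
proof -
  define f where "f n y = complex_of_real (y ^ n) * (1 / z) ^ Suc n" for n and y :: real
  have z0: "z \<noteq> 0" "cmod z > 0" using z \<rho> by auto
  have norm_f: "norm (f n y) \<le> (\<rho> / cmod z) ^ n / cmod z" if "\<bar>y\<bar> \<le> \<rho>" for n y
  proof -
    have "norm (f n y) = (\<bar>y\<bar> / cmod z) ^ n / cmod z"
      by (simp add: f_def norm_mult norm_power norm_divide power_divide power_abs)
    also have "\<dots> \<le> (\<rho> / cmod z) ^ n / cmod z"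
      using that z0 by (intro divide_right_mono power_mono) auto
    finally show ?thesis .
  qed
  have geo: "summable (\<lambda>n. (\<rho> / cmod z) ^ n / cmod z)"
    using z \<rho> z0 by (intro summable_divide summable_geometric) (auto simp: divide_less_eq)
  have ae: "AE y in \<mu>. norm (f n y) \<le> (\<rho> / cmod z) ^ n / cmod z" for n
    using support by eventually_elim (rule norm_f)
  have int: "integrable \<mu> (f n)" for n
    by (rule integrable_const_bound[OF ae]) (simp add: f_def)
  have "(\<lambda>n. \<integral>y. f n y \<partial>\<mu>) sums (\<integral>y. (\<Sum>n. f n y) \<partial>\<mu>)"
  proof (rule sums_integral[OF int])
    show "AE y in \<mu>. summable (\<lambda>n. norm (f n y))"
      using support
    proof eventually_elim
      case (elim y)
      then show ?case
        by (intro summable_comparison_test_ev[OF _ geo]) (simp add: norm_f)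
    qed
    show "summable (\<lambda>n. \<integral>y. norm (f n y) \<partial>\<mu>)"
    proof (rule summable_comparison_test_ev[OF _ geo], intro always_eventually allI)
      fix n
      have "(\<integral>y. norm (f n y) \<partial>\<mu>) \<le> (\<rho> / cmod z) ^ n / cmod z"
        by (rule integral_le_const[OF integrable_norm[OF int] ae])
      then show "norm (\<integral>y. norm (f n y) \<partial>\<mu>) \<le> (\<rho> / cmod z) ^ n / cmod z" by simp
    qed
  qed
  also have "(\<integral>y. (\<Sum>n. f n y) \<partial>\<mu>) = cauchy_transform \<mu> z"
    unfolding cauchy_transform_def
  proof (rule integral_cong_AE)
    show "AE y in \<mu>. (\<Sum>n. f n y) = 1 / (z - complex_of_real y)"
      using support
    proof eventually_elim
      case (elim y)
      have "norm (complex_of_real y / z) < 1"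
        using elim z z0 by (simp add: norm_divide divide_less_eq)
      then have "(\<lambda>n. (1 / z) * (complex_of_real y / z) ^ n) sums ((1 / z) * (1 / (1 - complex_of_real y / z)))"
        by (intro sums_mult geometric_sums)
      moreover have "(\<lambda>n. (1 / z) * (complex_of_real y / z) ^ n) = (\<lambda>n. f n y)"
        by (simp add: f_def fun_eq_iff power_divide)
      moreover have "(1 / z) * (1 / (1 - complex_of_real y / z)) = 1 / (z - complex_of_real y)"
        using z0 by (simp add: right_diff_distrib)
      ultimately show ?case by (simp add: sums_iff)
    qed
  qed (simp_all add: f_def)
  also have "(\<lambda>n. \<integral>y. f n y \<partial>\<mu>) = (\<lambda>n. moments $ n * (1 / z) ^ Suc n)"
    unfolding f_def moments_def
    by (simp only: integral_mult_left_zero integral_complex_of_real fps_nth_Abs_fps)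
  finally show ?thesis .
qed

lemma eval_moments:
  assumes "w \<noteq> 0" "cmod w < 1 / \<rho>"
  shows "cauchy_transform \<mu> (1 / w) = w * eval_fps moments w"
proof -
  have "cmod (1 / w) > \<rho>" using assms \<rho> by (simp add: norm_divide field_simps)
  from cauchy_transform_sums[OF this]
  have "(\<lambda>n. w * (moments $ n * w ^ n)) sums cauchy_transform \<mu> (1 / w)"
    by (simp add: mult_ac)
  then have "(\<lambda>n. moments $ n * w ^ n) sums (cauchy_transform \<mu> (1 / w) / w)"
    using sums_mult[of _ _ "1 / w"] assms(1) by fastforce
  then show ?thesis using assms(1) by (simp add: eval_fps_def sums_iff)
qed

lemma conv_radius_moments: "fps_conv_radius moments \<ge> ereal (1 / \<rho>)"
  unfolding fps_conv_radius_def
proof (rule conv_radius_geI_ex')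
  fix r assume r: "0 < r" "ereal r < ereal (1 / \<rho>)"
  define z where "z = complex_of_real (1 / r)"
  have "cmod z > \<rho>" using r \<rho> by (simp add: z_def norm_divide field_simps)
  from cauchy_transform_sums[OF this] have "summable (\<lambda>n. (1 / z) * (moments $ n * (1 / z) ^ n))"
    by (simp add: sums_iff mult_ac)
  then have "summable (\<lambda>n. z * ((1 / z) * (moments $ n * (1 / z) ^ n)))" by (rule summable_mult)
  moreover have "z \<noteq> 0" using r by (simp add: z_def)
  ultimately show "summable (\<lambda>n. moments $ n * complex_of_real r ^ n)"
    by (simp add: z_def)
qed

lemma integrable_cauchy_kernel:
  assumes "Im z > 0"
  shows "integrable \<mu> (\<lambda>y. 1 / (z - complex_of_real y))"
proof (rule integrable_const_bound)
  show "AE y in \<mu>. norm (1 / (z - complex_of_real y)) \<le> 1 / Im z"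
  proof (intro always_eventually allI)
    fix y
    have "Im z \<le> cmod (z - complex_of_real y)"
      using abs_Im_le_cmod[of "z - complex_of_real y"] by simp
    then show "norm (1 / (z - complex_of_real y)) \<le> 1 / Im z"
      using assms by (simp add: norm_divide frac_le)
  qed
qed simp

text \<open>The derivative is minus the integral of the squared kernel \<open>k z\<close>. The
  remainder of the difference quotient is exactly v - z times the integral of
  \<open>k v y * (k z y)\<^sup>2\<close>, and the kernels are bounded by inverse imaginary
  parts.\<close>

lemma holomorphic_cauchy_transform: "cauchy_transform \<mu> holomorphic_on {z. Im z > 0}"
proof (rule holomorphic_onI)
  fix z assume "z \<in> {z. Im z > 0}"
  define d where "d = Im z"
  have d: "d > 0" using \<open>z \<in> _\<close> by (simp add: d_def)
  define k where "k v y = 1 / (v - complex_of_real y)" for v y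
  have lower: "Im v \<le> cmod (v - complex_of_real y)" for v y
    using abs_Im_le_cmod[of "v - complex_of_real y"] by simp
  have norm_k: "norm (k v y) \<le> 1 / e" if "e > 0" "Im v \<ge> e" for v y e
    using lower[of v y] that by (simp add: k_def norm_divide frac_le)
  have int: "integrable \<mu> (k v)" if "Im v > 0" for v
    unfolding k_def using that by (rule integrable_cauchy_kernel)
  have int2: "integrable \<mu> (\<lambda>y. (k z y)\<^sup>2)"
  proof (rule integrable_const_bound)
    show "AE y in \<mu>. norm ((k z y)\<^sup>2) \<le> (1 / d)\<^sup>2"
      unfolding norm_power using norm_k[OF d] by (intro always_eventually allI power_mono) (simp_all add: d_def)
  qed (simp add: k_def)
  define D where "D = - (\<integral>y. (k z y)\<^sup>2 \<partial>\<mu>)"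
  have bound: "norm ((cauchy_transform \<mu> v - cauchy_transform \<mu> z) / (v - z) - D) \<le> (2 / d * (1 / d)\<^sup>2) * norm (v - z)"
    if v: "v \<noteq> z" "dist v z < d / 2" for v
  proof -
    have "\<bar>Im v - Im z\<bar> < d / 2"
      using v(2) abs_Im_le_cmod[of "v - z"] by (simp add: dist_norm)
    then have Imv: "Im v \<ge> d / 2" unfolding d_def by linarith
    have ne: "v - complex_of_real y \<noteq> 0" "z - complex_of_real y \<noteq> 0" for y
      using lower[of v y] lower[of z y] Imv d by (auto simp: d_def)
    have k_eq: "(k v y - k z y) / (v - z) + (k z y)\<^sup>2 = (v - z) * (k v y * (k z y)\<^sup>2)" for y
    proof -
      have "k v y - k z y = - (v - z) * (k v y * k z y)"
        using ne[of y] by (simp add: k_def field_simps)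
      then have "k v y - k z y = (v - z) * (- (k v y * k z y))"
        by (simp only: minus_mult_commute)
      moreover have "v - z \<noteq> 0" using v(1) by simp
      ultimately have "(k v y - k z y) / (v - z) = - (k v y * k z y)"
        by (metis nonzero_mult_div_cancel_left)
      moreover have "(v - z) * (k v y * k z y) = k z y - k v y"
        using ne[of y] by (simp add: k_def field_simps)
      then have "(v - z) * (k v y * k z y) * k z y = (k z y - k v y) * k z y" by simp
      ultimately show ?thesis by (simp add: power2_eq_square algebra_simps)
    qed
    have "(cauchy_transform \<mu> v - cauchy_transform \<mu> z) / (v - z) - D =
        (\<integral>y. (k v y - k z y) / (v - z) + (k z y)\<^sup>2 \<partial>\<mu>)"
      using int[of v] int[of z] int2 Imv d
      by (simp add: D_def cauchy_transform_def d_def k_def[symmetric])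
    also have "\<dots> = (\<integral>y. (v - z) * (k v y * (k z y)\<^sup>2) \<partial>\<mu>)" unfolding k_eq ..
    also have "norm \<dots> \<le> (\<integral>y. norm (v - z) * (2 / d * (1 / d)\<^sup>2) \<partial>\<mu>)"
    proof (rule Bochner_Integration.integral_norm_bound_integral)
      have nb: "norm ((v - z) * (k v y * (k z y)\<^sup>2)) \<le> norm (v - z) * (2 / d * (1 / d)\<^sup>2)" for y
      proof -
        have "norm (k v y) \<le> 2 / d" using norm_k[of "d / 2" v y] Imv d by simp
        moreover have "norm ((k z y)\<^sup>2) \<le> (1 / d)\<^sup>2"
          unfolding norm_power using norm_k[OF d, of z y] by (intro power_mono) (simp_all add: d_def)
        ultimately show ?thesis
          unfolding norm_mult using d by (intro mult_left_mono mult_mono) auto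
      qed
      show "integrable \<mu> (\<lambda>y. (v - z) * (k v y * (k z y)\<^sup>2))"
        by (rule integrable_const_bound[OF always_eventually]) (use nb in \<open>auto simp: k_def\<close>)
      show "integrable \<mu> (\<lambda>y. norm (v - z) * (2 / d * (1 / d)\<^sup>2))" by simp
      show "norm ((v - z) * (k v y * (k z y)\<^sup>2)) \<le> norm (v - z) * (2 / d * (1 / d)\<^sup>2)" for y
        by (rule nb)
    qed
    also have "\<dots> = (2 / d * (1 / d)\<^sup>2) * norm (v - z)" using prob_space by simp
    finally show ?thesis .
  qed
  have "((\<lambda>v. (2 / d * (1 / d)\<^sup>2) * norm (v - z)) \<longlongrightarrow> (2 / d * (1 / d)\<^sup>2) * norm (z - z)) (at z)"
    by (intro tendsto_intros)
  then have "((\<lambda>v. (2 / d * (1 / d)\<^sup>2) * norm (v - z)) \<longlongrightarrow> 0) (at z)" by simp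
  moreover have "\<forall>\<^sub>F v in at z. norm ((cauchy_transform \<mu> v - cauchy_transform \<mu> z) / (v - z) - D) \<le> (2 / d * (1 / d)\<^sup>2) * norm (v - z)"
    unfolding eventually_at using bound d by (intro exI[of _ "d / 2"]) auto
  ultimately have "((\<lambda>v. (cauchy_transform \<mu> v - cauchy_transform \<mu> z) / (v - z) - D) \<longlongrightarrow> 0) (at z)"
    by (rule Lim_null_comparison[rotated])
  then have "(cauchy_transform \<mu> has_field_derivative D) (at z)"
    unfolding has_field_derivative_iff by (rule LIM_zero_cancel)
  then show "cauchy_transform \<mu> field_differentiable at z within {z. Im z > 0}"
    unfolding field_differentiable_def by (blast intro: has_field_derivative_at_within)
qed

lemma Im_cauchy_transform_nonpos:
  assumes "Im z > 0"
  shows "Im (cauchy_transform \<mu> z) \<le> 0"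
proof -
  note int = integrable_cauchy_kernel[OF assms]
  have "Im (cauchy_transform \<mu> z) = (\<integral>y. Im (1 / (z - complex_of_real y)) \<partial>\<mu>)"
    unfolding cauchy_transform_def using int by simp
  moreover have "0 \<le> (\<integral>y. - Im (1 / (z - complex_of_real y)) \<partial>\<mu>)"
    using assms by (intro Bochner_Integration.integral_nonneg) (simp add: Im_divide)
  ultimately show ?thesis by simp
qed

text \<open>The formula for the transform G solves p G^2 - ((1 + 2 b) z + a) G + (1 + b) = 0 with p
  = b z^2 + a z + 1; the discriminant of this equation is (z - a)^2 - 4 (1 + b). With z = 1 / w and
  G(1 / w) = w M(w) it becomes the stated equation for the moment series.\<close>

lemma free_meixner_iff_moments:
  "free_meixner a b \<mu> \<longleftrightarrow>
    (fps_const (of_real b) + fps_const (of_real a) * fps_X + fps_X\<^sup>2) * moments\<^sup>2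
    - (fps_const (1 + 2 * of_real b) + fps_const (of_real a) * fps_X) * moments + fps_const (1 + of_real b) = 0"
    (is "_ \<longleftrightarrow> ?Q = 0")
proof -
  define G where "G = cauchy_transform \<mu>"
  define q where "q w = complex_of_real b + of_real a * w + w\<^sup>2" for w
  define p where "p z = complex_of_real b * z\<^sup>2 + of_real a * z + 1" for z
  define R where "R z = p z * (G z)\<^sup>2 - ((1 + 2 * of_real b) * z + of_real a) * G z + (1 + of_real b)" for z
  define P where "P = fps_const (complex_of_real b) + fps_const (of_real a) * fps_X + fps_X\<^sup>2"
  have disc: "((1 + 2 * of_real b) * z + of_real a - 2 * p z * G z)\<^sup>2
      = (z - of_real a)\<^sup>2 - 4 * (1 + of_real b) + 4 * p z * R z" for z
    unfolding R_def p_def by (simp add: power2_eq_square algebra_simps)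
  have val: "fps_value P w (q w)"
    "fps_value ?Q w (q w * (eval_fps moments w)\<^sup>2
      - ((1 + 2 * of_real b) + of_real a * w) * eval_fps moments w + (1 + of_real b))"
    if "cmod w < 1 / \<rho>" for w
  proof -
    have "ereal (cmod w) < fps_conv_radius moments"
      by (rule order_less_le_trans[OF _ conv_radius_moments]) (use that in simp)
    then have "fps_value moments w (eval_fps moments w)" by (simp add: fps_value_def)
    then show "fps_value P w (q w)"
      "fps_value ?Q w (q w * (eval_fps moments w)\<^sup>2
        - ((1 + 2 * of_real b) + of_real a * w) * eval_fps moments w + (1 + of_real b))"
      unfolding P_def q_def power2_eq_square by (intro fps_value_intros; assumption)+
  qed
  have eval: "eval_fps ?Q w = R (1 / w)" "p (1 / w) = q w / w\<^sup>2"
    if w: "w \<noteq> 0" "cmod w < 1 / \<rho>" for w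
  proof -
    have G: "G (1 / w) = w * eval_fps moments w" using eval_moments[OF w] by (simp add: G_def)
    show pw: "p (1 / w) = q w / w\<^sup>2"
      using w(1) by (simp add: p_def q_def field_simps power2_eq_square)
    show "eval_fps ?Q w = R (1 / w)"
      unfolding conjunct2[OF val(2)[OF w(2), unfolded fps_value_def]] R_def pw G
      using w(1) by (simp add: power2_eq_square field_simps)
  qed
  have inv: "1 / z \<noteq> 0 \<and> cmod (1 / z) < 1 / \<rho>" if "cmod z > \<rho>" for z
    using that \<rho> frac_less2[of 1 1 \<rho> "cmod z"] by (auto simp: norm_divide)
  show ?thesis
  proof
    assume "free_meixner a b \<mu>"
    then obtain s where s: "\<And>z. Im z > 0 \<Longrightarrow> (s z)\<^sup>2 = (z - of_real a)\<^sup>2 - 4 * (1 + of_real b)"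
      "\<And>z. Im z > 0 \<Longrightarrow> p z \<noteq> 0 \<Longrightarrow> G z = ((1 + 2 * of_real b) * z + of_real a - s z) / (2 * p z)"
      unfolding free_meixner_def p_def G_def Let_def by blast
    \<comment> \<open>The closed formula says nothing at a zero of \<open>p\<close>, so the equation
      is first shown times \<open>p\<close>. In the variable w this factor becomes the non-zero
      polynomial \<open>P\<close>, which is cancelled at the end.\<close>
    have zero: "p z * R z = 0" if "Im z > 0" for z
    proof (cases "p z = 0")
      case False
      then have "s z = (1 + 2 * of_real b) * z + of_real a - 2 * p z * G z"
        using s(2)[OF that] by (simp add: field_simps)
      then have "4 * p z * R z = 0" using s(1)[OF that] disc[of z] by simp
      then show ?thesis by simp
    qed simp
    have holo: "eval_fps (P * ?Q) holomorphic_on ball 0 (1 / \<rho>)"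
    proof (rule holomorphic_on_eval_fps, rule subsetI)
      fix w :: complex assume "w \<in> ball 0 (1 / \<rho>)"
      then have "cmod w < 1 / \<rho>" by simp
      then show "w \<in> eball 0 (fps_conv_radius (P * ?Q))"
        using fps_value_mult[OF val] by (simp add: fps_value_def)
    qed
    define U where "U = {w \<in> ball 0 (1 / \<rho>). Im w < 0}"
    \<comment> \<open>If w lies in the lower half disc \<open>U\<close>, then 1 / w lies in the
      upper half plane. Since 0 is an interior point of the disc and a limit point of
      \<open>U\<close>, vanishing on \<open>U\<close> extends to the whole disc.\<close>
    have limpt: "0 islimpt U"
      unfolding islimpt_approachable
    proof (intro allI impI)
      fix e :: real assume e: "e > 0"
      define t where "t = min (e / 2) (1 / (2 * \<rho>))"
      have t: "t > 0" "t < e" "t < 1 / \<rho>" using e \<rho> by (auto simp: t_def min_def field_simps)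
      then show "\<exists>w\<in>U. w \<noteq> 0 \<and> dist w 0 < e"
        by (intro bexI[of _ "- \<i> * complex_of_real t"]) (auto simp: U_def norm_mult)
    qed
    have on_U: "eval_fps (P * ?Q) w = 0" if "w \<in> U" for w
    proof -
      have w: "w \<noteq> 0" "cmod w < 1 / \<rho>" "Im w < 0" using that by (auto simp: U_def)
      have "Im (1 / w) > 0" using w by (simp add: Im_divide divide_neg_pos sum_power2_gt_zero_iff complex_eq_iff)
      then have "p (1 / w) * R (1 / w) = 0" by (rule zero)
      then have "q w * eval_fps ?Q w = 0" using eval[OF w(1,2)] w(1) by simp
      then show ?thesis using fps_value_mult[OF val[OF w(2) ]] val[OF w(2)] by (simp add: fps_value_def)
    qed
    have vanish: "eval_fps (P * ?Q) w = 0" if "w \<in> ball 0 (1 / \<rho>)" for w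
      by (rule analytic_continuation[OF holo open_ball connected_ball _ _ limpt on_U that])
        (use \<rho> in \<open>auto simp: U_def\<close>)
    have "P * ?Q = 0"
    proof (rule eval_fps_eqD)
      show "fps_conv_radius (P * ?Q) > 0"
        using fps_value_mult[OF val, of 0] \<rho> by (simp add: fps_value_def zero_ereal_def)
      have "\<forall>\<^sub>F w in nhds 0. w \<in> ball 0 (1 / \<rho>)"
        using \<rho> by (intro eventually_nhds_in_open) auto
      then show "\<forall>\<^sub>F w in nhds 0. eval_fps (P * ?Q) w = eval_fps 0 w"
        by eventually_elim (simp add: vanish)
    qed simp
    moreover have "P $ 2 = 1" by (simp add: P_def)
    then have "P \<noteq> 0" by auto
    ultimately show "?Q = 0" by (metis mult_eq_0_iff)
  next
    assume Q: "?Q = 0"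
    have far: "R z = 0" if "cmod z > \<rho>" for z
    proof -
      have "R z = eval_fps ?Q (1 / z)" using eval(1)[of "1 / z"] inv[OF that] by simp
      also have "\<dots> = 0" unfolding Q by simp
      finally show ?thesis .
    qed
    have holoG: "G holomorphic_on {z. Im z > 0}" unfolding G_def by (rule holomorphic_cauchy_transform)
    have holoR: "R holomorphic_on {z. Im z > 0}"
      unfolding R_def p_def by (intro holomorphic_intros holoG)
    have R: "R z = 0" if z: "Im z > 0" for z
    proof (rule analytic_continuation_open[of "{z. Im z > 0} \<inter> {z. cmod z > \<rho>}" "{z. Im z > 0}" R "\<lambda>_. 0"])
      show "open ({z. Im z > 0} \<inter> {z. cmod z > \<rho>})"
        by (intro open_Int open_halfspace_Im_gt open_Collect_less continuous_intros)
      have "\<i> * complex_of_real (\<rho> + 1) \<in> {z. Im z > 0} \<inter> {z. cmod z > \<rho>}" using \<rho> by (simp add: norm_mult)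
      then show "{z. Im z > 0} \<inter> {z. cmod z > \<rho>} \<noteq> {}" by blast
      show "connected {z. Im z > 0}" by (intro convex_connected convex_halfspace_Im_gt)
    qed (use far z holoR open_halfspace_Im_gt in auto)
    text \<open>Solving for the root instead of for \<open>G\<close> avoids the choice of a branch.\<close>
    define s where "s z = (1 + 2 * of_real b) * z + of_real a - 2 * p z * G z" for z
    have "continuous_on {z. Im z > 0} s"
      unfolding s_def p_def by (intro holomorphic_on_imp_continuous_on holomorphic_intros holoG)
    moreover have "(s z)\<^sup>2 = (z - of_real a)\<^sup>2 - 4 * (1 + of_real b)" if "Im z > 0" for z
      unfolding s_def disc using R[OF that] by simp
    moreover have "((1 + 2 * of_real b) * z + of_real a - s z) / (2 * p z) = G z" if "p z \<noteq> 0" for z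
      using that by (simp add: s_def)
    moreover have "compactly_supported \<mu>"
      unfolding compactly_supported_def
      by (intro exI[of _ "{-\<rho>..\<rho>}"]) (auto intro: eventually_mono[OF support])
    ultimately show "free_meixner a b \<mu>"
      unfolding free_meixner_def Let_def p_def[symmetric] G_def
      using Im_cauchy_transform_nonpos real_distribution_axioms by (intro conjI exI[of _ s]) auto
  qed
qed

end

subsection \<open>Projections and adjoints\<close>

lemma cinner_add_left: "cinner (x + y) z = cinner x z + cinner y (z :: 'a::complex_hilbert)"
  by (metis cinner_add_right cinner_commute complex_cnj_add)

lemma cinner_scaleC_left: "cinner (c *\<^sub>C x) y = cnj c * cinner x (y :: 'a::complex_hilbert)"
  by (metis cinner_scaleC_right cinner_commute complex_cnj_mult)

lemma cinner_zero_right [simp]: "cinner x (0 :: 'a::complex_hilbert) = 0"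
  using cinner_add_right[of x 0 0] by simp

lemma cinner_zero_left [simp]: "cinner 0 (x :: 'a::complex_hilbert) = 0"
  using cinner_add_left[of 0 0 x] by simp

lemma cinner_diff_right: "cinner x (y - z) = cinner x y - cinner x (z :: 'a::complex_hilbert)"
  using cinner_add_right[of x "y - z" z] by simp

lemma cinner_diff_left: "cinner (x - y) z = cinner x z - cinner y (z :: 'a::complex_hilbert)"
  using cinner_add_left[of "x - y" y z] by simp

lemma cinner_scaleR_right: "cinner x (r *\<^sub>R y) = complex_of_real r * cinner x (y :: 'a::complex_hilbert)"
  by (simp flip: scaleC_of_real add: cinner_scaleC_right)

lemma power2_norm_eq_cinner: "(norm (x :: 'a::complex_hilbert))\<^sup>2 = Re (cinner x x)"
  by (simp add: cinner_self)

lemma power2_norm_diff_scaleC: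
  fixes x y :: "'a::complex_hilbert"
  shows "(norm (x - c *\<^sub>C y))\<^sup>2 = (norm x)\<^sup>2 - 2 * Re (cnj c * cinner y x) + (cmod c)\<^sup>2 * (norm y)\<^sup>2"
proof -
  have "cinner (x - c *\<^sub>C y) (x - c *\<^sub>C y) =
      cinner x x - c * cinner x y - cnj c * cinner y x + (c * cnj c) * cinner y y"
    by (simp add: cinner_diff_left cinner_diff_right cinner_scaleC_left cinner_scaleC_right algebra_simps)
  moreover have "Re (c * cinner x y) = Re (cnj c * cinner y x)"
    by (subst cinner_commute[of x y]) (simp add: algebra_simps)
  moreover have "Re ((c * cnj c) * cinner y y) = (cmod c)\<^sup>2 * (norm y)\<^sup>2"
    by (simp add: cinner_self complex_norm_square[symmetric] del: of_real_power)
  ultimately show ?thesis by (simp add: power2_norm_eq_cinner)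
qed

lemma complex_hilbert_parallelogram:
  fixes x y :: "'a::complex_hilbert"
  shows "(norm (x + y))\<^sup>2 + (norm (x - y))\<^sup>2 = 2 * (norm x)\<^sup>2 + 2 * (norm y)\<^sup>2"
  unfolding power2_norm_eq_cinner
  by (simp add: cinner_diff_left cinner_diff_right cinner_add_left cinner_add_right)

lemma norm_cinner_le: "cmod (cinner x y) \<le> norm x * norm (y :: 'a::complex_hilbert)"
proof (cases "x = 0")
  case False
  then have nx: "(norm x)\<^sup>2 > 0" by simp
  define c where "c = cinner x y / complex_of_real ((norm x)\<^sup>2)"
  have 1: "cnj c * cinner x y = complex_of_real ((cmod (cinner x y))\<^sup>2 / (norm x)\<^sup>2)"
    unfolding c_def using complex_norm_square[of "cinner x y"]
    by (simp add: mult.commute)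
  have 2: "(cmod c)\<^sup>2 * (norm x)\<^sup>2 = (cmod (cinner x y))\<^sup>2 / (norm x)\<^sup>2"
    using nx by (simp add: c_def norm_divide norm_mult power_divide power2_eq_square)
  have "0 \<le> (norm (y - c *\<^sub>C x))\<^sup>2" by simp
  also have "\<dots> = (norm y)\<^sup>2 - (cmod (cinner x y))\<^sup>2 / (norm x)\<^sup>2"
    unfolding power2_norm_diff_scaleC 1 2 by simp
  finally have "(cmod (cinner x y))\<^sup>2 / (norm x)\<^sup>2 \<le> (norm y)\<^sup>2" by simp
  then have "(cmod (cinner x y))\<^sup>2 \<le> (norm x * norm y)\<^sup>2"
    using nx by (simp add: divide_le_eq power_mult_distrib mult.commute)
  then show ?thesis by (rule power2_le_imp_le) simp
qed simp

lemma bounded_linear_cinner_right: "bounded_linear (\<lambda>y. cinner x (y :: 'a::complex_hilbert))"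
  by (rule bounded_linear_intro[where K = "norm x"])
    (simp_all add: cinner_add_right cinner_scaleR_right scaleR_conv_of_real,
     metis norm_cinner_le mult.commute)

lemma cinner_ext: "(\<And>x. cinner x y = cinner x z) \<Longrightarrow> y = (z :: 'a::complex_hilbert)"
  by (metis cinner_diff_right cinner_self diff_self norm_eq_zero of_real_eq_0_iff power_eq_0_iff right_minus_eq)

lemma bounded_op_eqI: "(\<And>x. app_op S x = app_op T x) \<Longrightarrow> S = T"
  by (metis app_op_inject ext)

lemma bounded_linear_app_op: "bounded_linear (app_op T)"
  using app_op[of T] by simp

lemma app_op_scaleC: "app_op T (c *\<^sub>C x) = c *\<^sub>C app_op T x"
  using app_op[of T] by simp

lemmas app_op_add = linear_add[OF bounded_linear.linear[OF bounded_linear_app_op]]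
lemmas app_op_diff = linear_diff[OF bounded_linear.linear[OF bounded_linear_app_op]]
lemmas app_op_0 [simp] = linear_0[OF bounded_linear.linear[OF bounded_linear_app_op]]

lemma app_op_Abs_op: "bounded_linear T \<Longrightarrow> (\<And>c x. T (c *\<^sub>C x) = c *\<^sub>C T x) \<Longrightarrow> app_op (Abs_op T) = T"
  by (simp add: Abs_op_inverse)

lemma scaleR_eq_scaleC: "r *\<^sub>R x = complex_of_real r *\<^sub>C (x :: 'a::complex_vector)"
  by (simp add: scaleC_of_real)

lemma cinner_scaleR_left: "cinner (r *\<^sub>R x) y = complex_of_real r * cinner x (y :: 'a::complex_hilbert)"
  by (simp flip: scaleC_of_real add: cinner_scaleC_left)

lemma self_adjoint_scaleR: "self_adjoint T \<Longrightarrow> self_adjoint (r *\<^sub>R T)"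
  by (simp add: self_adjoint_def scaleR_bounded_op.rep_eq cinner_scaleR_left cinner_scaleR_right)

lemma self_adjoint_add: "self_adjoint S \<Longrightarrow> self_adjoint T \<Longrightarrow> self_adjoint (S + T)"
  by (simp add: self_adjoint_def plus_bounded_op.rep_eq cinner_add_left cinner_add_right)

section \<open>Closed subspaces, orthogonal projections and the Riesz theorem\<close>

definition csubspace :: "'a::complex_vector set \<Rightarrow> bool" where
  "csubspace L \<longleftrightarrow> 0 \<in> L \<and> (\<forall>x\<in>L. \<forall>y\<in>L. x + y \<in> L) \<and> (\<forall>c. \<forall>x\<in>L. c *\<^sub>C x \<in> L)"

lemma csubspace_diff: "csubspace L \<Longrightarrow> x \<in> L \<Longrightarrow> y \<in> L \<Longrightarrow> x - y \<in> (L :: 'a::complex_vector set)"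
  unfolding csubspace_def by (metis diff_conv_add_uminus scaleR_minus1_left scaleR_eq_scaleC)

lemma csubspace_closure:
  fixes L :: "'a::complex_hilbert set"
  assumes "csubspace L"
  shows "csubspace (closure L)"
  unfolding csubspace_def
proof (intro conjI ballI allI)
  show "0 \<in> closure L" using assms closure_subset unfolding csubspace_def by blast
next
  fix x y assume "x \<in> closure L" "y \<in> closure L"
  then obtain f g where "\<forall>n. f n \<in> L" "f \<longlonglongrightarrow> x" "\<forall>n. g n \<in> L" "g \<longlonglongrightarrow> y"
    unfolding closure_sequential by blast
  then have "\<forall>n. f n + g n \<in> L" "(\<lambda>n. f n + g n) \<longlonglongrightarrow> x + y"
    using assms by (auto simp: csubspace_def intro: tendsto_add)
  then show "x + y \<in> closure L"
    unfolding closure_sequential by (intro exI[of _ "\<lambda>n. f n + g n"] conjI)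
next
  fix c x assume "x \<in> closure L"
  then obtain f where "\<forall>n. f n \<in> L" "f \<longlonglongrightarrow> x"
    unfolding closure_sequential by blast
  then have "\<forall>n. c *\<^sub>C f n \<in> L" "(\<lambda>n. c *\<^sub>C f n) \<longlonglongrightarrow> c *\<^sub>C x"
    using assms bounded_linear.tendsto[OF bounded_linear_scaleC] by (auto simp: csubspace_def)
  then show "c *\<^sub>C x \<in> closure L"
    unfolding closure_sequential by (intro exI[of _ "\<lambda>n. c *\<^sub>C f n"] conjI)
qed

text \<open>Midpoints stay in \<open>L\<close>, so by the parallelogram law a minimizing sequence is
  Cauchy.\<close>

lemma ex_nearest_point:
  fixes L :: "'a::complex_hilbert set"
  assumes L: "csubspace L" and cl: "closed L"
  shows "\<exists>p\<in>L. \<forall>y\<in>L. norm (x - p) \<le> norm (x - y)"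
proof -
  define D where "D = (\<lambda>y. (norm (x - y))\<^sup>2) ` L"
  define d where "d = Inf D"
  have ne: "D \<noteq> {}" using L by (auto simp: D_def csubspace_def)
  have bdd: "bdd_below D" by (auto simp: D_def intro!: bdd_belowI[of _ 0])
  have low: "d \<le> (norm (x - y))\<^sup>2" if "y \<in> L" for y
    unfolding d_def using that bdd by (auto simp: D_def intro: cInf_lower)
  have "\<exists>y\<in>L. (norm (x - y))\<^sup>2 < d + 1 / real (Suc n)" for n
  proof -
    have "Inf D < d + 1 / real (Suc n)" by (simp add: d_def)
    then show ?thesis using cInf_less_iff[OF ne bdd] by (auto simp: D_def)
  qed
  then obtain y where y: "\<And>n. y n \<in> L" "\<And>n. (norm (x - y n))\<^sup>2 < d + 1 / real (Suc n)" by metis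
  have close: "(norm (y m - y n))\<^sup>2 \<le> 2 / real (Suc m) + 2 / real (Suc n)" for m n
  proof -
    define z where "z = (1/2) *\<^sub>R (y m + y n)"
    have zL: "z \<in> L" unfolding z_def scaleR_eq_scaleC using y(1) L by (auto simp: csubspace_def)
    have "(x - y m) + (x - y n) = 2 *\<^sub>R (x - z)"
      by (simp add: z_def algebra_simps scaleR_2)
    moreover have "(x - y n) - (x - y m) = y m - y n" by simp
    ultimately have "(norm (2 *\<^sub>R (x - z)))\<^sup>2 + (norm (y m - y n))\<^sup>2 = 2 * (norm (x - y m))\<^sup>2 + 2 * (norm (x - y n))\<^sup>2"
      using complex_hilbert_parallelogram[of "x - y m" "x - y n"] by (simp add: norm_minus_commute)
    moreover have "(norm (2 *\<^sub>R (x - z)))\<^sup>2 = 4 * (norm (x - z))\<^sup>2" by (simp add: power_mult_distrib)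
    ultimately show ?thesis using low[OF zL] y(2)[of m] y(2)[of n] by simp
  qed
  have "Cauchy y"
  proof (rule metric_CauchyI)
    fix e :: real assume e: "e > 0"
    then obtain N where N: "4 / e\<^sup>2 < real (Suc N)"
      using reals_Archimedean2[of "4 / e\<^sup>2"] by (metis less_Suc_eq of_nat_less_iff order_less_trans lessI)
    have "dist (y m) (y n) < e" if "m \<ge> N" "n \<ge> N" for m n
    proof -
      have "2 / real (Suc m) \<le> 2 / real (Suc N)" "2 / real (Suc n) \<le> 2 / real (Suc N)"
        using that by (auto intro!: divide_left_mono)
      moreover have "4 / real (Suc N) < e\<^sup>2" using N e by (simp add: divide_simps mult.commute)
      ultimately have "(norm (y m - y n))\<^sup>2 < e\<^sup>2" using close[of m n] by linarith
      then show ?thesis using e by (simp add: dist_norm power2_less_imp_less)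
    qed
    then show "\<exists>M. \<forall>m\<ge>M. \<forall>n\<ge>M. dist (y m) (y n) < e" by blast
  qed
  then obtain p where p: "y \<longlonglongrightarrow> p" using Cauchy_convergent convergent_def by blast
  have "p \<in> L" using cl y(1) p closed_sequentially by blast
  moreover have "norm (x - p) \<le> norm (x - z)" if "z \<in> L" for z
  proof -
    have "(\<lambda>n. (norm (x - y n))\<^sup>2) \<longlonglongrightarrow> (norm (x - p))\<^sup>2"
      by (intro tendsto_intros p)
    moreover have "(\<lambda>n. d + 1 / real (Suc n)) \<longlonglongrightarrow> d + 0"
      by (intro tendsto_add tendsto_const LIMSEQ_Suc[OF lim_1_over_n])
    ultimately have "(norm (x - p))\<^sup>2 \<le> d + 0"
      by (rule LIMSEQ_le) (use y(2) less_imp_le in blast)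
    then have "(norm (x - p))\<^sup>2 \<le> (norm (x - z))\<^sup>2" using low[OF that] by linarith
    then show ?thesis by (rule power2_le_imp_le) simp
  qed
  ultimately show ?thesis by blast
qed

lemma ex_orthogonal_projection:
  fixes L :: "'a::complex_hilbert set"
  assumes L: "csubspace L" and cl: "closed L"
  shows "\<exists>p\<in>L. \<forall>y\<in>L. cinner y (x - p) = 0"
proof -
  obtain p where p: "p \<in> L" "\<And>y. y \<in> L \<Longrightarrow> norm (x - p) \<le> norm (x - y)"
    using ex_nearest_point[OF L cl] by blast
  have "cinner y (x - p) = 0" if y: "y \<in> L" for y
  proof -
    \<comment> \<open>A step size with \<open>t * (norm y)\<^sup>2 \<le> 1\<close> that is also
      defined for \<open>y = 0\<close>. Moving \<open>p\<close> by \<open>c *\<^sub>C y\<close>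
      would come closer to \<open>x\<close> unless the inner product is 0.\<close>
    define t where "t = 1 / ((norm y)\<^sup>2 + 1)"
    define e where "e = x - p"
    define c where "c = complex_of_real t * cinner y e"
    have pos: "(norm y)\<^sup>2 + 1 > 0" by (simp add: add_nonneg_pos)
    then have t: "t > 0" "t * (norm y)\<^sup>2 \<le> 1" by (simp_all add: t_def divide_le_eq)
    have "p + c *\<^sub>C y \<in> L" using L p y by (auto simp: csubspace_def)
    then have "norm e \<le> norm (e - c *\<^sub>C y)" using p(2) by (simp add: e_def algebra_simps)
    then have "(norm e)\<^sup>2 \<le> (norm (e - c *\<^sub>C y))\<^sup>2" by (simp add: power_mono)
    moreover have "cnj c * cinner y e = complex_of_real (t * (cmod (cinner y e))\<^sup>2)"
      unfolding c_def using complex_norm_square[of "cinner y e"] by (simp add: mult_ac)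
    ultimately have "2 * (t * (cmod (cinner y e))\<^sup>2) \<le> (cmod c)\<^sup>2 * (norm y)\<^sup>2"
      unfolding power2_norm_diff_scaleC by simp
    also have "\<dots> = (t * (cmod (cinner y e))\<^sup>2) * (t * (norm y)\<^sup>2)"
      by (simp add: c_def norm_mult power_mult_distrib power2_eq_square)
    also have "\<dots> \<le> (t * (cmod (cinner y e))\<^sup>2) * 1"
      using t by (intro mult_left_mono) auto
    finally have "t * (cmod (cinner y e))\<^sup>2 \<le> 0" by simp
    then have "(cmod (cinner y e))\<^sup>2 \<le> 0" using t by (simp add: mult_le_0_iff)
    then show ?thesis by (simp add: e_def)
  qed
  then show ?thesis using p by blast
qed

lemma orthogonal_projection_unique:
  fixes L :: "'a::complex_hilbert set"
  assumes L: "csubspace L" and "p \<in> L" "q \<in> L"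
    and "\<And>y. y \<in> L \<Longrightarrow> cinner y (x - p) = 0" "\<And>y. y \<in> L \<Longrightarrow> cinner y (x - q) = 0"
  shows "p = q"
proof -
  have "p - q \<in> L" using assms csubspace_diff by blast
  then have "cinner (p - q) (x - q) - cinner (p - q) (x - p) = 0" using assms by simp
  then have "cinner (p - q) (p - q) = 0" by (simp add: cinner_diff_right)
  then show ?thesis by (simp add: cinner_self)
qed

lemma ex_projection_op:
  fixes L :: "'a::complex_hilbert set"
  assumes L: "csubspace L" and cl: "closed L"
  obtains P where "\<And>x. app_op P x \<in> L" "\<And>x y. y \<in> L \<Longrightarrow> cinner y (x - app_op P x) = 0"
proof -
  obtain P where P: "\<And>x. P x \<in> L" "\<And>x y. y \<in> L \<Longrightarrow> cinner y (x - P x) = 0"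
    using ex_orthogonal_projection[OF L cl] by metis
  note unique = orthogonal_projection_unique[OF L]
  have add: "P (x + y) = P x + P y" for x y
  proof (rule unique[of _ _ "x + y"])
    show "P x + P y \<in> L" using L P(1) by (auto simp: csubspace_def)
    show "cinner z (x + y - (P x + P y)) = 0" if "z \<in> L" for z
      using P(2)[OF that, of x] P(2)[OF that, of y]
      by (simp add: cinner_diff_right cinner_add_right)
  qed (use P in auto)
  have scaleC: "P (c *\<^sub>C x) = c *\<^sub>C P x" for c x
  proof (rule unique[of _ _ "c *\<^sub>C x"])
    show "c *\<^sub>C P x \<in> L" using L P(1) by (auto simp: csubspace_def)
    show "cinner z (c *\<^sub>C x - c *\<^sub>C P x) = 0" if "z \<in> L" for z
      using P(2)[OF that, of x] by (simp add: cinner_diff_right cinner_scaleC_right)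
  qed (use P in auto)
  have "norm (P x) \<le> norm x" for x
  proof -
    have "cinner (P x) x = cinner (P x) (P x)"
      using P(2)[OF P(1), of x x] by (simp add: cinner_diff_right)
    then have "(norm (P x))\<^sup>2 = cmod (cinner (P x) x)"
      by (simp add: cinner_self norm_power)
    also have "\<dots> \<le> norm (P x) * norm x" by (rule norm_cinner_le)
    finally show ?thesis by (cases "P x = 0") (simp_all add: power2_eq_square)
  qed
  then have "bounded_linear P"
    by (intro bounded_linear_intro[where K = 1]) (simp_all add: add scaleC scaleR_eq_scaleC)
  then have "app_op (Abs_op P) = P" using scaleC by (rule app_op_Abs_op)
  then show thesis using that[of "Abs_op P"] P by simp
qed

lemma riesz_representation:
  fixes f :: "'a::complex_hilbert \<Rightarrow> complex"
  assumes f: "bounded_linear f" and scaleC: "\<And>c x. f (c *\<^sub>C x) = c * f x"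
  shows "\<exists>z. \<forall>x. f x = cinner z x"
proof (cases "\<forall>x. f x = 0")
  case True
  then show ?thesis by (intro exI[of _ 0]) simp
next
  case False
  then obtain u where u: "f u \<noteq> 0" by blast
  interpret f: bounded_linear f by fact
  define L where "L = {x. f x = 0}"
  have L: "csubspace L" by (auto simp: L_def csubspace_def f.add scaleC f.zero)
  have cl: "closed L"
    unfolding L_def by (intro closed_Collect_eq continuous_intros f.continuous_on)
  obtain p where p: "p \<in> L" "\<And>y. y \<in> L \<Longrightarrow> cinner y (u - p) = 0"
    using ex_orthogonal_projection[OF L cl] by blast
  define e where "e = u - p"
  have fe: "f e \<noteq> 0" using u p by (simp add: e_def f.diff L_def)
  then have e: "cinner e e \<noteq> 0" by (auto simp: cinner_self f.zero)
  define z where "z = cnj (f e / cinner e e) *\<^sub>C e"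
  have "f x = cinner z x" for x
  proof -
    have "f (x - (f x / f e) *\<^sub>C e) = 0" using fe by (simp add: f.diff scaleC)
    then have "cinner (x - (f x / f e) *\<^sub>C e) e = 0" using p(2) by (simp add: L_def e_def)
    then have "cinner e (x - (f x / f e) *\<^sub>C e) = 0" by (metis cinner_commute complex_cnj_zero)
    then have "cinner e x = (f x / f e) * cinner e e"
      by (simp add: cinner_diff_right cinner_scaleC_right)
    then show ?thesis using e fe by (simp add: z_def cinner_scaleC_left)
  qed
  then show ?thesis by blast
qed

text \<open>\<open>adj\<close> is a definite description, so its defining property becomes available
  only after existence, by the Riesz theorem, and uniqueness are shown.\<close>

lemma cinner_adj:
  fixes T :: "'h::complex_hilbert bounded_op"
  shows "cinner (app_op T x) y = cinner x (app_op (adj T) y)"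
proof -
  have "\<exists>z. \<forall>x. cinner y (app_op T x) = cinner z x" for y
  proof (rule riesz_representation)
    show "bounded_linear (\<lambda>x. cinner y (app_op T x))"
      using bounded_linear_compose[OF bounded_linear_cinner_right bounded_linear_app_op] .
  qed (simp add: app_op_scaleC cinner_scaleC_right)
  then obtain S where "\<And>x y. cinner y (app_op T x) = cinner (S y) x" by metis
  then have S: "cinner (app_op T x) y = cinner x (S y)" for x y
    by (metis cinner_commute)
  have add: "S (x + y) = S x + S y" for x y
    by (rule cinner_ext) (simp add: S[symmetric] cinner_add_right)
  have scaleC: "S (c *\<^sub>C x) = c *\<^sub>C S x" for c x
    by (rule cinner_ext) (simp add: S[symmetric] cinner_scaleC_right)
  obtain K where K: "K \<ge> 0" "\<And>x. norm (app_op T x) \<le> norm x * K"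
    using bounded_linear.nonneg_bounded[OF bounded_linear_app_op] by blast
  have "norm (S x) \<le> norm x * K" for x
  proof -
    have "(norm (S x))\<^sup>2 = cmod (cinner (S x) (S x))"
      by (simp add: cinner_self norm_power)
    also have "\<dots> = cmod (cinner (app_op T (S x)) x)" by (simp only: S)
    also have "\<dots> \<le> norm (app_op T (S x)) * norm x" by (rule norm_cinner_le)
    also have "\<dots> \<le> (norm (S x) * K) * norm x" using K by (intro mult_right_mono) auto
    finally show ?thesis by (cases "S x = 0") (simp_all add: power2_eq_square K mult_ac)
  qed
  then have "bounded_linear S"
    by (intro bounded_linear_intro[where K = K]) (simp_all add: add scaleC scaleR_eq_scaleC)
  then have "app_op (Abs_op S) = S" using scaleC by (rule app_op_Abs_op)
  then have ex: "\<forall>x y. cinner (app_op T x) y = cinner x (app_op (Abs_op S) y)" using S by simp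
  have "\<forall>x y. cinner (app_op T x) y = cinner x (app_op (adj T) y)"
    unfolding adj_def
  proof (rule theI[where a = "Abs_op S"])
    show "\<forall>x y. cinner (app_op T x) y = cinner x (app_op (Abs_op S) y)" by (rule ex)
  next
    fix S' assume "\<forall>x y. cinner (app_op T x) y = cinner x (app_op S' y)"
    then show "S' = Abs_op S" using ex by (intro bounded_op_eqI cinner_ext) metis
  qed
  then show ?thesis by blast
qed

lemma adj_eqI: "(\<And>x y. cinner (app_op T x) y = cinner x (app_op S y)) \<Longrightarrow> adj T = S"
  by (intro bounded_op_eqI cinner_ext) (metis cinner_adj)

lemma adj_self_adjoint: "self_adjoint T \<Longrightarrow> adj T = T"
  by (intro adj_eqI) (simp add: self_adjoint_def)

lemma adj_mult: "adj (S * T) = adj T * adj S"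
  by (intro adj_eqI) (simp add: times_bounded_op.rep_eq cinner_adj)

lemma commutant_adj:
  assumes "\<And>S. S \<in> M \<Longrightarrow> adj S \<in> M" "T \<in> commutant M"
  shows "adj T \<in> commutant M"
  unfolding commutant_def
proof (intro CollectI ballI)
  have adj_adj: "adj (adj S) = S" for S :: "'a bounded_op"
    by (rule adj_eqI) (metis cinner_adj cinner_commute)
  fix S assume "S \<in> M"
  then have "adj S * T = T * adj S" using assms by (auto simp: commutant_def)
  then have "adj (adj S * T) = adj (T * adj S)" by simp
  then show "S * adj T = adj T * S" by (simp add: adj_mult adj_adj)
qed

subsection \<open>Square-summable sequences of vectors\<close>

text \<open>On this Hilbert space, a sum of matrix coefficients that defines the ultraweak topology
  becomes one matrix coefficient.\<close>

typedef (overloaded) 'h l2 = "{f :: nat \<Rightarrow> 'h::complex_hilbert. summable (\<lambda>n. (norm (f n))\<^sup>2)}"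
  morphisms l2_nth Abs_l2
  by (rule exI[of _ "\<lambda>_. 0"]) simp

setup_lifting type_definition_l2

lemma power2_norm_add_le: "(norm (x + y))\<^sup>2 \<le> 2 * (norm x)\<^sup>2 + 2 * (norm (y :: 'a::real_normed_vector))\<^sup>2"
proof -
  have "(norm (x + y))\<^sup>2 \<le> (norm x + norm y)\<^sup>2" by (simp add: norm_triangle_ineq power_mono)
  also have "\<dots> \<le> 2 * (norm x)\<^sup>2 + 2 * (norm y)\<^sup>2"
    using sum_squares_ge_zero[of "norm x - norm y" 0] by (simp add: power2_eq_square algebra_simps)
  finally show ?thesis .
qed

lemma summable_power2_norm_add:
  fixes f g :: "nat \<Rightarrow> 'a::real_normed_vector"
  assumes "summable (\<lambda>n. (norm (f n))\<^sup>2)" "summable (\<lambda>n. (norm (g n))\<^sup>2)"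
  shows "summable (\<lambda>n. (norm (f n + g n))\<^sup>2)"
proof (rule summable_comparison_test_ev)
  show "summable (\<lambda>n. 2 * (norm (f n))\<^sup>2 + 2 * (norm (g n))\<^sup>2)"
    using assms by (intro summable_add summable_mult)
  show "\<forall>\<^sub>F n in sequentially. norm ((norm (f n + g n))\<^sup>2) \<le> 2 * (norm (f n))\<^sup>2 + 2 * (norm (g n))\<^sup>2"
    by (simp add: power2_norm_add_le)
qed

lemma summable_power2_norm_uminus:
  "summable (\<lambda>n. (norm (f n))\<^sup>2) \<Longrightarrow> summable (\<lambda>n. (norm (- f n :: 'a::real_normed_vector))\<^sup>2)"
  by simp

lemma summable_power2_norm_scaleC:
  "summable (\<lambda>n. (norm (f n))\<^sup>2) \<Longrightarrow> summable (\<lambda>n. (norm (c *\<^sub>C f n :: 'a::complex_hilbert))\<^sup>2)"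
  by (simp add: norm_scaleC power_mult_distrib summable_mult)

instantiation l2 :: (complex_hilbert) complex_vector
begin

lift_definition zero_l2 :: "'a l2" is "\<lambda>n. 0" by simp

lift_definition plus_l2 :: "'a l2 \<Rightarrow> 'a l2 \<Rightarrow> 'a l2" is "\<lambda>f g n. f n + g n"
  by (rule summable_power2_norm_add)

lift_definition uminus_l2 :: "'a l2 \<Rightarrow> 'a l2" is "\<lambda>f n. - f n"
  by (rule summable_power2_norm_uminus)

lift_definition minus_l2 :: "'a l2 \<Rightarrow> 'a l2 \<Rightarrow> 'a l2" is "\<lambda>f g n. f n - g n"
proof -
  fix f g :: "nat \<Rightarrow> 'a"
  assume "summable (\<lambda>n. (norm (f n))\<^sup>2)" "summable (\<lambda>n. (norm (g n))\<^sup>2)"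
  then show "summable (\<lambda>n. (norm (f n - g n))\<^sup>2)"
    using summable_power2_norm_add[OF _ summable_power2_norm_uminus, of f g] by simp
qed

lift_definition scaleC_l2 :: "complex \<Rightarrow> 'a l2 \<Rightarrow> 'a l2" is "\<lambda>c f n. c *\<^sub>C f n"
  by (rule summable_power2_norm_scaleC)

lift_definition scaleR_l2 :: "real \<Rightarrow> 'a l2 \<Rightarrow> 'a l2" is "\<lambda>r f n. r *\<^sub>R f n"
  by (simp add: power_mult_distrib summable_mult)

instance
proof
  fix f g h :: "'a l2" and c d :: complex and r q :: real
  show "f + g + h = f + (g + h)" "f + g = g + f" "0 + f = f" "- f + f = 0" "f - g = f + - g"
    by (transfer; simp add: fun_eq_iff)+
  show "r *\<^sub>R (f + g) = r *\<^sub>R f + r *\<^sub>R g" "(r + q) *\<^sub>R f = r *\<^sub>R f + q *\<^sub>R f"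
    "r *\<^sub>R q *\<^sub>R f = (r * q) *\<^sub>R f" "1 *\<^sub>R f = f"
    by (transfer; simp add: fun_eq_iff scaleR_add_right scaleR_add_left)+
  show "c *\<^sub>C (f + g) = c *\<^sub>C f + c *\<^sub>C g" "(c + d) *\<^sub>C f = c *\<^sub>C f + d *\<^sub>C f"
    "c *\<^sub>C d *\<^sub>C f = (c * d) *\<^sub>C f" "complex_of_real r *\<^sub>C f = r *\<^sub>R f"
    by (transfer; simp add: fun_eq_iff scaleC_add_right scaleC_add_left scaleC_scaleC scaleC_of_real)+
qed

end

lemma summable_l2_nth: "summable (\<lambda>n. (norm (l2_nth f n))\<^sup>2)"
  using l2_nth[of f] by simp

lemma l2_eqI: "(\<And>n. l2_nth f n = l2_nth g n) \<Longrightarrow> f = g"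
  by (metis l2_nth_inject ext)

lemma norm_cinner_le_power2: "norm (cinner x y) \<le> (norm x)\<^sup>2 + (norm (y :: 'a::complex_hilbert))\<^sup>2"
proof -
  have "norm (cinner x y) \<le> norm x * norm y" by (rule norm_cinner_le)
  also have "\<dots> \<le> (norm x)\<^sup>2 + (norm y)\<^sup>2"
  proof -
    have "2 * (norm x * norm y) \<le> (norm x)\<^sup>2 + (norm y)\<^sup>2"
      using zero_le_power2[of "norm x - norm y"] by (simp add: power2_diff)
    moreover have "0 \<le> norm x * norm y" by simp
    ultimately show ?thesis by linarith
  qed
  finally show ?thesis .
qed

lemma summable_cinner_l2: "summable (\<lambda>n. cinner (l2_nth f n) (l2_nth g n))"
proof (rule summable_comparison_test_ev)
  show "summable (\<lambda>n. (norm (l2_nth f n))\<^sup>2 + (norm (l2_nth g n))\<^sup>2)"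
    by (intro summable_add summable_l2_nth)
qed (simp add: norm_cinner_le_power2)

instantiation l2 :: (complex_hilbert) real_normed_vector
begin

definition norm_l2 :: "'a l2 \<Rightarrow> real" where
  "norm_l2 f = sqrt (\<Sum>n. (norm (l2_nth f n))\<^sup>2)"

definition dist_l2 :: "'a l2 \<Rightarrow> 'a l2 \<Rightarrow> real" where
  "dist_l2 f g = norm (f - g)"

definition sgn_l2 :: "'a l2 \<Rightarrow> 'a l2" where
  "sgn_l2 f = inverse (norm f) *\<^sub>R f"

definition uniformity_l2 :: "('a l2 \<times> 'a l2) filter" where
  "uniformity_l2 = (INF e\<in>{0 <..}. principal {(x, y). dist x y < e})"

definition open_l2 :: "'a l2 set \<Rightarrow> bool" where
  "open_l2 U \<longleftrightarrow> (\<forall>x\<in>U. eventually (\<lambda>(x', y). x' = x \<longrightarrow> y \<in> U) uniformity)"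

lemma power2_norm_l2: "(norm f)\<^sup>2 = (\<Sum>n. (norm (l2_nth f n))\<^sup>2)"
  by (simp add: norm_l2_def suminf_nonneg summable_l2_nth)

lemma L2_set_le_norm_l2: "L2_set (\<lambda>n. norm (l2_nth f n)) {..<N} \<le> norm f"
  unfolding L2_set_def norm_l2_def
  by (intro real_sqrt_le_mono sum_le_suminf summable_l2_nth) auto

lemma norm_l2_leI:
  assumes "\<And>N. L2_set (\<lambda>n. norm (l2_nth f n)) {..<N} \<le> C"
  shows "norm f \<le> C"
proof -
  have "0 \<le> C" using assms[of 0] by simp
  have "(\<Sum>n<N. (norm (l2_nth f n))\<^sup>2) \<le> C\<^sup>2" for N
    using assms[of N] \<open>0 \<le> C\<close> unfolding L2_set_def by (metis real_sqrt_le_iff real_sqrt_unique)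
  then have "(\<Sum>n. (norm (l2_nth f n))\<^sup>2) \<le> C\<^sup>2"
    by (intro suminf_le_const summable_l2_nth)
  then show ?thesis unfolding norm_l2_def using \<open>0 \<le> C\<close> real_le_lsqrt by blast
qed

instance
proof
  fix f g :: "'a l2" and r :: real and U :: "'a l2 set"
  show "dist f g = norm (f - g)" by (rule dist_l2_def)
  show "sgn f = inverse (norm f) *\<^sub>R f" by (rule sgn_l2_def)
  show "uniformity = (INF e\<in>{0 <..}. principal {(x :: 'a l2, y). dist x y < e})"
    by (rule uniformity_l2_def)
  show "open U = (\<forall>x\<in>U. \<forall>\<^sub>F (x', y) in uniformity. x' = x \<longrightarrow> y \<in> U)"
    by (rule open_l2_def)
  show "(norm f = 0) = (f = 0)"
  proof
    assume "norm f = 0"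
    then have "(\<Sum>n. (norm (l2_nth f n))\<^sup>2) = 0"
      using power2_norm_l2[of f] by simp
    then have "\<forall>n. (norm (l2_nth f n))\<^sup>2 = 0"
      by (subst (asm) suminf_eq_zero_iff[OF summable_l2_nth]) auto
    then show "f = 0" by (intro l2_eqI) (simp add: zero_l2.rep_eq)
  qed (simp add: norm_l2_def zero_l2.rep_eq)
  show "norm (f + g) \<le> norm f + norm g"
  proof (rule norm_l2_leI)
    fix N
    have "L2_set (\<lambda>n. norm (l2_nth (f + g) n)) {..<N} \<le>
        L2_set (\<lambda>n. norm (l2_nth f n) + norm (l2_nth g n)) {..<N}"
      by (intro L2_set_mono) (simp_all add: plus_l2.rep_eq norm_triangle_ineq)
    also have "\<dots> \<le> L2_set (\<lambda>n. norm (l2_nth f n)) {..<N} + L2_set (\<lambda>n. norm (l2_nth g n)) {..<N}"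
      by (rule L2_set_triangle_ineq)
    also have "\<dots> \<le> norm f + norm g" by (intro add_mono L2_set_le_norm_l2)
    finally show "L2_set (\<lambda>n. norm (l2_nth (f + g) n)) {..<N} \<le> norm f + norm g" .
  qed
  show "norm (r *\<^sub>R f) = \<bar>r\<bar> * norm f"
    by (simp add: norm_l2_def scaleR_l2.rep_eq power_mult_distrib suminf_mult[OF summable_l2_nth] real_sqrt_mult)
qed

end

lemma norm_l2_nth_le: "norm (l2_nth f n) \<le> norm f"
proof -
  have "norm (l2_nth f n) \<le> L2_set (\<lambda>n. norm (l2_nth f n)) {..<Suc n}"
    by (rule member_le_L2_set) auto
  also have "\<dots> \<le> norm f" by (rule L2_set_le_norm_l2)
  finally show ?thesis .
qed

text \<open>The limit is taken entry by entry. Norms over finite initial segments are continuous in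
  the entries, so the Cauchy estimate passes to the limit there and then to the whole
  sequence.\<close>

instance l2 :: (complex_hilbert) banach
proof
  fix F :: "nat \<Rightarrow> 'a l2"
  assume F: "Cauchy F"
  have "Cauchy (\<lambda>k. l2_nth (F k) n)" for n
  proof (rule metric_CauchyI)
    fix e :: real assume "e > 0"
    then obtain M where M: "\<forall>k\<ge>M. \<forall>l\<ge>M. dist (F k) (F l) < e"
      using F metric_CauchyD by blast
    have "dist (l2_nth (F k) n) (l2_nth (F l) n) < e" if "k \<ge> M" "l \<ge> M" for k l
    proof -
      have "dist (l2_nth (F k) n) (l2_nth (F l) n) = norm (l2_nth (F k - F l) n)"
        by (simp add: dist_norm minus_l2.rep_eq)
      also have "\<dots> \<le> dist (F k) (F l)" unfolding dist_norm by (rule norm_l2_nth_le)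
      finally show ?thesis using M that by fastforce
    qed
    then show "\<exists>M. \<forall>k\<ge>M. \<forall>l\<ge>M. dist (l2_nth (F k) n) (l2_nth (F l) n) < e" by blast
  qed
  then have "\<exists>x. (\<lambda>k. l2_nth (F k) n) \<longlonglongrightarrow> x" for n
    using Cauchy_convergent convergent_def by blast
  then obtain g where g: "\<And>n. (\<lambda>k. l2_nth (F k) n) \<longlonglongrightarrow> g n" by metis
  have tail: "\<exists>M. \<forall>k\<ge>M. \<forall>N. L2_set (\<lambda>n. norm (l2_nth (F k) n - g n)) {..<N} \<le> e" if "e > 0" for e
  proof -
    obtain M where M: "\<forall>k\<ge>M. \<forall>l\<ge>M. dist (F k) (F l) < e"
      using F metric_CauchyD \<open>e > 0\<close> by blast
    have "L2_set (\<lambda>n. norm (l2_nth (F k) n - g n)) {..<N} \<le> e" if "k \<ge> M" for k N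
    proof (rule LIMSEQ_le_const2)
      show "(\<lambda>l. L2_set (\<lambda>n. norm (l2_nth (F k) n - l2_nth (F l) n)) {..<N})
          \<longlonglongrightarrow> L2_set (\<lambda>n. norm (l2_nth (F k) n - g n)) {..<N}"
        unfolding L2_set_def by (intro tendsto_intros g)
      have "L2_set (\<lambda>n. norm (l2_nth (F k) n - l2_nth (F l) n)) {..<N} \<le> e" if "l \<ge> M" for l
      proof -
        have "L2_set (\<lambda>n. norm (l2_nth (F k - F l) n)) {..<N} \<le> norm (F k - F l)"
          by (rule L2_set_le_norm_l2)
        also have "\<dots> < e" using M that \<open>k \<ge> M\<close> by (simp add: dist_norm)
        finally show ?thesis by (simp add: minus_l2.rep_eq)
      qed
      then show "\<exists>M. \<forall>l\<ge>M. L2_set (\<lambda>n. norm (l2_nth (F k) n - l2_nth (F l) n)) {..<N} \<le> e" by blast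
    qed
    then show ?thesis by blast
  qed
  have summable: "summable (\<lambda>n. (norm (l2_nth (F k) n - g n))\<^sup>2)"
    if "\<forall>N. L2_set (\<lambda>n. norm (l2_nth (F k) n - g n)) {..<N} \<le> e" for k e
  proof (rule summableI_nonneg_bounded)
    fix N
    have "sqrt (\<Sum>n<N. (norm (l2_nth (F k) n - g n))\<^sup>2) \<le> e" using that by (simp add: L2_set_def)
    then show "(\<Sum>n<N. (norm (l2_nth (F k) n - g n))\<^sup>2) \<le> e\<^sup>2" by (rule sqrt_le_D)
  qed simp
  obtain M where "\<forall>k\<ge>M. \<forall>N. L2_set (\<lambda>n. norm (l2_nth (F k) n - g n)) {..<N} \<le> 1"
    using tail[of 1] by auto
  then have "summable (\<lambda>n. (norm (l2_nth (F M) n - g n))\<^sup>2)" using summable by blast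
  from summable_power2_norm_add[OF summable_l2_nth[of "F M"] summable_power2_norm_uminus[OF this]]
  have "summable (\<lambda>n. (norm (g n))\<^sup>2)" by simp
  then have G: "l2_nth (Abs_l2 g) = g" by (simp add: Abs_l2_inverse)
  have "F \<longlonglongrightarrow> Abs_l2 g"
  proof (rule metric_LIMSEQ_I)
    fix e :: real assume "e > 0"
    then obtain M where M: "\<forall>k\<ge>M. \<forall>N. L2_set (\<lambda>n. norm (l2_nth (F k) n - g n)) {..<N} \<le> e / 2"
      using tail[of "e / 2"] by auto
    have "dist (F k) (Abs_l2 g) < e" if "k \<ge> M" for k
    proof -
      have "norm (F k - Abs_l2 g) \<le> e / 2"
        by (rule norm_l2_leI) (use M that in \<open>simp add: minus_l2.rep_eq G\<close>)
      then show ?thesis using \<open>e > 0\<close> by (simp add: dist_norm)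
    qed
    then show "\<exists>M. \<forall>k\<ge>M. dist (F k) (Abs_l2 g) < e" by blast
  qed
  then show "convergent F" by (auto simp: convergent_def)
qed

instantiation l2 :: (complex_hilbert) complex_hilbert
begin

definition cinner_l2 :: "'a l2 \<Rightarrow> 'a l2 \<Rightarrow> complex" where
  "cinner_l2 f g = (\<Sum>n. cinner (l2_nth f n) (l2_nth g n))"

instance
proof
  fix f g h :: "'a l2" and c :: complex
  show "cinner f (g + h) = cinner f g + cinner f h"
    by (simp add: cinner_l2_def plus_l2.rep_eq cinner_add_right suminf_add summable_cinner_l2)
  show "cinner f (c *\<^sub>C g) = c * cinner f g"
    by (simp add: cinner_l2_def scaleC_l2.rep_eq cinner_scaleC_right suminf_mult summable_cinner_l2)
  have "(\<lambda>n. cnj (cinner (l2_nth f n) (l2_nth g n))) sums cnj (cinner f g)"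
    unfolding cinner_l2_def using summable_sums[OF summable_cinner_l2[of f g]] by (simp only: sums_cnj)
  then have "(\<lambda>n. cinner (l2_nth g n) (l2_nth f n)) sums cnj (cinner f g)"
    by (subst cinner_commute)
  then show "cinner g f = cnj (cinner f g)"
    unfolding cinner_l2_def[of g f] by (rule sums_unique[symmetric])
  show "cinner f f = complex_of_real ((norm f)\<^sup>2)"
    unfolding power2_norm_l2 cinner_l2_def cinner_self
    by (rule suminf_of_real[symmetric]) (rule summable_l2_nth)
qed

end

subsection \<open>Density of the polynomials in the bicommutant\<close>

lemma times_bounded_op_apply: "app_op (S * T) x = app_op S (app_op T x)"
  by (simp add: times_bounded_op.rep_eq)

lemma bounded_op_bound:
  obtains K where "K \<ge> 0" "\<And>x. norm (app_op T x) \<le> K * norm x"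
  using bounded_linear.nonneg_bounded[OF bounded_linear_app_op, of T] by (metis mult.commute)

text \<open>The diagonal operator with \<open>T\<close> in every entry, that is, \<open>T\<close>
  tensored with the identity of the scalar sequence space.\<close>

definition amplify :: "'h::complex_hilbert bounded_op \<Rightarrow> 'h l2 bounded_op" where
  "amplify T = Abs_op (\<lambda>f. Abs_l2 (\<lambda>n. app_op T (l2_nth f n)))"

lemma l2_nth_amplify: "l2_nth (app_op (amplify T) f) n = app_op T (l2_nth f n)"
proof -
  obtain K where K: "K \<ge> 0" "\<And>x. norm (app_op T x) \<le> K * norm x" using bounded_op_bound[of T] by blast
  have sq: "(norm (app_op T x))\<^sup>2 \<le> K\<^sup>2 * (norm x)\<^sup>2" for x
    using power_mono[OF K(2)[of x], of 2] by (simp add: power_mult_distrib)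
  have "summable (\<lambda>n. (norm (app_op T (l2_nth f n)))\<^sup>2)" for f
    by (rule summable_comparison_test_ev[OF _ summable_mult[OF summable_l2_nth[of f], of "K\<^sup>2"]])
      (simp add: sq)
  then have nth: "l2_nth (Abs_l2 (\<lambda>n. app_op T (l2_nth f n))) = (\<lambda>n. app_op T (l2_nth f n))" for f
    by (simp add: Abs_l2_inverse)
  define g where "g f = Abs_l2 (\<lambda>n. app_op T (l2_nth f n))" for f
  have g: "l2_nth (g f) n = app_op T (l2_nth f n)" for f n
    unfolding g_def nth ..
  have "bounded_linear g"
  proof (rule bounded_linear_intro[where K = K])
    fix f
    have "(norm (g f))\<^sup>2 \<le> (\<Sum>n. K\<^sup>2 * (norm (l2_nth f n))\<^sup>2)"
      unfolding power2_norm_l2 g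
      by (rule suminf_le[OF sq summable_comparison_test_ev[OF _ summable_mult[OF summable_l2_nth[of f], of "K\<^sup>2"]]
            summable_mult[OF summable_l2_nth]]) (simp add: sq)
    also have "\<dots> = (norm f * K)\<^sup>2"
      by (simp add: suminf_mult summable_l2_nth power2_norm_l2 power_mult_distrib mult.commute)
    finally show "norm (g f) \<le> norm f * K"
      by (rule power2_le_imp_le) (simp add: K)
  qed (auto intro!: l2_eqI simp: g plus_l2.rep_eq scaleR_l2.rep_eq app_op_add
      linear_scale[OF bounded_linear.linear[OF bounded_linear_app_op]])
  moreover have "g (c *\<^sub>C f) = c *\<^sub>C g f" for c f
    by (intro l2_eqI) (simp add: g scaleC_l2.rep_eq app_op_scaleC)
  ultimately have "app_op (amplify T) = g"
    unfolding amplify_def g_def[symmetric] by (rule app_op_Abs_op)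
  then show ?thesis by (simp add: g)
qed

lemma amplify_mult: "amplify (S * T) = amplify S * amplify T"
  by (intro bounded_op_eqI l2_eqI) (simp add: l2_nth_amplify times_bounded_op_apply)

lemma amplify_one: "amplify 1 = 1"
  by (intro bounded_op_eqI l2_eqI) (simp add: l2_nth_amplify one_bounded_op.rep_eq)

lemma amplify_add: "amplify (S + T) = amplify S + amplify T"
  by (intro bounded_op_eqI l2_eqI) (simp add: l2_nth_amplify plus_bounded_op.rep_eq plus_l2.rep_eq)

lemma amplify_diff: "amplify (S - T) = amplify S - amplify T"
  by (intro bounded_op_eqI l2_eqI) (simp add: l2_nth_amplify minus_bounded_op.rep_eq minus_l2.rep_eq)

lemma amplify_scaleC: "amplify (c *\<^sub>C T) = c *\<^sub>C amplify T"
  by (intro bounded_op_eqI l2_eqI) (simp add: l2_nth_amplify scaleC_bounded_op.rep_eq scaleC_l2.rep_eq)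

lemma self_adjoint_amplify: "self_adjoint T \<Longrightarrow> self_adjoint (amplify T)"
  by (simp add: self_adjoint_def cinner_l2_def l2_nth_amplify)

definition l2_single :: "nat \<Rightarrow> 'h::complex_hilbert \<Rightarrow> 'h l2" where
  "l2_single j x = Abs_l2 (\<lambda>n. if n = j then x else 0)"

lemma l2_nth_single: "l2_nth (l2_single j x) = (\<lambda>n. if n = j then x else 0)"
proof -
  have "summable (\<lambda>n. if n = j then (norm x)\<^sup>2 else 0)" by (rule summable_single)
  then have "summable (\<lambda>n. (norm (if n = j then x else 0))\<^sup>2)"
    by (simp add: if_distrib[of "\<lambda>y. (norm y)\<^sup>2"] cong: if_cong)
  then show ?thesis unfolding l2_single_def by (simp add: Abs_l2_inverse)
qed

lemma cinner_l2_single: "cinner (l2_single j x) f = cinner x (l2_nth f j)"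
proof -
  have "(\<lambda>n. if n = j then cinner x (l2_nth f n) else 0) sums cinner x (l2_nth f j)"
    by (rule sums_single)
  moreover have "(\<lambda>n. cinner (l2_nth (l2_single j x) n) (l2_nth f n)) = (\<lambda>n. if n = j then cinner x (l2_nth f n) else 0)"
    by (auto simp: l2_nth_single)
  ultimately show ?thesis unfolding cinner_l2_def by (simp add: sums_iff)
qed

lemma norm_l2_single: "norm (l2_single j x) = norm x"
proof -
  have "complex_of_real ((norm (l2_single j x))\<^sup>2) = complex_of_real ((norm x)\<^sup>2)"
    unfolding cinner_self[symmetric] by (simp add: cinner_l2_single l2_nth_single)
  then have "(norm (l2_single j x))\<^sup>2 = (norm x)\<^sup>2" using of_real_eq_iff by blast
  then show ?thesis by simp
qed

text \<open>The adjoint of the difference has only zero entries, because its entries are tested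
  against sequences with one non-zero entry. This replaces a density argument.\<close>

lemma bounded_op_l2_eqI:
  fixes S T :: "'h::complex_hilbert l2 bounded_op"
  assumes "\<And>j x. app_op S (l2_single j x) = app_op T (l2_single j x)"
  shows "S = T"
proof -
  define D where "D = S - T"
  have D: "app_op D (l2_single j x) = 0" for j x
    using assms by (simp add: D_def minus_bounded_op.rep_eq)
  have "app_op (adj D) g = 0" for g
  proof (rule l2_eqI)
    fix j
    have "cinner x (l2_nth (app_op (adj D) g) j) = cinner x 0" for x
      unfolding cinner_l2_single[symmetric] cinner_adj[symmetric] D by simp
    then show "l2_nth (app_op (adj D) g) j = l2_nth 0 j"
      by (intro cinner_ext) (simp add: zero_l2.rep_eq)
  qed
  then have "cinner (app_op D f) (app_op D f) = 0" for f by (simp add: cinner_adj)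
  then have "app_op D f = 0" for f by (simp add: cinner_self)
  then show ?thesis by (intro bounded_op_eqI) (simp add: D_def minus_bounded_op.rep_eq)
qed

text \<open>An operator that commutes with every \<open>amplify S\<close> has matrix entries
  \<open>q i j\<close> in the commutant of \<open>M\<close>. So \<open>T\<close> commutes with each
  entry, and \<open>amplify T\<close> with the operator.\<close>

lemma amplify_bicommutant:
  assumes T: "T \<in> commutant (commutant M)"
  shows "amplify T \<in> commutant (commutant (amplify ` M))"
  unfolding commutant_def[of "commutant _"]
proof (intro CollectI ballI)
  fix Q assume Q: "Q \<in> commutant (amplify ` M)"
  define q where "q i j = Abs_op (\<lambda>x. l2_nth (app_op Q (l2_single j x)) i)" for i j
  have q: "app_op (q i j) x = l2_nth (app_op Q (l2_single j x)) i" for i j x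
  proof -
    obtain K where K: "K \<ge> 0" "\<And>x. norm (app_op Q x) \<le> K * norm x" using bounded_op_bound[of Q] by blast
    have add: "l2_single j (x + y) = l2_single j x + l2_single j y" for x y :: 'a
      by (intro l2_eqI) (simp add: l2_nth_single plus_l2.rep_eq)
    have scaleC: "l2_single j (c *\<^sub>C x) = c *\<^sub>C l2_single j x" for c and x :: 'a
      by (intro l2_eqI) (simp add: l2_nth_single scaleC_l2.rep_eq)
    have scaleC': "l2_nth (app_op Q (l2_single j (c *\<^sub>C x))) i = c *\<^sub>C l2_nth (app_op Q (l2_single j x)) i" for c x
      by (simp add: scaleC app_op_scaleC scaleC_l2.rep_eq)
    have "bounded_linear (\<lambda>x. l2_nth (app_op Q (l2_single j x)) i)"
    proof (rule bounded_linear_intro[where K = K])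
      fix x
      show "norm (l2_nth (app_op Q (l2_single j x)) i) \<le> norm x * K"
        using norm_l2_nth_le[of "app_op Q (l2_single j x)" i] K(2)[of "l2_single j x"]
        by (simp add: norm_l2_single mult.commute)
    qed (simp_all add: add app_op_add plus_l2.rep_eq scaleC' scaleR_eq_scaleC)
    then show ?thesis unfolding q_def by (subst app_op_Abs_op) (simp_all add: scaleC')
  qed
  have amp: "app_op (amplify S) (l2_single j x) = l2_single j (app_op S x)" for S :: "'a bounded_op" and j x
    by (intro l2_eqI) (simp add: l2_nth_amplify l2_nth_single)
  have "q i j \<in> commutant M" for i j
    unfolding commutant_def
  proof (intro CollectI ballI bounded_op_eqI)
    fix S x assume "S \<in> M"
    then have "amplify S * Q = Q * amplify S" using Q by (auto simp: commutant_def)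
    then have "l2_nth (app_op (amplify S * Q) (l2_single j x)) i = l2_nth (app_op (Q * amplify S) (l2_single j x)) i"
      by simp
    then show "app_op (S * q i j) x = app_op (q i j * S) x"
      by (simp add: times_bounded_op_apply l2_nth_amplify amp q)
  qed
  then have comm: "q i j * T = T * q i j" for i j using T unfolding commutant_def by blast
  show "Q * amplify T = amplify T * Q"
  proof (rule bounded_op_l2_eqI, rule l2_eqI)
    fix j x i
    have "app_op (q i j * T) x = app_op (T * q i j) x" using comm by simp
    then show "l2_nth (app_op (Q * amplify T) (l2_single j x)) i = l2_nth (app_op (amplify T * Q) (l2_single j x)) i"
      by (simp add: times_bounded_op_apply l2_nth_amplify amp q)
  qed
qed

inductive_set op_polys :: "'h::complex_hilbert bounded_op \<Rightarrow> 'h bounded_op set" for V where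
  one: "1 \<in> op_polys V"
| add: "P \<in> op_polys V \<Longrightarrow> Q \<in> op_polys V \<Longrightarrow> P + Q \<in> op_polys V"
| scaleC: "P \<in> op_polys V \<Longrightarrow> c *\<^sub>C P \<in> op_polys V"
| mult: "P \<in> op_polys V \<Longrightarrow> V * P \<in> op_polys V"

text \<open>The closure \<open>L\<close> of the vectors p(V) \<xi> is invariant under
  \<open>V\<close>, and so is its orthogonal complement, as \<open>V\<close> is self-adjoint. Thus
  the projection onto \<open>L\<close> commutes with \<open>V\<close>, hence with \<open>T\<close>,
  and \<open>app_op T \<xi>\<close> stays in \<open>L\<close>.\<close>

lemma bicommutant_approx:
  assumes V: "self_adjoint V" and T: "T \<in> commutant (commutant {V, 1})" and e: "e > 0"
  shows "\<exists>P\<in>op_polys V. norm (app_op (T - P) \<xi>) < e"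
proof -
  define L0 where "L0 = (\<lambda>P. app_op P \<xi>) ` op_polys V"
  define L where "L = closure L0"
  have "csubspace L0"
    unfolding csubspace_def
  proof (intro conjI ballI allI)
    have "0 *\<^sub>C 1 \<in> op_polys V" by (intro op_polys.intros)
    moreover have "app_op (0 *\<^sub>C 1) \<xi> = 0"
      using scaleC_of_real[of 0 \<xi>] by (simp add: scaleC_bounded_op.rep_eq one_bounded_op.rep_eq)
    ultimately show "0 \<in> L0" unfolding L0_def by (metis imageI)
    show "x + y \<in> L0" if "x \<in> L0" "y \<in> L0" for x y
      using that op_polys.add unfolding L0_def by (force simp: plus_bounded_op.rep_eq)
    show "c *\<^sub>C x \<in> L0" if "x \<in> L0" for c x
      using that op_polys.scaleC unfolding L0_def by (force simp: scaleC_bounded_op.rep_eq)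
  qed
  then have L: "csubspace L" unfolding L_def by (rule csubspace_closure)
  obtain P where P: "\<And>x. app_op P x \<in> L" "\<And>x y. y \<in> L \<Longrightarrow> cinner y (x - app_op P x) = 0"
    using ex_projection_op[OF L] unfolding L_def by auto
  have VL: "app_op V x \<in> L" if x: "x \<in> L" for x
  proof -
    have L0: "app_op V y \<in> L0" if "y \<in> L0" for y
      using that op_polys.mult unfolding L0_def by (force simp: times_bounded_op_apply)
    obtain f where f: "\<forall>n. f n \<in> L0" "f \<longlonglongrightarrow> x"
      using x unfolding L_def closure_sequential by blast
    then have "(\<lambda>n. app_op V (f n)) \<longlonglongrightarrow> app_op V x"
      by (intro bounded_linear.tendsto[OF bounded_linear_app_op])
    then show ?thesis unfolding L_def closure_sequential
      using f L0 by (intro exI[of _ "\<lambda>n. app_op V (f n)"]) auto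
  qed
  have "V * P = P * V"
  proof (rule bounded_op_eqI)
    fix x
    have "app_op V (app_op P x) = app_op P (app_op V x)"
    proof (rule orthogonal_projection_unique[OF L, of _ _ "app_op V x"])
      show "app_op V (app_op P x) \<in> L" by (intro VL P)
      show "cinner y (app_op V x - app_op V (app_op P x)) = 0" if "y \<in> L" for y
      proof -
        have "cinner y (app_op V (x - app_op P x)) = cinner (app_op V y) (x - app_op P x)"
          using V by (simp add: self_adjoint_def)
        also have "\<dots> = 0" by (intro P VL that)
        finally show ?thesis by (simp add: app_op_diff)
      qed
    qed (use P in auto)
    then show "app_op (V * P) x = app_op (P * V) x" by (simp add: times_bounded_op_apply)
  qed
  then have "P \<in> commutant {V, 1}" by (simp add: commutant_def)
  then have comm: "P * T = T * P" using T by (simp add: commutant_def)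
  have fixed: "app_op P x = x" if "x \<in> L" for x
    using orthogonal_projection_unique[OF L, of "app_op P x" x x] P that by simp
  have "\<xi> \<in> L0"
    unfolding L0_def using op_polys.one[of V] by (force simp: one_bounded_op.rep_eq)
  then have "\<xi> \<in> L" using closure_subset by (auto simp: L_def)
  then have "app_op T \<xi> = app_op (T * P) \<xi>" by (simp add: times_bounded_op_apply fixed)
  also have "\<dots> = app_op P (app_op T \<xi>)" by (simp add: comm[symmetric] times_bounded_op_apply)
  finally have "app_op T \<xi> \<in> L" using P(1) by metis
  then obtain y where "y \<in> L0" "dist y (app_op T \<xi>) < e"
    unfolding L_def using e by (auto simp: closure_approachable)
  then show ?thesis
    unfolding L0_def by (auto simp: dist_norm norm_minus_commute minus_bounded_op.rep_eq)
qed

lemma op_polys_amplify: "P \<in> op_polys (amplify V) \<Longrightarrow> \<exists>Q\<in>op_polys V. P = amplify Q"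
proof (induction rule: op_polys.induct)
  case one
  then show ?case using amplify_one op_polys.one by metis
next
  case (add P Q)
  then show ?case using amplify_add op_polys.add by metis
next
  case (scaleC P c)
  then show ?case using amplify_scaleC op_polys.scaleC by metis
next
  case (mult P)
  then show ?case using amplify_mult op_polys.mult by metis
qed

text \<open>
  Finitely many square-summable sequences are combined into one vector of \<open>\<ell>\<^sup>2(\<ell>\<^sup>2(H))\<close>, so that
  the approximation in a single vector applies.
\<close>

lemma bicommutant_approx_l2:
  fixes F :: "'h::complex_hilbert l2 set"
  assumes V: "self_adjoint V" and T: "T \<in> commutant (commutant {V, 1})" and e: "e > 0" and F: "finite F"
  shows "\<exists>P\<in>op_polys V. \<forall>\<xi>\<in>F. norm (app_op (amplify (T - P)) \<xi>) < e"
proof -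
  obtain f and m :: nat where f: "F = f ` {i. i < m}"
    using finite_imp_nat_seg_image_inj_on[OF F] by blast
  define \<Xi> where "\<Xi> = Abs_l2 (\<lambda>i. if i < m then f i else 0)"
  have "summable (\<lambda>i. (norm (if i < m then f i else 0))\<^sup>2)"
    by (rule summable_finite[of "{..<m}"]) auto
  then have \<Xi>: "l2_nth \<Xi> i = (if i < m then f i else 0)" for i
    unfolding \<Xi>_def by (simp add: Abs_l2_inverse)
  have "amplify (amplify T) \<in> commutant (commutant {amplify (amplify V), 1})"
    using amplify_bicommutant[OF amplify_bicommutant[OF T]] by (simp add: amplify_one)
  then obtain P' where P': "P' \<in> op_polys (amplify (amplify V))"
    "norm (app_op (amplify (amplify T) - P') \<Xi>) < e"
    using bicommutant_approx[OF self_adjoint_amplify[OF self_adjoint_amplify[OF V]] _ e] by blast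
  then obtain P where P: "P \<in> op_polys V" "P' = amplify (amplify P)"
    using op_polys_amplify by metis
  have "norm (app_op (amplify (T - P)) (f i)) < e" if "i < m" for i
  proof -
    have "norm (app_op (amplify (T - P)) (f i)) = norm (l2_nth (app_op (amplify (amplify (T - P))) \<Xi>) i)"
      using that by (simp add: l2_nth_amplify \<Xi>)
    also have "\<dots> \<le> norm (app_op (amplify (amplify (T - P))) \<Xi>)" by (rule norm_l2_nth_le)
    also have "\<dots> < e" using P'(2) by (simp add: P amplify_diff)
    finally show ?thesis .
  qed
  then show ?thesis using P f by blast
qed

subsection \<open>Normal traces\<close>

lemma cinner_Abs_l2:
  assumes "summable (\<lambda>n. (norm (\<xi> n))\<^sup>2)" "summable (\<lambda>n. (norm (\<eta> n))\<^sup>2)"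
  shows "(\<Sum>n. cinner (\<eta> n) (app_op T (\<xi> n))) = cinner (Abs_l2 \<eta>) (app_op (amplify T) (Abs_l2 \<xi>))"
  using assms by (simp add: cinner_l2_def l2_nth_amplify Abs_l2_inverse)

text \<open>The topology is given by a subbasis only. Induction over its generation shows that each
  open set contains a neighbourhood given by finitely many matrix coefficients of amplified
  operators.\<close>

lemma ultraweak_open_nhd:
  fixes U :: "'h::complex_hilbert bounded_op set"
  assumes "openin ultraweak_topology U" "T0 \<in> U"
  shows "\<exists>F e. finite F \<and> e > 0 \<and>
    (\<forall>T. (\<forall>(\<eta>, \<xi>)\<in>F. cmod (cinner \<eta> (app_op (amplify (T - T0)) \<xi>)) < e) \<longrightarrow> T \<in> U)"
proof -
  define \<B> :: "'h bounded_op set set" where "\<B> = {{T. (\<Sum>n. cinner (\<eta> n) (app_op T (\<xi> n))) \<in> G} | \<xi> \<eta> G.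
        summable (\<lambda>n::nat. (norm (\<xi> n))\<^sup>2) \<and> summable (\<lambda>n. (norm (\<eta> n))\<^sup>2) \<and> open G}"
  have "generate_topology_on \<B> U"
    using assms(1) unfolding ultraweak_topology_def \<B>_def openin_topology_generated_by_iff .
  then show ?thesis using assms(2)
  proof (induction arbitrary: T0 rule: generate_topology_on.induct)
    case Empty
    then show ?case by simp
  next
    case (Int U V)
    then obtain F e G d where "finite F" "e > 0" "finite G" "d > 0"
      and F: "\<forall>T. (\<forall>(\<eta>, \<xi>)\<in>F. cmod (cinner \<eta> (app_op (amplify (T - T0)) \<xi>)) < e) \<longrightarrow> T \<in> U"
      and G: "\<forall>T. (\<forall>(\<eta>, \<xi>)\<in>G. cmod (cinner \<eta> (app_op (amplify (T - T0)) \<xi>)) < d) \<longrightarrow> T \<in> V"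
      by (metis IntD1 IntD2)
    then show ?case
      by (intro exI[of _ "F \<union> G"] exI[of _ "min e d"]) fastforce
  next
    case (UN K)
    then obtain U where "U \<in> K" "T0 \<in> U" by blast
    from UN.IH[OF this] obtain F e where "finite F" "e > 0"
      "\<forall>T. (\<forall>(\<eta>, \<xi>)\<in>F. cmod (cinner \<eta> (app_op (amplify (T - T0)) \<xi>)) < e) \<longrightarrow> T \<in> U"
      by blast
    then show ?case using \<open>U \<in> K\<close> by (intro exI[of _ F] exI[of _ e]) blast
  next
    case (Basis U)
    then obtain \<xi> \<eta> G where U: "U = {T. (\<Sum>n. cinner (\<eta> n) (app_op T (\<xi> n))) \<in> G}"
      and sm: "summable (\<lambda>n::nat. (norm (\<xi> n))\<^sup>2)" "summable (\<lambda>n. (norm (\<eta> n))\<^sup>2)" and "open G"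
      unfolding \<B>_def by blast
    let ?\<phi> = "\<lambda>T. cinner (Abs_l2 \<eta>) (app_op (amplify T) (Abs_l2 \<xi>))"
    have U': "U = {T. ?\<phi> T \<in> G}" unfolding U cinner_Abs_l2[OF sm] ..
    then have "?\<phi> T0 \<in> G" using Basis.prems by simp
    then obtain e where e: "e > 0" "ball (?\<phi> T0) e \<subseteq> G" using \<open>open G\<close> open_contains_ball by blast
    have diff: "?\<phi> (T - T0) = ?\<phi> T - ?\<phi> T0" for T
      by (simp add: amplify_diff minus_bounded_op.rep_eq cinner_diff_right)
    show ?case
    proof (intro exI[of _ "{(Abs_l2 \<eta>, Abs_l2 \<xi>)}"] exI[of _ e] conjI allI impI)
      fix T assume "\<forall>(\<eta>, \<xi>)\<in>{(Abs_l2 \<eta>, Abs_l2 \<xi>)}. cmod (cinner \<eta> (app_op (amplify (T - T0)) \<xi>)) < e"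
      then have "cmod (?\<phi> T - ?\<phi> T0) < e" by (simp add: diff)
      then have "?\<phi> T \<in> ball (?\<phi> T0) e" by (simp add: dist_norm norm_minus_commute)
      then show "T \<in> U" using e U' by blast
    qed (use e in auto)
  qed
qed

section \<open>Commutants and generated von Neumann algebras\<close>

lemma one_mem_commutant: "1 \<in> commutant M"
  by (simp add: commutant_def)

lemma mult_mem_commutant: "S \<in> commutant M \<Longrightarrow> T \<in> commutant M \<Longrightarrow> S * T \<in> commutant M"
  unfolding commutant_def by (auto simp: mult.assoc) (metis mult.assoc)

lemma add_mem_commutant: "S \<in> commutant M \<Longrightarrow> T \<in> commutant M \<Longrightarrow> S + T \<in> commutant M"
  unfolding commutant_def by (simp add: distrib_left distrib_right)

lemma scaleC_mult_left: "(c *\<^sub>C S) * T = c *\<^sub>C (S * (T :: 'h::complex_hilbert bounded_op))"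
  by (intro bounded_op_eqI) (simp add: times_bounded_op_apply scaleC_bounded_op.rep_eq)

lemma scaleC_mult_right: "S * (c *\<^sub>C T) = c *\<^sub>C (S * (T :: 'h::complex_hilbert bounded_op))"
  by (intro bounded_op_eqI) (simp add: times_bounded_op_apply scaleC_bounded_op.rep_eq app_op_scaleC)

lemma scaleR_mult_left: "(c *\<^sub>R S) * T = c *\<^sub>R (S * (T :: 'h::complex_hilbert bounded_op))"
  by (simp add: scaleR_eq_scaleC scaleC_mult_left)

lemma scaleR_mult_right: "S * (c *\<^sub>R T) = c *\<^sub>R (S * (T :: 'h::complex_hilbert bounded_op))"
  by (simp add: scaleR_eq_scaleC scaleC_mult_right)

lemma scaleC_mem_commutant: "S \<in> commutant M \<Longrightarrow> c *\<^sub>C S \<in> commutant M"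
  unfolding commutant_def by (simp add: scaleC_mult_left scaleC_mult_right)

lemma commutant_antimono: "M \<subseteq> N \<Longrightarrow> commutant N \<subseteq> commutant M"
  unfolding commutant_def by blast

lemma subset_bicommutant: "M \<subseteq> commutant (commutant M)"
  unfolding commutant_def by auto

lemma von_neumann_algebra_bicommutant:
  assumes "self_adjoint V"
  shows "von_neumann_algebra (commutant (commutant {V, 1}))"
  unfolding von_neumann_algebra_def
proof (intro conjI ballI)
  have one: "adj 1 = (1 :: 'a bounded_op)"
    by (rule adj_eqI) (simp add: one_bounded_op.rep_eq)
  have "adj S \<in> {V, 1}" if "S \<in> {V, 1}" for S
    using that adj_self_adjoint[OF assms] one by auto
  then have "adj S \<in> commutant {V, 1}" if "S \<in> commutant {V, 1}" for S
    using that commutant_adj by blast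
  then show "adj T \<in> commutant (commutant {V, 1})" if "T \<in> commutant (commutant {V, 1})" for T
    using that commutant_adj by blast
  have "commutant (commutant (commutant {V, 1})) = commutant {V, 1}"
    by (intro equalityI subset_bicommutant commutant_antimono)
  then show "commutant (commutant (commutant (commutant {V, 1}))) = commutant (commutant {V, 1})"
    by simp
qed

text \<open>By this inclusion the elements of the hull, an intersection of von Neumann algebras,
  inherit the approximation by polynomials in \<open>V\<close>.\<close>

lemma hull_subset_bicommutant:
  assumes "self_adjoint V"
  shows "von_neumann_algebra hull {V, 1} \<subseteq> commutant (commutant {V, 1})"
  by (intro hull_minimal subset_bicommutant von_neumann_algebra_bicommutant assms)

lemma von_neumann_algebra_closed:
  assumes "von_neumann_algebra N"
  shows "1 \<in> N" "S \<in> N \<Longrightarrow> T \<in> N \<Longrightarrow> S * T \<in> N" "S \<in> N \<Longrightarrow> T \<in> N \<Longrightarrow> S + T \<in> N"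
    "S \<in> N \<Longrightarrow> c *\<^sub>C S \<in> N" "S \<in> N \<Longrightarrow> r *\<^sub>R S \<in> N" "S \<in> N \<Longrightarrow> T \<in> N \<Longrightarrow> S - T \<in> N"
    "S \<in> N \<Longrightarrow> S ^ n \<in> N" "0 \<in> N"
proof -
  have N: "N = commutant (commutant N)" using assms by (simp add: von_neumann_algebra_def)
  show one: "1 \<in> N" by (subst N) (rule one_mem_commutant)
  show mult: "S * T \<in> N" if "S \<in> N" "T \<in> N" for S T
    using that mult_mem_commutant[of _ "commutant N"] N by auto
  show add: "S + T \<in> N" if "S \<in> N" "T \<in> N" for S T
    using that add_mem_commutant[of _ "commutant N"] N by auto
  show scaleC: "c *\<^sub>C S \<in> N" if "S \<in> N" for S c
    using that scaleC_mem_commutant[of _ "commutant N"] N by auto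
  show scaleR: "r *\<^sub>R S \<in> N" if "S \<in> N" for S r
    unfolding scaleR_eq_scaleC by (intro scaleC that)
  show diff: "S - T \<in> N" if "S \<in> N" "T \<in> N" for S T
    using add[OF that(1) scaleR[OF that(2), of "- 1"]] by simp
  show "S ^ n \<in> N" if "S \<in> N" for S
    by (induction n) (use that one mult in auto)
  show "0 \<in> N" using diff[OF one one] by simp
qed

definition ultraweak_seminorm :: "('h::complex_hilbert l2 \<times> 'h l2) set \<Rightarrow> 'h bounded_op \<Rightarrow> real" where
  "ultraweak_seminorm F T = (\<Sum>(\<eta>, \<xi>)\<in>F. cmod (cinner \<eta> (app_op (amplify T) \<xi>)))"

lemma ultraweak_seminorm_nonneg: "0 \<le> ultraweak_seminorm F T"
  unfolding ultraweak_seminorm_def by (intro sum_nonneg) auto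

lemma ultraweak_seminorm_le:
  assumes "\<And>\<xi>. \<xi> \<in> snd ` F \<Longrightarrow> norm (app_op (amplify T) \<xi>) \<le> K \<xi>"
  shows "ultraweak_seminorm F T \<le> (\<Sum>(\<eta>, \<xi>)\<in>F. norm \<eta> * K \<xi>)"
  unfolding ultraweak_seminorm_def
proof (intro sum_mono, clarify)
  fix \<eta> \<xi> assume "(\<eta>, \<xi>) \<in> F"
  then have "norm (app_op (amplify T) \<xi>) \<le> K \<xi>" by (intro assms) force
  then show "cmod (cinner \<eta> (app_op (amplify T) \<xi>)) \<le> norm \<eta> * K \<xi>"
    by (intro order_trans[OF norm_cinner_le] mult_left_mono) auto
qed

section \<open>Estimates for a normal trace\<close>

context tracial_von_neumann_algebra
begin

lemmas closed = von_neumann_algebra_closed[OF vna]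

lemma trace_scaleR: "T \<in> A \<Longrightarrow> \<tau> (r *\<^sub>R T) = complex_of_real r * \<tau> T"
  unfolding scaleR_eq_scaleC by (rule trace_scaleC)

lemma trace_zero: "\<tau> 0 = 0"
  using trace_scaleR[OF closed(1), of 0] by simp

lemma trace_diff: "S \<in> A \<Longrightarrow> T \<in> A \<Longrightarrow> \<tau> (S - T) = \<tau> S - \<tau> T"
  using trace_add[of S "(- 1) *\<^sub>R T"] trace_scaleR[of T "- 1"] closed(5)[of T "- 1"] by simp

text \<open>Continuity at 0 gives a neighbourhood on which the trace has modulus below 1, and
  scaling an operator into it gives the linear bound.\<close>

lemma trace_ultraweak_bound:
  obtains F C where "finite F" "C \<ge> 0" "\<And>T. T \<in> A \<Longrightarrow> cmod (\<tau> T) \<le> C * ultraweak_seminorm F T"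
proof -
  let ?U = "ultraweak_topology :: 'h bounded_op topology"
  have "openin (subtopology ?U A) {T \<in> topspace (subtopology ?U A). \<tau> T \<in> ball 0 1}"
    using trace_normal by (rule openin_continuous_map_preimage) simp
  then obtain U where U: "openin ?U U"
    "{T \<in> topspace (subtopology ?U A). \<tau> T \<in> ball 0 1} = U \<inter> A"
    unfolding openin_subtopology by blast
  have "UNIV \<in> {{T. (\<Sum>n. cinner (\<eta> n) (app_op T (\<xi> n))) \<in> G} | \<xi> \<eta> G.
        summable (\<lambda>n::nat. (norm (\<xi> n :: 'h))\<^sup>2) \<and> summable (\<lambda>n. (norm (\<eta> n))\<^sup>2) \<and> open G}"
    by (intro CollectI exI[of _ "\<lambda>_. 0"] exI[of _ UNIV]) simp
  from Union_upper[OF this] have "topspace ?U = UNIV"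
    unfolding ultraweak_topology_def topology_generated_by_topspace by (rule top_le)
  then have "0 \<in> {T \<in> topspace (subtopology ?U A). \<tau> T \<in> ball 0 1}"
    using closed(8) by (simp add: trace_zero)
  then have "0 \<in> U" using U by blast
  then obtain F e where F: "finite F" "e > 0"
    "\<And>T. (\<forall>(\<eta>, \<xi>)\<in>F. cmod (cinner \<eta> (app_op (amplify (T - 0)) \<xi>)) < e) \<Longrightarrow> T \<in> U"
    using ultraweak_open_nhd[OF U(1)] by metis
  have "cmod (\<tau> T) \<le> (1 / e) * ultraweak_seminorm F T" if T: "T \<in> A" for T
  proof -
    define s where "s = ultraweak_seminorm F T"
    have s: "s \<ge> 0" unfolding s_def by (rule ultraweak_seminorm_nonneg)
    have "cmod (\<tau> T) \<le> s / e + d" if d: "d > 0" for d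
    proof -
      \<comment> \<open>The scaling yields \<open>c * s < e\<close>, and 1 / c is s / e + d. The
        extra \<open>d\<close> covers the case that the seminorm \<open>s\<close> is 0.\<close>
      define c where "c = e / (s + d * e)"
      have pos: "s + d * e > 0" using s d F(2) by (simp add: add_nonneg_pos)
      then have c: "c > 0" using F(2) by (simp add: c_def)
      have "c *\<^sub>R T \<in> U"
      proof (rule F(3), clarify)
        fix \<eta> \<xi> assume "(\<eta>, \<xi>) \<in> F"
        then have "cmod (cinner \<eta> (app_op (amplify T) \<xi>)) \<le> s"
          unfolding s_def ultraweak_seminorm_def using member_le_sum[of "(\<eta>, \<xi>)" F "\<lambda>(\<eta>, \<xi>). cmod (cinner \<eta> (app_op (amplify T) \<xi>))"] F(1)
          by auto
        then have "c * cmod (cinner \<eta> (app_op (amplify T) \<xi>)) \<le> c * s" using c by simp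
        also have "\<dots> < e"
          using pos d F(2) s by (simp add: c_def divide_less_eq)
        finally show "cmod (cinner \<eta> (app_op (amplify (c *\<^sub>R T - 0)) \<xi>)) < e"
          using c by (simp add: scaleR_eq_scaleC amplify_scaleC scaleC_bounded_op.rep_eq cinner_scaleC_right norm_mult)
      qed
      then have "\<tau> (c *\<^sub>R T) \<in> ball 0 1" using U(2) closed(5)[OF T] by blast
      then have "c * cmod (\<tau> T) < 1" using c by (simp add: trace_scaleR[OF T] norm_mult)
      then have "cmod (\<tau> T) < 1 / c" using c by (simp add: field_simps)
      also have "1 / c = s / e + d" using F(2) by (simp add: c_def field_simps)
      finally show ?thesis by simp
    qed
    then show ?thesis unfolding s_def[symmetric] by (simp add: field_le_epsilon)
  qed
  then show thesis using that[of F "1 / e"] F by simp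
qed

text \<open>Normality provides the growth bound for the moment problem: the trace is dominated by
  finitely many matrix coefficients, which grow at most geometrically along the powers.\<close>

lemma trace_power_bound:
  assumes "T \<in> A"
  shows "\<exists>C r. r > 0 \<and> (\<forall>n. cmod (\<tau> (T ^ n)) \<le> C * r ^ n)"
proof -
  obtain F C where F: "finite F" "C \<ge> 0"
    "\<And>T. T \<in> A \<Longrightarrow> cmod (\<tau> T) \<le> C * ultraweak_seminorm F T"
    using trace_ultraweak_bound by metis
  obtain K where K: "K \<ge> 0" "\<And>x. norm (app_op (amplify T) x) \<le> K * norm x" using bounded_op_bound[of "amplify T"] by blast
  define r where "r = K + 1"
  have pow: "norm (app_op (amplify (T ^ n)) x) \<le> r ^ n * norm x" for n x
  proof (induction n)
    case (Suc n)
    have "norm (app_op (amplify (T ^ Suc n)) x) \<le> K * norm (app_op (amplify (T ^ n)) x)"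
      using K(2) by (simp add: amplify_mult times_bounded_op_apply)
    also have "\<dots> \<le> r * (r ^ n * norm x)"
      using Suc K(1) by (intro mult_mono) (auto simp: r_def)
    finally show ?case by (simp add: mult.assoc)
  qed (simp add: amplify_one one_bounded_op.rep_eq)
  define s where "s = (\<Sum>(\<eta>, \<xi>)\<in>F. norm \<eta> * norm \<xi>)"
  have "cmod (\<tau> (T ^ n)) \<le> (C * s) * r ^ n" for n
  proof -
    have "ultraweak_seminorm F (T ^ n) \<le> (\<Sum>(\<eta>, \<xi>)\<in>F. norm \<eta> * (r ^ n * norm \<xi>))"
      by (rule ultraweak_seminorm_le[OF pow])
    also have "\<dots> = s * r ^ n" unfolding s_def sum_distrib_right by (simp add: case_prod_unfold mult_ac)
    finally have "C * ultraweak_seminorm F (T ^ n) \<le> C * (s * r ^ n)" using F(2) by (rule mult_left_mono)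
    then show ?thesis using F(3)[OF closed(7)[OF assms], of n] by (simp add: mult.assoc)
  qed
  moreover have "r > 0" using K by (simp add: r_def)
  ultimately show ?thesis by blast
qed

lemma hull_subset: "V \<in> A \<Longrightarrow> von_neumann_algebra hull {V, 1} \<subseteq> A"
  by (rule hull_minimal) (use closed(1) vna in auto)

text \<open>A polynomial \<open>P\<close> in \<open>V\<close> approximates \<open>W\<close> on the
  finitely many vectors that bound the trace. Left multiplication by \<open>D\<close> keeps the
  error small, and the trace of \<open>D * P\<close> is 0.\<close>

lemma trace_eq_0_on_hull:
  assumes V: "V \<in> A" "self_adjoint V" and D: "D \<in> A"
    and zero: "\<And>n. \<tau> (D * V ^ n) = 0" and W: "W \<in> von_neumann_algebra hull {V, 1}"
  shows "\<tau> (D * W) = 0"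
proof -
  obtain F C where F: "finite F" "C \<ge> 0"
    "\<And>T. T \<in> A \<Longrightarrow> cmod (\<tau> T) \<le> C * ultraweak_seminorm F T"
    using trace_ultraweak_bound by metis
  have WA: "W \<in> A" by (rule subsetD[OF hull_subset[OF V(1)] W])
  have WV: "W \<in> commutant (commutant {V, 1})" by (rule subsetD[OF hull_subset_bicommutant[OF V(2)] W])
  \<comment> \<open>The power of \<open>V\<close> in the claim absorbs the factor \<open>V\<close>
    that \<open>op_polys\<close> adds on the left.\<close>
  have polys: "P \<in> A \<and> (\<forall>n. \<tau> (D * (V ^ n * P)) = 0)" if "P \<in> op_polys V" for P
    using that
  proof (induction rule: op_polys.induct)
    case one
    then show ?case using closed(1) zero by simp
  next
    case (add P Q)
    then show ?case using closed D V by (auto simp: distrib_left trace_add)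
  next
    case (scaleC P c)
    then show ?case using closed D V by (auto simp: scaleC_mult_right trace_scaleC)
  next
    case (mult P)
    have eq: "V ^ n * (V * P) = V ^ Suc n * P" for n
      by (simp only: mult.assoc[symmetric] power_Suc2)
    show ?case unfolding eq using mult.IH closed(2)[OF V(1)] by blast
  qed
  obtain K where K: "K \<ge> 0" "\<And>x. norm (app_op (amplify D) x) \<le> K * norm x" using bounded_op_bound[of "amplify D"] by blast
  define s where "s = (\<Sum>(\<eta>, \<xi>)\<in>F. norm \<eta>)"
  have bound: "cmod (\<tau> (D * W)) \<le> (C * (s * K)) * e" if e: "e > 0" for e
  proof -
    obtain P where P: "P \<in> op_polys V" "\<forall>\<xi>\<in>snd ` F. norm (app_op (amplify (W - P)) \<xi>) < e"
      using bicommutant_approx_l2[OF V(2) WV e, of "snd ` F"] F(1) by blast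
    have PA: "P \<in> A" "\<tau> (D * P) = 0" using polys[OF P(1)] by (auto dest: spec[of _ 0])
    have "ultraweak_seminorm F (D * (W - P)) \<le> (\<Sum>(\<eta>, \<xi>)\<in>F. norm \<eta> * (K * e))"
    proof (rule ultraweak_seminorm_le)
      fix \<xi> assume "\<xi> \<in> snd ` F"
      then have "K * norm (app_op (amplify (W - P)) \<xi>) \<le> K * e"
        using P(2) K(1) by (intro mult_left_mono) auto
      then show "norm (app_op (amplify (D * (W - P))) \<xi>) \<le> K * e"
        using K(2)[of "app_op (amplify (W - P)) \<xi>"] by (simp add: amplify_mult times_bounded_op_apply)
    qed
    also have "\<dots> = s * K * e" unfolding s_def sum_distrib_right by (simp add: case_prod_unfold mult_ac)
    finally have "C * ultraweak_seminorm F (D * (W - P)) \<le> C * (s * K * e)" using F(2) by (rule mult_left_mono)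
    moreover have "cmod (\<tau> (D * (W - P))) \<le> C * ultraweak_seminorm F (D * (W - P))"
      by (intro F(3) closed(2)[OF D] closed(6)[OF WA] PA)
    moreover have "\<tau> (D * W) = \<tau> (D * (W - P))"
      using PA(2) trace_diff[OF closed(2)[OF D WA] closed(2)[OF D PA(1)]] by (simp add: right_diff_distrib)
    ultimately show ?thesis by (simp add: mult.assoc)
  qed
  have "((\<lambda>e. (C * (s * K)) * e) \<longlongrightarrow> (C * (s * K)) * 0) (at_right 0)"
    by (intro tendsto_intros)
  then have "cmod (\<tau> (D * W)) \<le> (C * (s * K)) * 0"
    by (rule tendsto_lowerbound) (auto intro: eventually_mono[OF eventually_at_right_less] bound)
  then show ?thesis by simp
qed

end

subsection \<open>Laws and conditional expectations\<close>

lemma scaleR_power_bounded_op: "(c *\<^sub>R T) ^ n = c ^ n *\<^sub>R (T ^ n :: 'h::complex_hilbert bounded_op)"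
  by (induction n) (simp_all add: scaleR_mult_left scaleR_mult_right mult.commute)

section \<open>Real polynomials in one operator\<close>

definition op_poly :: "'h::complex_hilbert bounded_op \<Rightarrow> real poly \<Rightarrow> 'h bounded_op" where
  "op_poly T p = fold_coeffs (\<lambda>a S. a *\<^sub>R 1 + T * S) p 0"

lemma op_poly_0 [simp]: "op_poly T 0 = 0"
  by (simp add: op_poly_def)

lemma op_poly_pCons [simp]: "op_poly T (pCons a p) = a *\<^sub>R 1 + T * op_poly T p"
  by (cases "p = 0 \<and> a = 0") (auto simp: op_poly_def)

lemma op_poly_1 [simp]: "op_poly T 1 = 1"
  by (simp add: one_pCons)

lemma op_poly_add: "op_poly T (p + q) = op_poly T p + op_poly T q"
  by (induction p q rule: poly_induct2) (simp_all add: scaleR_add_left distrib_left)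

lemma op_poly_smult: "op_poly T (smult c p) = c *\<^sub>R op_poly T p"
  by (induction p) (simp_all add: scaleR_add_right scaleR_mult_right)

lemma op_poly_mult: "op_poly T (p * q) = op_poly T p * op_poly T q"
  by (induction p) (simp_all add: op_poly_add op_poly_smult distrib_right scaleR_mult_left mult.assoc)

lemma op_poly_X_power: "op_poly T ([:0, 1:] ^ n) = T ^ n"
  by (induction n) (simp_all add: op_poly_mult del: mult_pCons_left)

lemma self_adjoint_op_poly:
  assumes T: "self_adjoint T"
  shows "self_adjoint (op_poly T p)"
proof (induction p)
  case 0
  show ?case by (simp add: self_adjoint_def zero_bounded_op.rep_eq)
next
  case (pCons a p)
  have "op_poly T ([:0, 1:] * p) = op_poly T (p * [:0, 1:])" by (simp only: mult.commute)
  then have comm: "T * op_poly T p = op_poly T p * T" unfolding op_poly_mult by simp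
  have "cinner (app_op (T * op_poly T p) x) y = cinner x (app_op (T * op_poly T p) y)" for x y
  proof -
    have "cinner (app_op T (app_op (op_poly T p) x)) y = cinner x (app_op (op_poly T p) (app_op T y))"
      using T pCons.IH by (simp add: self_adjoint_def)
    then show ?thesis
      by (subst (2) comm) (simp add: times_bounded_op_apply)
  qed
  then show ?case
    by (simp add: self_adjoint_def plus_bounded_op.rep_eq scaleR_bounded_op.rep_eq one_bounded_op.rep_eq
        cinner_add_left cinner_add_right cinner_scaleR_left cinner_scaleR_right)
qed

context tracial_von_neumann_algebra
begin

lemma tracial_linear: "tracial_linear A \<tau>"
proof
  fix P Q S T c d assume mem: "P \<in> A" "Q \<in> A" "S \<in> A" "T \<in> A"
  have "P * (c *\<^sub>R S + d *\<^sub>R T) * Q = c *\<^sub>R (P * S * Q) + d *\<^sub>R (P * T * Q)"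
    by (simp add: distrib_left distrib_right scaleR_mult_left scaleR_mult_right)
  then show "\<tau> (P * (c *\<^sub>R S + d *\<^sub>R T) * Q) =
      complex_of_real c * \<tau> (P * S * Q) + complex_of_real d * \<tau> (P * T * Q)"
    using mem closed by (simp add: trace_add trace_scaleR)
qed (use closed trace_one in auto)

lemma op_poly_mem: "T \<in> A \<Longrightarrow> op_poly T p \<in> A"
  by (induction p) (simp_all add: closed)

lemma trace_square_self_adjoint:
  assumes "S \<in> A" "self_adjoint S"
  shows "\<tau> (S * S) \<in> \<real>\<^sub>\<ge>\<^sub>0"
  using trace_positive[OF assms(1)] adj_self_adjoint[OF assms(2)] by simp

text \<open>Positivity concerns squares only; the cross term in the trace of (1 + S)^2 isolates the
  trace of \<open>S\<close>.\<close>

lemma trace_self_adjoint_real: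
  assumes "S \<in> A" "self_adjoint S"
  shows "\<tau> S \<in> \<real>"
proof -
  have "self_adjoint (1 + S)"
    using assms(2) by (simp add: self_adjoint_def plus_bounded_op.rep_eq one_bounded_op.rep_eq cinner_add_left cinner_add_right)
  then have "\<tau> ((1 + S) * (1 + S)) \<in> \<real>\<^sub>\<ge>\<^sub>0"
    using assms closed by (intro trace_square_self_adjoint) auto
  moreover have "\<tau> ((1 + S) * (1 + S)) = 1 + (\<tau> S + \<tau> S) + \<tau> (S * S)"
    using assms closed by (simp add: distrib_left distrib_right trace_add trace_one)
  moreover have "\<tau> (S * S) \<in> \<real>\<^sub>\<ge>\<^sub>0" using assms by (rule trace_square_self_adjoint)
  ultimately show ?thesis by (simp add: complex_is_Real_iff complex_nonneg_Reals_iff)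
qed

lemma ex_distribution:
  assumes T: "T \<in> A" "self_adjoint T"
  shows "\<exists>\<mu> r. r > 0 \<and> real_distribution \<mu> \<and> (AE y in \<mu>. \<bar>y\<bar> \<le> r) \<and>
    (\<forall>n. \<tau> (T ^ n) = complex_of_real (\<integral>y. y ^ n \<partial>\<mu>))"
proof -
  define L where "L p = Re (\<tau> (op_poly T p))" for p
  obtain C r where r: "r > 0" "\<And>n. cmod (\<tau> (T ^ n)) \<le> C * r ^ n"
    using trace_power_bound[OF T(1)] by blast
  have "poly_functional L"
    using op_poly_mem[OF T(1)]
    by unfold_locales (simp_all add: L_def op_poly_add op_poly_smult trace_add trace_scaleR trace_one)
  moreover have "0 \<le> L (p * p)" for p
    using trace_square_self_adjoint[OF op_poly_mem[OF T(1)] self_adjoint_op_poly[OF T(2)], of p]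
    by (simp add: L_def op_poly_mult complex_nonneg_Reals_iff)
  moreover have "\<bar>L ([:0, 1:] ^ n)\<bar> \<le> C * r ^ n" for n
    unfolding L_def op_poly_X_power using abs_Re_le_cmod r(2) order_trans by blast
  ultimately obtain \<mu> where \<mu>: "real_distribution \<mu>" "AE y in \<mu>. y \<in> {-r..r}"
    "\<And>n. (\<integral>y. y ^ n \<partial>\<mu>) = L ([:0, 1:] ^ n)"
    using bounded_moment_problem[of L r C] r(1) by blast
  have "\<tau> (T ^ n) \<in> \<real>" for n
    using trace_self_adjoint_real[OF op_poly_mem[OF T(1)] self_adjoint_op_poly[OF T(2)], of "[:0, 1:] ^ n"]
    unfolding op_poly_X_power .
  then have "\<tau> (T ^ n) = complex_of_real (\<integral>y. y ^ n \<partial>\<mu>)" for n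
    unfolding \<mu>(3) L_def op_poly_X_power by simp
  moreover have "AE y in \<mu>. \<bar>y\<bar> \<le> r" using \<mu>(2) by eventually_elim auto
  ultimately show ?thesis using \<mu>(1) r(1) by blast
qed

lemma has_free_meixner_law_iff_moments:
  assumes T: "T \<in> A" "self_adjoint T"
  shows "has_free_meixner_law \<tau> T a b \<longleftrightarrow> moment_quadratic 1 (of_real a) (of_real b) (moment_fps \<tau> T)"
    (is "_ \<longleftrightarrow> ?quad (moment_fps \<tau> T)")
proof -
  have quad: "?quad M \<longleftrightarrow> (fps_const (of_real b) + fps_const (of_real a) * fps_X + fps_X\<^sup>2) * M\<^sup>2
    - (fps_const (1 + 2 * of_real b) + fps_const (of_real a) * fps_X) * M + fps_const (1 + of_real b) = 0"
    (is "_ \<longleftrightarrow> ?Q = 0") for M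
  proof -
    have "fps_const (1 + 2 * complex_of_real b) = 1 + 2 * fps_const (of_real b)"
      "fps_const (1 + complex_of_real b) = 1 + fps_const (of_real b)"
      by (simp_all add: numeral_fps_const flip: fps_const_add fps_const_mult fps_const_1_eq_1)
    then have "?Q = (fps_X * M)\<^sup>2 + fps_const (of_real a) * fps_X * (M - 1) * M + fps_const (of_real b) * (M - 1)\<^sup>2 - (M - 1)"
      by (simp only:) (simp add: power2_eq_square algebra_simps)
    then show ?thesis by (auto simp: moment_quadratic_def)
  qed
  have moments: "moment_fps \<tau> T = compact_real_distribution.moments \<mu>"
    if "compact_real_distribution \<mu> r" "\<And>n. \<tau> (T ^ n) = complex_of_real (\<integral>y. y ^ n \<partial>\<mu>)" for \<mu> r
    using that by (simp add: moment_fps_def compact_real_distribution.moments_def)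
  show ?thesis
  proof
    assume "has_free_meixner_law \<tau> T a b"
    then obtain \<mu> where \<mu>: "free_meixner a b \<mu>" "real_distribution \<mu>" "compactly_supported \<mu>"
      "\<And>n. \<tau> (T ^ n) = complex_of_real (\<integral>y. y ^ n \<partial>\<mu>)"
      by (auto simp: has_free_meixner_law_def has_law_def)
    then obtain K where K: "compact K" "AE y in \<mu>. y \<in> K" by (auto simp: compactly_supported_def)
    obtain r where r: "r > 0" "\<And>y. y \<in> K \<Longrightarrow> \<bar>y\<bar> \<le> r"
      using compact_imp_bounded[OF K(1)] unfolding bounded_pos by (metis real_norm_def)
    have dist: "compact_real_distribution \<mu> r"
      unfolding compact_real_distribution_def compact_real_distribution_axioms_def
      using \<mu>(2) r K(2) by (auto elim!: eventually_mono)
    then show "?quad (moment_fps \<tau> T)"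
      unfolding quad moments[OF dist \<mu>(4)] compact_real_distribution.free_meixner_iff_moments[OF dist, symmetric]
      by (intro \<mu>(1))
  next
    assume Q: "?quad (moment_fps \<tau> T)"
    obtain \<mu> r where \<mu>: "r > 0" "real_distribution \<mu>" "AE y in \<mu>. \<bar>y\<bar> \<le> r"
      "\<And>n. \<tau> (T ^ n) = complex_of_real (\<integral>y. y ^ n \<partial>\<mu>)"
      using ex_distribution[OF T] by blast
    have dist: "compact_real_distribution \<mu> r"
      unfolding compact_real_distribution_def compact_real_distribution_axioms_def
      using \<mu> by auto
    have "free_meixner a b \<mu>"
      unfolding compact_real_distribution.free_meixner_iff_moments[OF dist] moments[OF dist \<mu>(4), symmetric]
      using Q unfolding quad .
    then show "has_free_meixner_law \<tau> T a b"
      using \<mu>(4) unfolding has_free_meixner_law_def has_law_def by (auto simp: free_meixner_def)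
  qed
qed

lemma has_free_meixner_law_iff_cumulants:
  assumes T: "T \<in> A" "self_adjoint T" and v: "v > 0"
  shows "has_free_meixner_law \<tau> ((1 / sqrt v) *\<^sub>R T) (a / sqrt v) (b / v) \<longleftrightarrow>
    cumulant_quadratic (of_real v) (of_real a) (of_real b / of_real v) (cumulant_fps \<tau> [] T)"
proof -
  define c where "c = complex_of_real (1 / sqrt v)"
  have c: "c \<noteq> 0" "1 / c\<^sup>2 = of_real v"
    using v by (simp_all add: c_def power_divide flip: of_real_power)
  note sa = self_adjoint_scaleR[OF T(2), of "1 / sqrt v"]
  have nth: "moment_fps \<tau> ((1 / sqrt v) *\<^sub>R T) $ n = c ^ n * moment_fps \<tau> T $ n" for n
    using closed(7)[OF T(1)] by (simp add: moment_fps_def scaleR_power_bounded_op trace_scaleR c_def)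
  have K0: "cumulant_fps \<tau> [] T $ 0 = 0"
    using trace_one by (simp add: cumulant_fps_def)
  have "complex_of_real (a / sqrt v) = of_real a * c" by (simp add: c_def)
  then show ?thesis
    unfolding has_free_meixner_law_iff_moments[OF closed(5)[OF T(1)] sa]
    using moment_quadratic_rescale[OF c(1) nth, of "of_real a" "of_real (b / v)"]
      moment_quadratic_iff_cumulant_quadratic[OF moment_fps_eq[where \<tau> = \<tau>, OF trace_one] K0, of "of_real v" "of_real a" "of_real b / of_real v"]
    by (simp only: c(2) of_real_divide)
qed

text \<open>Membership of \<open>E\<close> in the hull is assumed, as it is the half of
  \<open>has_cond_exp\<close> that moments do not test. For the other half, \<open>U - E\<close> is
  annihilated against all powers of \<open>V\<close>, hence against the hull.\<close>

lemma has_cond_exp_iff: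
  assumes V: "V \<in> A" "self_adjoint V" and U: "U \<in> A" and E: "E \<in> von_neumann_algebra hull {V, 1}"
  shows "has_cond_exp \<tau> V U E \<longleftrightarrow> (\<forall>n. \<tau> (U * V ^ n) = \<tau> (E * V ^ n))"
proof
  have "V ^ n \<in> von_neumann_algebra hull {V, 1}" for n
    by (simp add: hull_def von_neumann_algebra_closed)
  then show "\<forall>n. \<tau> (U * V ^ n) = \<tau> (E * V ^ n)" if "has_cond_exp \<tau> V U E"
    using that unfolding has_cond_exp_def by blast
next
  assume eq: "\<forall>n. \<tau> (U * V ^ n) = \<tau> (E * V ^ n)"
  have EA: "E \<in> A" using hull_subset[OF V(1)] E by blast
  have diff: "\<tau> ((U - E) * W) = \<tau> (U * W) - \<tau> (E * W)" if "W \<in> A" for W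
    using that U EA closed by (simp add: left_diff_distrib trace_diff)
  have "\<tau> (U * W) = \<tau> (E * W)" if W: "W \<in> von_neumann_algebra hull {V, 1}" for W
  proof -
    have "\<tau> ((U - E) * W) = 0"
      by (rule trace_eq_0_on_hull[OF V closed(6)[OF U EA] _ W]) (use eq diff closed(7)[OF V(1)] in simp)
    then show ?thesis using diff[of W] hull_subset[OF V(1)] W by auto
  qed
  then show "has_cond_exp \<tau> V U E" using E by (simp add: has_cond_exp_def)
qed

end

subsection \<open>The characterization of free Meixner laws\<close>

theorem theorem3p2:
  fixes A :: "'h::complex_hilbert bounded_op set"
    and \<tau> :: "'h bounded_op \<Rightarrow> complex"
    and X Y :: "'h bounded_op"
    and \<alpha> \<beta> a b :: real
  assumes "tracial_von_neumann_algebra A \<tau>"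
    and "X \<in> A" and "Y \<in> A"
    and "self_adjoint X" and "self_adjoint Y"
    and "free_rvs \<tau> [X, Y]"
    and "\<forall>c. X \<noteq> c *\<^sub>C 1" and "\<forall>c. Y \<noteq> c *\<^sub>C 1"
    and "\<tau> X = 0" and "\<tau> Y = 0"
    and "\<tau> (X\<^sup>2 + Y\<^sup>2) = 1"
    and "\<alpha> > 0" and "\<beta> > 0" and "\<alpha> + \<beta> = 1"
    and "b \<ge> -1" and "b < 0 \<Longrightarrow> b \<ge> max (- \<alpha>) (- \<beta>)"
  shows "has_free_meixner_law \<tau> ((1 / sqrt \<alpha>) *\<^sub>R X) (a / sqrt \<alpha>) (b / \<alpha>) \<and>
         has_free_meixner_law \<tau> ((1 / sqrt \<beta>) *\<^sub>R Y) (a / sqrt \<beta>) (b / \<beta>)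
     \<longleftrightarrow>
         has_cond_exp \<tau> (X + Y) X (\<alpha> *\<^sub>R (X + Y)) \<and>
         has_cond_exp \<tau> (X + Y) ((\<beta> *\<^sub>R X - \<alpha> *\<^sub>R Y) * (X + Y) * (\<beta> *\<^sub>R X - \<alpha> *\<^sub>R Y))
           ((\<alpha> * \<beta> / (b + 1)\<^sup>2) *\<^sub>R
             (b\<^sup>2 *\<^sub>R (X + Y) ^ 3 + (2 * b * a) *\<^sub>R (X + Y)\<^sup>2 + (b + a\<^sup>2) *\<^sub>R (X + Y) + a *\<^sub>R 1))"
proof -
  interpret tracial_von_neumann_algebra A \<tau> by fact
  interpret tl: tracial_linear A \<tau> by (rule tracial_linear)
  note X = \<open>X \<in> A\<close> and Y = \<open>Y \<in> A\<close>
  have \<alpha>: "\<alpha> > 0" and \<beta>: "\<beta> > 0" and sum1: "\<alpha> + \<beta> = 1" by fact+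
  \<comment> \<open>For negative b the given maximum exceeds -1, as \<alpha> and \<beta> are below
    1. This makes division by (b + 1)^2 legitimate.\<close>
  have "b > -1" using assms(14-16) \<alpha> \<beta> by (cases "b < 0") auto
  then have "b + 1 \<noteq> 0" by simp
  then have b: "complex_of_real b + 1 \<noteq> 0"
    by (metis of_real_1 of_real_add of_real_eq_0_iff)
  define S where "S = X + Y"
  define D where "D = \<beta> *\<^sub>R X - \<alpha> *\<^sub>R Y"
  define E where "E = b\<^sup>2 *\<^sub>R S ^ 3 + (2 * b * a) *\<^sub>R S\<^sup>2 + (b + a\<^sup>2) *\<^sub>R S + a *\<^sub>R 1"
  have SA: "S \<in> A" "self_adjoint S" and DA: "D \<in> A"
    unfolding S_def D_def by (intro closed self_adjoint_add X Y assms(4,5))+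
  define M where "M = moment_fps \<tau> S"
  define w where "w = fps_X * M"
  define KX where "KX = cumulant_fps \<tau> [] X"
  define KY where "KY = cumulant_fps \<tau> [] Y"
  define KS where "KS = cumulant_fps \<tau> [] S"
  define a' where "a' = complex_of_real a"
  define b' where "b' = complex_of_real b"
  define quad where "quad = cumulant_quadratic 1 a' b'"

  have "(case p of (p, q) \<Rightarrow> p *\<^sub>R X + q *\<^sub>R Y) \<in> A" for p by (cases p) (auto intro: closed X Y)
  \<comment> \<open>A pair (p, q) encodes the letter p X + q Y: (1, 0) is X, (1, 1) is S, and
    (\<beta>, -\<alpha>) is D.\<close>
  note comb = tl.free_cumulant_combination[OF assms(6) this]
  have R_S: "free_cumulant \<tau> (replicate j S) = free_cumulant \<tau> (replicate j X) + free_cumulant \<tau> (replicate j Y)" for j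
    using comb[of "replicate j (1, 1)"] by (simp add: S_def prod_list_replicate_eq_power)
  have R_XS: "free_cumulant \<tau> (X # replicate j S) = free_cumulant \<tau> (replicate (Suc j) X)" for j
    using comb[of "(1, 0) # replicate j (1, 1)"] by (simp add: S_def prod_list_replicate_eq_power)
  have R_DS: "free_cumulant \<tau> (D # replicate j S) =
      of_real \<beta> * free_cumulant \<tau> (replicate (Suc j) X) - of_real \<alpha> * free_cumulant \<tau> (replicate (Suc j) Y)" for j
    using comb[of "(\<beta>, - \<alpha>) # replicate j (1, 1)"] by (simp add: S_def D_def prod_list_replicate_eq_power)
  have R_DSD: "free_cumulant \<tau> (D # S # D # replicate j S) =
      (of_real \<beta>)\<^sup>2 * free_cumulant \<tau> (replicate (j + 3) X) + (of_real \<alpha>)\<^sup>2 * free_cumulant \<tau> (replicate (j + 3) Y)" for j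
    using comb[of "(\<beta>, - \<alpha>) # (1, 1) # (\<beta>, - \<alpha>) # replicate j (1, 1)"]
    by (simp add: S_def D_def prod_list_replicate_eq_power power2_eq_square numeral_3_eq_3)

  have KS_eq: "KS = KX + KY"
    by (simp add: fps_eq_iff KS_def KX_def KY_def cumulant_fps_def R_S)
  have KS0: "KS $ 0 = 0" "KX $ 0 = 0" "KY $ 0 = 0"
    using trace_one by (simp_all add: KS_def KX_def KY_def cumulant_fps_def)
  have trS: "\<tau> S = 0" using X Y assms(9,10) by (simp add: S_def trace_add)
  have KS1: "KS $ 1 = 0"
    using trS trace_one by (simp add: KS_def cumulant_fps_def free_cumulant_single)
  note pair = free_cumulant_pair[where \<tau> = \<tau>, OF trace_one]
  \<comment> \<open>Freeness adds the variances of X and Y, whose sum is normalized to 1.\<close>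
  have R_SS: "free_cumulant \<tau> [S, S] = 1"
    using R_S[of 2] assms(9-11) X Y closed
    by (simp add: numeral_2_eq_2 pair trace_add power2_eq_square)
  have KS2: "KS $ 2 = 1"
    using R_SS by (simp add: KS_def cumulant_fps_def numeral_2_eq_2)
  have M_eq: "M = 1 + (KS oo (fps_X * M))"
    unfolding M_def KS_def by (rule moment_fps_eq[where \<tau> = \<tau>, OF trace_one])
  have M1: "M $ 1 = 0" using trS by (simp add: M_def moment_fps_def)
  have M2: "M $ 2 = 1"
    using R_SS trS by (simp add: M_def moment_fps_def pair power2_eq_square)
  have M0: "M $ 0 \<noteq> 0" using trace_one by (simp add: M_def moment_fps_def)
  then have Mne: "M \<noteq> 0" by auto
  have compose_inj: "F oo w = G oo w \<longleftrightarrow> F = G" for F G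
    unfolding w_def by (rule fps_X_mult_compose_inj[OF M0])

  have one: "fps_const (of_real \<alpha>) * F + fps_const (of_real \<beta>) * F = F" for F :: "complex fps"
  proof -
    have "fps_const (of_real \<alpha>) * F + fps_const (of_real \<beta>) * F = fps_const (of_real (\<alpha> + \<beta>)) * F"
      by (simp only: of_real_add distrib_right flip: fps_const_add)
    then show ?thesis by (simp add: sum1)
  qed

  have cond1: "has_cond_exp \<tau> S X (\<alpha> *\<^sub>R S) \<longleftrightarrow> KX = fps_const (of_real \<alpha>) * KS"
  proof -
    let ?F = "cumulant_fps \<tau> [X] S" and ?G = "cumulant_fps \<tau> [S] S"
    have "\<alpha> *\<^sub>R S \<in> von_neumann_algebra hull {S, 1}"
      by (simp add: hull_def von_neumann_algebra_closed)
    then have "has_cond_exp \<tau> S X (\<alpha> *\<^sub>R S) \<longleftrightarrow> (\<forall>n. \<tau> (X * S ^ n) = of_real \<alpha> * \<tau> (S * S ^ n))"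
      using SA X closed by (simp add: has_cond_exp_iff scaleR_mult_left trace_scaleR)
    also have "\<dots> \<longleftrightarrow> Abs_fps (\<lambda>n. \<tau> (X * S ^ n)) = fps_const (of_real \<alpha>) * Abs_fps (\<lambda>n. \<tau> (S * S ^ n))"
      by (simp add: fps_eq_iff)
    also have "\<dots> \<longleftrightarrow> M * (?F oo w) = M * ((fps_const (of_real \<alpha>) * ?G) oo w)"
      unfolding trace_mult_power_eq[where \<tau> = \<tau>, OF trace_one] M_def[symmetric] w_def[symmetric]
      by (simp add: fps_compose_mult_distrib w_def mult_ac)
    also have "\<dots> \<longleftrightarrow> ?F = fps_const (of_real \<alpha>) * ?G"
      using Mne by (simp add: compose_inj)
    \<comment> \<open>The factor z restores the indexing by the number of letters; the constant
      coefficient it introduces matches the cumulant 0 of the empty list.\<close>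
    also have "\<dots> \<longleftrightarrow> fps_X * ?F = fps_X * (fps_const (of_real \<alpha>) * ?G)" by simp
    also have "fps_X * ?F = KX"
    proof (rule fps_ext)
      show "(fps_X * ?F) $ n = KX $ n" for n
        using KS0 by (cases n) (simp_all add: KX_def cumulant_fps_def R_XS)
    qed
    also have "fps_X * (fps_const (of_real \<alpha>) * ?G) = fps_const (of_real \<alpha>) * (fps_X * ?G)" by (simp only: mult_ac)
    also have "fps_X * ?G = KS"
    proof (rule fps_ext)
      show "(fps_X * ?G) $ n = KS $ n" for n
        using KS0 by (cases n) (simp_all add: KS_def cumulant_fps_def)
    qed
    finally show ?thesis .
  qed

  \<comment> \<open>The cumulants of one D with copies of S are known to vanish only given the first
    condition. For an equivalence of conjunctions this is enough.\<close>
  have cond2: "has_cond_exp \<tau> S (D * S * D) ((\<alpha> * \<beta> / (b + 1)\<^sup>2) *\<^sub>R E) \<longleftrightarrow> quad KS"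
    if KX: "KX = fps_const (of_real \<alpha>) * KS"
  proof -
    have KY: "KY = fps_const (of_real \<beta>) * KS"
      using one[of KS] KS_eq KX by (metis add_left_cancel)
    have RX: "free_cumulant \<tau> (replicate j X) = of_real \<alpha> * KS $ j"
      and RY: "free_cumulant \<tau> (replicate j Y) = of_real \<beta> * KS $ j" for j
      using arg_cong[OF KX, of "\<lambda>F. F $ j"] arg_cong[OF KY, of "\<lambda>F. F $ j"]
      by (simp_all add: KX_def KY_def cumulant_fps_def)
    \<comment> \<open>The coefficients of D are made for this: the contributions \<beta> \<alpha>
      and - \<alpha> \<beta> cancel.\<close>
    have "free_cumulant \<tau> (D # replicate j S) = 0" for j
      unfolding R_DS RX RY by simp
    note sandwich = trace_sandwich_eq[where \<tau> = \<tau>, OF trace_one trS this]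
    \<comment> \<open>This is the origin of the constant \<alpha> \<beta> in the second condition:
      \<beta>^2 \<alpha> + \<alpha>^2 \<beta> = \<alpha> \<beta> (\<alpha> + \<beta>).\<close>
    have "(of_real \<beta>)\<^sup>2 * (of_real \<alpha> * x) + (of_real \<alpha>)\<^sup>2 * (of_real \<beta> * x) = of_real (\<alpha> * \<beta>) * (x::complex)" for x
    proof -
      have "(of_real \<beta>)\<^sup>2 * (of_real \<alpha> * x) + (of_real \<alpha>)\<^sup>2 * (of_real \<beta> * x) = of_real (\<alpha> * \<beta>) * of_real (\<alpha> + \<beta>) * x"
        by (simp add: power2_eq_square algebra_simps)
      then show ?thesis by (simp add: sum1)
    qed
    then have k3: "cumulant_fps \<tau> [D, S, D] S = fps_const (of_real (\<alpha> * \<beta>)) * fps_shift 3 KS"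
      by (simp only: fps_eq_iff cumulant_fps_def fps_nth_Abs_fps append_Cons append_Nil R_DSD RX RY
          fps_mult_left_const_nth fps_shift_nth simp_thms)
    define F where "F = Abs_fps (\<lambda>n. \<tau> (E * S ^ n))"
    have F: "F $ n = b'\<^sup>2 * M $ (n + 3) + 2 * b' * a' * M $ (n + 2) + (b' + a'\<^sup>2) * M $ (n + 1) + a' * M $ n" for n
    proof -
      have "E * S ^ n = b\<^sup>2 *\<^sub>R S ^ (n + 3) + (2 * b * a) *\<^sub>R S ^ (n + 2) + (b + a\<^sup>2) *\<^sub>R S ^ (n + 1) + a *\<^sub>R S ^ n"
        by (simp add: E_def distrib_right scaleR_mult_left power_add[symmetric] add.commute[of n])
      then show ?thesis
        using SA closed by (simp add: F_def M_def moment_fps_def trace_add trace_scaleR a'_def b'_def)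
    qed
    have EA: "E \<in> A" unfolding E_def by (intro closed SA)
    have "(\<alpha> * \<beta> / (b + 1)\<^sup>2) *\<^sub>R E \<in> von_neumann_algebra hull {S, 1}"
      by (simp add: hull_def von_neumann_algebra_closed E_def)
    then have "has_cond_exp \<tau> S (D * S * D) ((\<alpha> * \<beta> / (b + 1)\<^sup>2) *\<^sub>R E) \<longleftrightarrow>
        (\<forall>n. \<tau> (D * S * D * S ^ n) = of_real (\<alpha> * \<beta> / (b + 1)\<^sup>2) * \<tau> (E * S ^ n))"
      using SA DA EA closed by (simp only: has_cond_exp_iff scaleR_mult_left trace_scaleR)
    also have "\<dots> \<longleftrightarrow> Abs_fps (\<lambda>n. \<tau> (D * S * D * S ^ n)) = fps_const (of_real (\<alpha> * \<beta> / (b + 1)\<^sup>2)) * F"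
      by (simp only: fps_eq_iff fps_nth_Abs_fps fps_mult_left_const_nth F_def)
    also have "Abs_fps (\<lambda>n. \<tau> (D * S * D * S ^ n)) = fps_const (of_real (\<alpha> * \<beta>)) * (M * (fps_shift 3 KS oo w))"
      unfolding sandwich k3 M_def[symmetric] w_def[symmetric]
      by (simp add: fps_compose_mult_distrib w_def mult_ac)
    also have "fps_const (of_real (\<alpha> * \<beta> / (b + 1)\<^sup>2)) * F = fps_const (of_real (\<alpha> * \<beta>)) * (fps_const (1 / (b' + 1)\<^sup>2) * F)"
      by (simp add: mult.assoc[symmetric] b'_def)
    also have "fps_const (of_real (\<alpha> * \<beta>)) * (M * (fps_shift 3 KS oo w)) = fps_const (of_real (\<alpha> * \<beta>)) * (fps_const (1 / (b' + 1)\<^sup>2) * F)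
        \<longleftrightarrow> M * (fps_shift 3 KS oo w) = fps_const (1 / (b' + 1)\<^sup>2) * F"
      using \<alpha> \<beta> by (intro mult_left_cancel) simp
    also have "\<dots> \<longleftrightarrow> fps_const ((b' + 1)\<^sup>2) * (M * (fps_shift 3 KS oo w)) = F"
    proof -
      have "fps_const ((b' + 1)\<^sup>2) * fps_const (1 / (b' + 1)\<^sup>2) = 1"
        "fps_const (1 / (b' + 1)\<^sup>2) * fps_const ((b' + 1)\<^sup>2) = 1"
        using b by (simp_all add: b'_def)
      then have "fps_const ((b' + 1)\<^sup>2) * (fps_const (1 / (b' + 1)\<^sup>2) * F) = F"
        "fps_const (1 / (b' + 1)\<^sup>2) * (fps_const ((b' + 1)\<^sup>2) * G) = G" for G
        by (simp_all only: mult.assoc[symmetric] mult_1)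
      then show ?thesis by metis
    qed
    also have "\<dots> \<longleftrightarrow> quad KS"
      unfolding quad_def w_def
      by (rule conditional_variance_iff_cumulant_quadratic[OF M_eq M1 M2 KS0(1) KS1 KS2 _ F])
        (use b in \<open>simp add: b'_def\<close>)
    finally show ?thesis .
  qed

  \<comment> \<open>Dividing the cumulants by v brings both laws under one equation, whose
    parameters 1, a and b do not depend on v.\<close>
  have law: "has_free_meixner_law \<tau> ((1 / sqrt v) *\<^sub>R T) (a / sqrt v) (b / v) \<longleftrightarrow>
      quad (fps_const (of_real (1 / v)) * cumulant_fps \<tau> [] T)"
    if T: "T \<in> A" "self_adjoint T" and v: "v > 0" for T v
  proof -
    let ?K = "fps_const (of_real (1 / v)) * cumulant_fps \<tau> [] T"
    have v0: "complex_of_real v \<noteq> 0" using v by simp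
    have K: "fps_const (of_real v) * ?K = cumulant_fps \<tau> [] T"
      using v0 by (simp add: mult.assoc[symmetric])
    show ?thesis
      unfolding has_free_meixner_law_iff_cumulants[OF T v] quad_def a'_def b'_def
      using cumulant_quadratic_scale[OF v0, of "of_real a" "of_real b" ?K] unfolding K .
  qed

  have scale: "fps_const (of_real v) * (fps_const (of_real (1 / v)) * F) = F"
    "fps_const (of_real (1 / v)) * (fps_const (of_real v) * F) = F" if "v > 0" for v :: real and F :: "complex fps"
    using that by (simp_all add: mult.assoc[symmetric])
  define kX where "kX = fps_const (of_real (1 / \<alpha>)) * KX"
  define kY where "kY = fps_const (of_real (1 / \<beta>)) * KY"
  have scaled: "KX = fps_const (of_real \<alpha>) * kX" "KY = fps_const (of_real \<beta>) * kY"
    unfolding kX_def kY_def by (simp_all only: scale(1) \<alpha> \<beta>)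
  \<comment> \<open>Uniqueness of the solution gives \<open>kX = kY\<close>, and then \<alpha> +
    \<beta> = 1 identifies the common series with \<open>KS\<close>.\<close>
  have "quad kX \<and> quad kY \<longleftrightarrow> KX = fps_const (of_real \<alpha>) * KS \<and> quad KS"
  proof
    assume q: "quad kX \<and> quad kY"
    moreover have "kX $ 0 = 0" "kY $ 0 = 0" by (simp_all add: kX_def kY_def KS0)
    ultimately have "kX = kY"
      unfolding quad_def by (intro cumulant_quadratic_unique[of 1 a' b' kX kY]) auto
    then have "KS = kX" using one[of kX] KS_eq scaled by metis
    then show "KX = fps_const (of_real \<alpha>) * KS \<and> quad KS"
      using q scaled by simp
  next
    assume q: "KX = fps_const (of_real \<alpha>) * KS \<and> quad KS"
    then have "KY = fps_const (of_real \<beta>) * KS"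
      using one[of KS] KS_eq by (metis add_left_cancel)
    then have "kX = KS" "kY = KS" unfolding kX_def kY_def using q by (simp_all only: scale(2) \<alpha> \<beta>)
    then show "quad kX \<and> quad kY" using q by simp
  qed
  then show ?thesis
    unfolding law[OF X assms(4) \<alpha>] law[OF Y assms(5) \<beta>]
    unfolding KX_def[symmetric] KY_def[symmetric] kX_def[symmetric] kY_def[symmetric]
    unfolding S_def[symmetric] D_def[symmetric] E_def[symmetric]
    using cond1 cond2 by blast
qed

end
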